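(* (1) There exist maps of triangles (in some triangulated category) which are not middling good. (2) There exist maps of triangles (in some triangulated category) which are middling good but neither good nor Verdier good. (3) Middling goodness is not invariant under chain homotopy: there exist (in some triangulated category) two chain homotopic maps of triangles, one of which is middling good and the other of which is not.
   Context: Work in a triangulated category with self-equivalence $\Sigma$. "Exact triangle" or "triangle" means distinguished triangle. A map of triangles $(f,g,h)$ from $X\xrightarrow{u}Y\xrightarrow{v}Z\xrightarrow{w}\Sigma X$ to $X'\xrightarrow{u'}Y'\xrightarrow{v'}Z'\xrightarrow{w'}\Sigma X'$ consists of $f\colon X\to X'$, $g\colon Y\to Y'$, $h\colon Z\to Z'$ with $gu=u'f$, $hv=v'g$, $(\Sigma f)w=w'h$. Two maps of triangles $(f,g,h)$ and $(\bar f,\bar g,\bar h)$ with the same source and target are chain homotopic if there are maps $F\colon Y\to X'$, $G\colon Z\to Y'$, $H\colon\Sigma X\to Z'$ with $\bar f-f=Fu+\Sigma^{-1}(w'H)$, $\bar g-g=Gv+u'F$, $\bar h-h=Hw+v'G$. Good: the mapping cone of $(f,g,h)$ is the sequence $X'\oplus Y\to Y'\oplus Z\to Z'\oplus\Sigma X\to\Sigma X'\oplus\Sigma Y$ with successive maps $\begin{bmatrix}u'&g\\0&-v\end{bmatrix},\begin{bmatrix}v'&h\\0&-w\end{bmatrix},\begin{bmatrix}w'&\Sigma f\\0&-\Sigma u\end{bmatrix}$ (acting on column vectors). $(f,g,h)$ is good if its mapping cone is an exact triangle. Middling good: $(f,g,h)$ is middling good if there are exact triangles $X\xrightarrow{f}X'\xrightarrow{f'}X''\xrightarrow{f''}\Sigma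 X$, $Y\xrightarrow{g}Y'\xrightarrow{g'}Y''\xrightarrow{g''}\Sigma Y$, $Z\xrightarrow{h}Z'\xrightarrow{h'}Z''\xrightarrow{h''}\Sigma Z$ and an exact triangle $X''\xrightarrow{u''}Y''\xrightarrow{v''}Z''\xrightarrow{w''}\Sigma X''$ with $g'u'=u''f'$, $h'v'=v''g'$, $(\Sigma f')w'=w''h'$, $g''u''=(\Sigma u)f''$, $h''v''=(\Sigma v)g''$ and $(\Sigma f'')w''=-(\Sigma w)h''$. Octahedra: given composable maps $P\xrightarrow{a}Q\xrightarrow{b}R$ and exact triangles $P\xrightarrow{a}Q\xrightarrow{a'}C_a\xrightarrow{a''}\Sigma P$, $Q\xrightarrow{b}R\xrightarrow{b'}C_b\xrightarrow{b''}\Sigma Q$, $P\xrightarrow{ba}R\xrightarrow{c'}C\xrightarrow{c''}\Sigma P$, an octahedron for the composite $ba$ consists of maps $\alpha\colon C_a\to C$, $\beta\colon C\to C_b$, $\gamma\colon C_b\to\Sigma C_a$ such that $C_a\xrightarrow{\alpha}C\xrightarrow{\beta}C_b\xrightarrow{\gamma}\Sigma C_a$ is exact and $\alpha a'=c'b$, $c''\alpha=a''$, $\beta c'=b'$, $\gamma=(\Sigma a')b''$, $b''\beta=(\Sigma a)c''$. Verdier good: choose exact triangles $X\xrightarrow{f}X'\xrightarrow{f'}X''\xrightarrow{f''}\Sigma X$, $Y\xrightarrow{g}Y'\xrightarrow{g'}Y''\xrightarrow{g''}\Sigma Y$ and $X\xrightarrow{gu=u'f}Y'\xrightarrow{\tilde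 v}A\xrightarrow{\tilde w}\Sigma X$. The map $(f,g,h)$ is Verdier good if there exist an octahedron $(\alpha_1\colon Z\to A,\ \beta_1\colon A\to Y'',\ \gamma_1)$ for the composite $X\xrightarrow{u}Y\xrightarrow{g}Y'$ and an octahedron $(\alpha_2\colon X''\to A,\ \beta_2\colon A\to Z',\ \gamma_2)$ for the composite $X\xrightarrow{f}X'\xrightarrow{u'}Y'$ (both using the given and chosen triangles, in particular the same triangle on $gu=u'f$) such that $h=\beta_2\alpha_1$. This does not depend on the chosen triangles. *)

theory Defs
  imports "HOL-Algebra.Group"
begin

section \<open>Categories\<close>

text \<open>
  Small categories, with objects in a type \<open>'o\<close> and arrows in a type \<open>'m\<close>.  Every arrow has one
  domain and one codomain, and \<open>g \<cdot> f\<close> means \<open>g\<close> after \<open>f\<close>; it is meaningful only for composable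
  arrows.
\<close>

record ('o, 'm) cat =
  Ob  :: "'o set"
  Arr :: "'m set"
  Dom :: "'m \<Rightarrow> 'o"
  Cod :: "'m \<Rightarrow> 'o"
  Id  :: "'o \<Rightarrow> 'm"
  Comp :: "'m \<Rightarrow> 'm \<Rightarrow> 'm"  (infixl "\<cdot>\<index>" 75)

definition Hom :: "('o, 'm, 'b) cat_scheme \<Rightarrow> 'o \<Rightarrow> 'o \<Rightarrow> 'm set" where
  "Hom C X Y = {f \<in> Arr C. Dom C f = X \<and> Cod C f = Y}"

locale category =
  fixes C :: "('o, 'm, 'b) cat_scheme" (structure)
  assumes dom_in_Ob: "f \<in> Arr C \<Longrightarrow> Dom C f \<in> Ob C"
    and cod_in_Ob: "f \<in> Arr C \<Longrightarrow> Cod C f \<in> Ob C"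
    and id_in_Hom: "X \<in> Ob C \<Longrightarrow> Id C X \<in> Hom C X X"
    and comp_in_Hom: "\<lbrakk>f \<in> Hom C X Y; g \<in> Hom C Y Z\<rbrakk> \<Longrightarrow> g \<cdot> f \<in> Hom C X Z"
    and comp_id: "f \<in> Hom C X Y \<Longrightarrow> f \<cdot> Id C X = f"
    and id_comp: "f \<in> Hom C X Y \<Longrightarrow> Id C Y \<cdot> f = f"
    and comp_assoc: "\<lbrakk>f \<in> Hom C W X; g \<in> Hom C X Y; h \<in> Hom C Y Z\<rbrakk>
      \<Longrightarrow> (h \<cdot> g) \<cdot> f = h \<cdot> (g \<cdot> f)"

definition is_iso :: "('o, 'm, 'b) cat_scheme \<Rightarrow> 'o \<Rightarrow> 'o \<Rightarrow> 'm \<Rightarrow> bool" where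
  "is_iso C X Y f \<longleftrightarrow> f \<in> Hom C X Y \<and>
     (\<exists>g \<in> Hom C Y X. g \<cdot>\<^bsub>C\<^esub> f = Id C X \<and> f \<cdot>\<^bsub>C\<^esub> g = Id C Y)"

definition zero_object :: "('o, 'm, 'b) cat_scheme \<Rightarrow> 'o \<Rightarrow> bool" where
  "zero_object C Z \<longleftrightarrow> Z \<in> Ob C \<and>
     (\<forall>X \<in> Ob C. (\<exists>!f. f \<in> Hom C X Z) \<and> (\<exists>!f. f \<in> Hom C Z X))"

definition endofunctor :: "('o, 'm, 'b) cat_scheme \<Rightarrow> ('o \<Rightarrow> 'o) \<Rightarrow> ('m \<Rightarrow> 'm) \<Rightarrow> bool" where
  "endofunctor C F\<^sub>o F\<^sub>m \<longleftrightarrow>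
     (\<forall>X \<in> Ob C. F\<^sub>o X \<in> Ob C \<and> F\<^sub>m (Id C X) = Id C (F\<^sub>o X)) \<and>
     (\<forall>X Y. \<forall>f \<in> Hom C X Y. F\<^sub>m f \<in> Hom C (F\<^sub>o X) (F\<^sub>o Y)) \<and>
     (\<forall>X Y Z. \<forall>f \<in> Hom C X Y. \<forall>g \<in> Hom C Y Z. F\<^sub>m (g \<cdot>\<^bsub>C\<^esub> f) = F\<^sub>m g \<cdot>\<^bsub>C\<^esub> F\<^sub>m f)"

definition natural_iso ::
  "('o, 'm, 'b) cat_scheme \<Rightarrow> ('o \<Rightarrow> 'o) \<Rightarrow> ('m \<Rightarrow> 'm) \<Rightarrow> ('o \<Rightarrow> 'o) \<Rightarrow> ('m \<Rightarrow> 'm) \<Rightarrow> ('o \<Rightarrow> 'm) \<Rightarrow> bool" where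
  "natural_iso C F\<^sub>o F\<^sub>m G\<^sub>o G\<^sub>m \<eta> \<longleftrightarrow>
     (\<forall>X \<in> Ob C. is_iso C (F\<^sub>o X) (G\<^sub>o X) (\<eta> X)) \<and>
     (\<forall>X Y. \<forall>f \<in> Hom C X Y. \<eta> Y \<cdot>\<^bsub>C\<^esub> F\<^sub>m f = G\<^sub>m f \<cdot>\<^bsub>C\<^esub> \<eta> X)"

definition self_equivalence :: "('o, 'm, 'b) cat_scheme \<Rightarrow> ('o \<Rightarrow> 'o) \<Rightarrow> ('m \<Rightarrow> 'm) \<Rightarrow> bool" where
  "self_equivalence C F\<^sub>o F\<^sub>m \<longleftrightarrow> endofunctor C F\<^sub>o F\<^sub>m \<and>
     (\<exists>G\<^sub>o G\<^sub>m \<eta> \<epsilon>. endofunctor C G\<^sub>o G\<^sub>m \<and>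
        natural_iso C id id (G\<^sub>o \<circ> F\<^sub>o) (G\<^sub>m \<circ> F\<^sub>m) \<eta> \<and>
        natural_iso C (F\<^sub>o \<circ> G\<^sub>o) (F\<^sub>m \<circ> G\<^sub>m) id id \<epsilon>)"


section \<open>Additive categories\<close>

record ('o, 'm) precat = "('o, 'm) cat" +
  Add  :: "'m \<Rightarrow> 'm \<Rightarrow> 'm"  (infixl "\<boxplus>\<index>" 65)
  Zero :: "'o \<Rightarrow> 'o \<Rightarrow> 'm"

definition hom_group :: "('o, 'm, 'b) precat_scheme \<Rightarrow> 'o \<Rightarrow> 'o \<Rightarrow> 'm monoid" where
  "hom_group C X Y = \<lparr>carrier = Hom C X Y, mult = Add C, one = Zero C X Y\<rparr>"

definition neg :: "('o, 'm, 'b) precat_scheme \<Rightarrow> 'm \<Rightarrow> 'm" where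
  "neg C f = inv\<^bsub>hom_group C (Dom C f) (Cod C f)\<^esub> f"

definition sub :: "('o, 'm, 'b) precat_scheme \<Rightarrow> 'm \<Rightarrow> 'm \<Rightarrow> 'm" where
  "sub C f g = f \<boxplus>\<^bsub>C\<^esub> neg C g"

text \<open>A biproduct diagram of \<open>X\<close> and \<open>Y\<close>: the object, its two injections and its two projections.\<close>

type_synonym ('o, 'm) biprod = "'o \<times> 'm \<times> 'm \<times> 'm \<times> 'm"

fun biproduct :: "('o, 'm, 'b) precat_scheme \<Rightarrow> 'o \<Rightarrow> 'o \<Rightarrow> ('o, 'm) biprod \<Rightarrow> bool" where
  "biproduct C X Y (S, i, j, p, q) \<longleftrightarrow>
     i \<in> Hom C X S \<and> j \<in> Hom C Y S \<and> p \<in> Hom C S X \<and> q \<in> Hom C S Y \<and>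
     p \<cdot>\<^bsub>C\<^esub> i = Id C X \<and> q \<cdot>\<^bsub>C\<^esub> j = Id C Y \<and>
     p \<cdot>\<^bsub>C\<^esub> j = Zero C Y X \<and> q \<cdot>\<^bsub>C\<^esub> i = Zero C X Y \<and>
     (i \<cdot>\<^bsub>C\<^esub> p) \<boxplus>\<^bsub>C\<^esub> (j \<cdot>\<^bsub>C\<^esub> q) = Id C S"

locale additive_category = category C
  for C :: "('o, 'm, 'b) precat_scheme" (structure) +
  assumes hom_comm_group: "\<lbrakk>X \<in> Ob C; Y \<in> Ob C\<rbrakk> \<Longrightarrow> comm_group (hom_group C X Y)"
    and comp_add_left: "\<lbrakk>f \<in> Hom C X Y; g \<in> Hom C Y Z; g' \<in> Hom C Y Z\<rbrakk>
      \<Longrightarrow> (g \<boxplus> g') \<cdot> f = (g \<cdot> f) \<boxplus> (g' \<cdot> f)"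
    and comp_add_right: "\<lbrakk>f \<in> Hom C X Y; f' \<in> Hom C X Y; g \<in> Hom C Y Z\<rbrakk>
      \<Longrightarrow> g \<cdot> (f \<boxplus> f') = (g \<cdot> f) \<boxplus> (g \<cdot> f')"
    and ex_zero_object: "\<exists>Z. zero_object C Z"
    and ex_biproduct: "\<lbrakk>X \<in> Ob C; Y \<in> Ob C\<rbrakk> \<Longrightarrow> \<exists>B. biproduct C X Y B"


section \<open>Triangulated categories\<close>

text \<open>
  \<open>ShO\<close> and \<open>Sh\<close> are the object and arrow parts of the suspension \<open>\<Sigma>\<close>.  A sequence
  \<open>X \<rightarrow> Y \<rightarrow> Z \<rightarrow> \<Sigma> X\<close> is given by its three maps; \<open>Tri\<close> is the class of exact triangles.
\<close>

type_synonym 'm triple = "'m \<times> 'm \<times> 'm"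

record ('o, 'm) tricat = "('o, 'm) precat" +
  ShO :: "'o \<Rightarrow> 'o"
  Sh  :: "'m \<Rightarrow> 'm"
  Tri :: "'m triple set"

fun candidate :: "('o, 'm, 'b) tricat_scheme \<Rightarrow> 'm triple \<Rightarrow> bool" where
  "candidate C (u, v, w) \<longleftrightarrow> (\<exists>X Y Z. u \<in> Hom C X Y \<and> v \<in> Hom C Y Z \<and> w \<in> Hom C Z (ShO C X))"

text \<open>The commutativity conditions defining a map \<open>(f, g, h)\<close> between two sequences.\<close>

fun candidate_map :: "('o, 'm, 'b) tricat_scheme \<Rightarrow> 'm triple \<Rightarrow> 'm triple \<Rightarrow> 'm triple \<Rightarrow> bool" where
  "candidate_map C (u, v, w) (u', v', w') (f, g, h) \<longleftrightarrow>
     candidate C (u, v, w) \<and> candidate C (u', v', w') \<and>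
     f \<in> Hom C (Dom C u) (Dom C u') \<and>
     g \<in> Hom C (Dom C v) (Dom C v') \<and>
     h \<in> Hom C (Dom C w) (Dom C w') \<and>
     g \<cdot>\<^bsub>C\<^esub> u = u' \<cdot>\<^bsub>C\<^esub> f \<and> h \<cdot>\<^bsub>C\<^esub> v = v' \<cdot>\<^bsub>C\<^esub> g \<and> Sh C f \<cdot>\<^bsub>C\<^esub> w = w' \<cdot>\<^bsub>C\<^esub> h"

fun candidate_iso :: "('o, 'm, 'b) tricat_scheme \<Rightarrow> 'm triple \<Rightarrow> 'm triple \<Rightarrow> 'm triple \<Rightarrow> bool" where
  "candidate_iso C (u, v, w) (u', v', w') (f, g, h) \<longleftrightarrow>
     candidate_map C (u, v, w) (u', v', w') (f, g, h) \<and>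
     is_iso C (Dom C u) (Dom C u') f \<and>
     is_iso C (Dom C v) (Dom C v') g \<and>
     is_iso C (Dom C w) (Dom C w') h"

text \<open>
  \<open>octahedron C (a, a', a'') (b, b', b'') (c, c', c'') (\<alpha>, \<beta>, \<gamma>)\<close>: an octahedron for the
  composite \<open>c = b \<cdot> a\<close>, relative to the given exact triangles on \<open>a\<close>, \<open>b\<close> and \<open>c\<close>.
\<close>

fun octahedron ::
  "('o, 'm, 'b) tricat_scheme \<Rightarrow> 'm triple \<Rightarrow> 'm triple \<Rightarrow> 'm triple \<Rightarrow> 'm triple \<Rightarrow> bool" where
  "octahedron C (a, a', a'') (b, b', b'') (c, c', c'') (\<alpha>, \<beta>, \<gamma>) \<longleftrightarrow>
     Dom C b = Cod C a \<and> c = b \<cdot>\<^bsub>C\<^esub> a \<and>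
     (a, a', a'') \<in> Tri C \<and> (b, b', b'') \<in> Tri C \<and> (c, c', c'') \<in> Tri C \<and>
     \<alpha> \<in> Hom C (Cod C a') (Cod C c') \<and>
     \<beta> \<in> Hom C (Cod C c') (Cod C b') \<and>
     \<gamma> \<in> Hom C (Cod C b') (ShO C (Cod C a')) \<and>
     (\<alpha>, \<beta>, \<gamma>) \<in> Tri C \<and>
     \<alpha> \<cdot>\<^bsub>C\<^esub> a' = c' \<cdot>\<^bsub>C\<^esub> b \<and> c'' \<cdot>\<^bsub>C\<^esub> \<alpha> = a'' \<and>
     \<beta> \<cdot>\<^bsub>C\<^esub> c' = b' \<and> \<gamma> = Sh C a' \<cdot>\<^bsub>C\<^esub> b'' \<and>
     b'' \<cdot>\<^bsub>C\<^esub> \<beta> = Sh C a \<cdot>\<^bsub>C\<^esub> c''"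

locale triangulated_category = additive_category C
  for C :: "('o, 'm, 'b) tricat_scheme" (structure) +
  assumes shift_equivalence: "self_equivalence C (ShO C) (Sh C)"
    and shift_add: "\<lbrakk>f \<in> Hom C X Y; f' \<in> Hom C X Y\<rbrakk> \<Longrightarrow> Sh C (f \<boxplus> f') = Sh C f \<boxplus> Sh C f'"
    and tri_candidate: "T \<in> Tri C \<Longrightarrow> candidate C T"
    and tri_iso_closed: "\<lbrakk>T \<in> Tri C; candidate_iso C T T' \<phi>\<rbrakk> \<Longrightarrow> T' \<in> Tri C"
    and tri_id: "\<lbrakk>X \<in> Ob C; zero_object C Z\<rbrakk>
      \<Longrightarrow> (Id C X, Zero C X Z, Zero C Z (ShO C X)) \<in> Tri C"
    and tri_ex: "u \<in> Arr C \<Longrightarrow> \<exists>v w. (u, v, w) \<in> Tri C"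
    and tri_rotate: "candidate C (u, v, w)
      \<Longrightarrow> (u, v, w) \<in> Tri C \<longleftrightarrow> (v, w, neg C (Sh C u)) \<in> Tri C"
    and tri_fill_in: "\<lbrakk>(u, v, w) \<in> Tri C; (u', v', w') \<in> Tri C;
        f \<in> Hom C (Dom C u) (Dom C u'); g \<in> Hom C (Cod C u) (Cod C u'); g \<cdot> u = u' \<cdot> f\<rbrakk>
      \<Longrightarrow> \<exists>h. candidate_map C (u, v, w) (u', v', w') (f, g, h)"
    and tri_octahedron: "\<lbrakk>(a, a', a'') \<in> Tri C; (b, b', b'') \<in> Tri C; (b \<cdot> a, c', c'') \<in> Tri C;
        Dom C b = Cod C a\<rbrakk>
      \<Longrightarrow> \<exists>\<omega>. octahedron C (a, a', a'') (b, b', b'') (b \<cdot> a, c', c'') \<omega>"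


section \<open>Maps of triangles\<close>

definition triangle_map :: "('o, 'm, 'b) tricat_scheme \<Rightarrow> 'm triple \<Rightarrow> 'm triple \<Rightarrow> 'm triple \<Rightarrow> bool" where
  "triangle_map C T T' \<phi> \<longleftrightarrow> T \<in> Tri C \<and> T' \<in> Tri C \<and> candidate_map C T T' \<phi>"

text \<open>
  As \<open>\<Sigma>\<close> is fully faithful, \<open>\<Sigma>\<^sup>-\<^sup>1 (w' \<cdot> H)\<close>, for \<open>w' \<cdot> H : \<Sigma> X \<rightarrow> \<Sigma> X'\<close>, is the unique arrow
  \<open>X \<rightarrow> X'\<close> that \<open>\<Sigma>\<close> sends to \<open>w' \<cdot> H\<close>.
\<close>

fun chain_homotopic ::
  "('o, 'm, 'b) tricat_scheme \<Rightarrow> 'm triple \<Rightarrow> 'm triple \<Rightarrow> 'm triple \<Rightarrow> 'm triple \<Rightarrow> bool" where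
  "chain_homotopic C (u, v, w) (u', v', w') (f, g, h) (k, l, m) \<longleftrightarrow>
     (\<exists>F G H.
        F \<in> Hom C (Cod C u) (Dom C u') \<and>
        G \<in> Hom C (Cod C v) (Cod C u') \<and>
        H \<in> Hom C (ShO C (Dom C u)) (Cod C v') \<and>
        sub C k f = (F \<cdot>\<^bsub>C\<^esub> u) \<boxplus>\<^bsub>C\<^esub> inv_into (Hom C (Dom C u) (Dom C u')) (Sh C) (w' \<cdot>\<^bsub>C\<^esub> H) \<and>
        sub C l g = (G \<cdot>\<^bsub>C\<^esub> v) \<boxplus>\<^bsub>C\<^esub> (u' \<cdot>\<^bsub>C\<^esub> F) \<and>
        sub C m h = (H \<cdot>\<^bsub>C\<^esub> w) \<boxplus>\<^bsub>C\<^esub> (v' \<cdot>\<^bsub>C\<^esub> G))"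

text \<open>
  \<open>upper_matrix C i j p q a b d\<close> is the arrow between biproducts with matrix \<open>[a b; 0 d]\<close> acting on
  column vectors, where \<open>p\<close>, \<open>q\<close> are the projections of the source and \<open>i\<close>, \<open>j\<close> the injections of
  the target.
\<close>

definition upper_matrix ::
  "('o, 'm, 'b) precat_scheme \<Rightarrow> 'm \<Rightarrow> 'm \<Rightarrow> 'm \<Rightarrow> 'm \<Rightarrow> 'm \<Rightarrow> 'm \<Rightarrow> 'm \<Rightarrow> 'm" where
  "upper_matrix C i j p q a b d =
     (i \<cdot>\<^bsub>C\<^esub> a \<cdot>\<^bsub>C\<^esub> p) \<boxplus>\<^bsub>C\<^esub> (i \<cdot>\<^bsub>C\<^esub> b \<cdot>\<^bsub>C\<^esub> q) \<boxplus>\<^bsub>C\<^esub> (j \<cdot>\<^bsub>C\<^esub> d \<cdot>\<^bsub>C\<^esub> q)"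

text \<open>
  The mapping cone, formed with biproduct diagrams of \<open>X' \<oplus> Y\<close>, \<open>Y' \<oplus> Z\<close> and \<open>Z' \<oplus> \<Sigma> X\<close>.
  Its last object \<open>\<Sigma> X' \<oplus> \<Sigma> Y\<close> is identified with \<open>\<Sigma> (X' \<oplus> Y)\<close> by taking the latter, with
  injections \<open>\<Sigma> i\<^sub>1\<close> and \<open>\<Sigma> j\<^sub>1\<close>, as the biproduct of \<open>\<Sigma> X'\<close> and \<open>\<Sigma> Y\<close>.
\<close>

fun mapping_cone ::
  "('o, 'm, 'b) tricat_scheme \<Rightarrow> 'm triple \<Rightarrow> 'm triple \<Rightarrow> 'm triple \<Rightarrow>
   ('o, 'm) biprod \<Rightarrow> ('o, 'm) biprod \<Rightarrow> ('o, 'm) biprod \<Rightarrow> 'm triple" where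
  "mapping_cone C (u, v, w) (u', v', w') (f, g, h)
     (S\<^sub>1, i\<^sub>1, j\<^sub>1, p\<^sub>1, q\<^sub>1) (S\<^sub>2, i\<^sub>2, j\<^sub>2, p\<^sub>2, q\<^sub>2) (S\<^sub>3, i\<^sub>3, j\<^sub>3, p\<^sub>3, q\<^sub>3) =
     (upper_matrix C i\<^sub>2 j\<^sub>2 p\<^sub>1 q\<^sub>1 u' g (neg C v),
      upper_matrix C i\<^sub>3 j\<^sub>3 p\<^sub>2 q\<^sub>2 v' h (neg C w),
      upper_matrix C (Sh C i\<^sub>1) (Sh C j\<^sub>1) p\<^sub>3 q\<^sub>3 w' (Sh C f) (neg C (Sh C u)))"

text \<open>
  Exactness of the mapping cone does not depend on the biproduct diagrams, by closure of the exact
  triangles under isomorphism.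
\<close>

fun good :: "('o, 'm, 'b) tricat_scheme \<Rightarrow> 'm triple \<Rightarrow> 'm triple \<Rightarrow> 'm triple \<Rightarrow> bool" where
  "good C (u, v, w) (u', v', w') (f, g, h) \<longleftrightarrow>
     (\<exists>B\<^sub>1 B\<^sub>2 B\<^sub>3.
        biproduct C (Dom C u') (Dom C v) B\<^sub>1 \<and>
        biproduct C (Dom C v') (Dom C w) B\<^sub>2 \<and>
        biproduct C (Dom C w') (ShO C (Dom C u)) B\<^sub>3 \<and>
        mapping_cone C (u, v, w) (u', v', w') (f, g, h) B\<^sub>1 B\<^sub>2 B\<^sub>3 \<in> Tri C)"

text \<open>
  Below, \<open>f\<^sub>1, f\<^sub>2\<close> stand for \<open>f', f''\<close> (so \<open>X'' = Cod f\<^sub>1\<close>), likewise for \<open>g\<close> and \<open>h\<close>, and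
  \<open>(r, s, t)\<close> stands for \<open>(u'', v'', w'')\<close>.
\<close>

fun middling_good :: "('o, 'm, 'b) tricat_scheme \<Rightarrow> 'm triple \<Rightarrow> 'm triple \<Rightarrow> 'm triple \<Rightarrow> bool" where
  "middling_good C (u, v, w) (u', v', w') (f, g, h) \<longleftrightarrow>
     (\<exists>f\<^sub>1 f\<^sub>2 g\<^sub>1 g\<^sub>2 h\<^sub>1 h\<^sub>2 r s t.
        (f, f\<^sub>1, f\<^sub>2) \<in> Tri C \<and> (g, g\<^sub>1, g\<^sub>2) \<in> Tri C \<and> (h, h\<^sub>1, h\<^sub>2) \<in> Tri C \<and>
        r \<in> Hom C (Cod C f\<^sub>1) (Cod C g\<^sub>1) \<and>
        s \<in> Hom C (Cod C g\<^sub>1) (Cod C h\<^sub>1) \<and>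
        t \<in> Hom C (Cod C h\<^sub>1) (ShO C (Cod C f\<^sub>1)) \<and>
        (r, s, t) \<in> Tri C \<and>
        g\<^sub>1 \<cdot>\<^bsub>C\<^esub> u' = r \<cdot>\<^bsub>C\<^esub> f\<^sub>1 \<and> h\<^sub>1 \<cdot>\<^bsub>C\<^esub> v' = s \<cdot>\<^bsub>C\<^esub> g\<^sub>1 \<and> Sh C f\<^sub>1 \<cdot>\<^bsub>C\<^esub> w' = t \<cdot>\<^bsub>C\<^esub> h\<^sub>1 \<and>
        g\<^sub>2 \<cdot>\<^bsub>C\<^esub> r = Sh C u \<cdot>\<^bsub>C\<^esub> f\<^sub>2 \<and> h\<^sub>2 \<cdot>\<^bsub>C\<^esub> s = Sh C v \<cdot>\<^bsub>C\<^esub> g\<^sub>2 \<and>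
        Sh C f\<^sub>2 \<cdot>\<^bsub>C\<^esub> t = neg C (Sh C w \<cdot>\<^bsub>C\<^esub> h\<^sub>2))"

text \<open>
  The property does not depend on the triangles chosen on \<open>f\<close>, \<open>g\<close> and \<open>g \<cdot> u\<close>, so the choice is
  rendered by an existential quantifier.  \<open>c\<^sub>1, c\<^sub>2\<close> stand for \<open>\<open>v\<close>-tilde, \<open>w\<close>-tilde\<close>; both octahedra
  use the same triangle \<open>(g \<cdot> u, c\<^sub>1, c\<^sub>2)\<close>.
\<close>

fun verdier_good :: "('o, 'm, 'b) tricat_scheme \<Rightarrow> 'm triple \<Rightarrow> 'm triple \<Rightarrow> 'm triple \<Rightarrow> bool" where
  "verdier_good C (u, v, w) (u', v', w') (f, g, h) \<longleftrightarrow>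
     (\<exists>f\<^sub>1 f\<^sub>2 g\<^sub>1 g\<^sub>2 c\<^sub>1 c\<^sub>2.
        (f, f\<^sub>1, f\<^sub>2) \<in> Tri C \<and> (g, g\<^sub>1, g\<^sub>2) \<in> Tri C \<and> (g \<cdot>\<^bsub>C\<^esub> u, c\<^sub>1, c\<^sub>2) \<in> Tri C \<and>
        (\<exists>\<alpha>\<^sub>1 \<beta>\<^sub>1 \<gamma>\<^sub>1 \<alpha>\<^sub>2 \<beta>\<^sub>2 \<gamma>\<^sub>2.
           octahedron C (u, v, w) (g, g\<^sub>1, g\<^sub>2) (g \<cdot>\<^bsub>C\<^esub> u, c\<^sub>1, c\<^sub>2) (\<alpha>\<^sub>1, \<beta>\<^sub>1, \<gamma>\<^sub>1) \<and>
           octahedron C (f, f\<^sub>1, f\<^sub>2) (u', v', w') (g \<cdot>\<^bsub>C\<^esub> u, c\<^sub>1, c\<^sub>2) (\<alpha>\<^sub>2, \<beta>\<^sub>2, \<gamma>\<^sub>2) \<and>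
           h = \<beta>\<^sub>2 \<cdot>\<^bsub>C\<^esub> \<alpha>\<^sub>1))"

text \<open>
  HOL cannot quantify existentially over types, so "some triangulated category" has to be given in
  a fixed type.  Categories with objects and arrows coded by natural numbers lose no generality:
  the triangulated category axioms and all notions above (the suspension being fully faithful and
  essentially surjective) are first-order in the structure, so by the downward
  Loewenheim-Skolem theorem every triangulated category with given maps of triangles has a
  countable triangulated subcategory containing them in which the same properties hold.
\<close>

type_synonym countable_tricat = "(nat, nat) tricat"

end

theory Submission
  imports Defs "HOL-Library.Function_Algebras" "HOL-Library.Product_Plus"
    "HOL-Library.Numeral_Type" "HOL-Library.Countable_Set"
begin

text \<open>
  All three parts are witnessed by one category, the category of finitely generated free modules
  over \<open>\<int>/4\<close> with \<open>\<Sigma>\<close> the identity, which Muro, Schwede and Strickland showed to be triangulated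
  with an exact triangle \<open>T\<close> all of whose maps are multiplication by 2 on \<open>\<int>/4\<close>.  An exact
  sequence \<open>X \<rightarrow> Y \<rightarrow> Z \<rightarrow> X\<close> is declared an exact triangle when a monodromy operator on its
  reduction modulo 2 is the identity.  The mapping cone of a map of triangles is always exact as a
  sequence, and the fill-in can be chosen so that its monodromy is the identity as well; applying
  this twice yields the octahedral axiom.

  The maps \<open>(2, 2, 2)\<close> and \<open>(0, 0, 2)\<close> from \<open>T\<close> to itself are chain homotopic.  The first is middling
  good by completing it with copies of \<open>T\<close>, but the monodromy of its cone is a nontrivial
  unipotent matrix, and the only third component \<open>h\<close> making \<open>(2, 2, h)\<close> Verdier good is \<open>h = 0\<close>.
  For the second, a completion to a 4 by 4 diagram would force \<open>2 f'(1) = 0\<close> although \<open>f'\<close> is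
  injective.
\<close>

section \<open>Free modules over the integers modulo 4\<close>

text \<open>The obstacle is the choice of fill-ins. A careless \<open>h\<close> can leave a
  nontrivial unipotent monodromy on the cone, as (2, 2, 2) does. Trivial monodromy restricts
  \<open>h a\<close> only for those \<open>a\<close> that occur in cycles of the cone modulo 2, so
  finding \<open>h\<close> becomes a problem of extending a partial linear map inside nested
  relations \<open>G0 \<subseteq> S \<subseteq> R\<close>, where doubling carries \<open>R\<close>
  into \<open>S\<close> and \<open>S\<close> into \<open>G0\<close>. Extending to a new element
  meets one obstruction: the value already assigned to its double must be twice a value allowed by
  \<open>R\<close>. On the prescribed part of \<open>h\<close>, the trivial monodromy of the two
  given triangles supplies just this divisibility. Only squares that are the identity on the first
  object need such a careful choice. There the cone loses a contractible summand X, and octahedra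
  come from two of these reduced cones, other fill-ins from octahedra. With \<Sigma> the identity
  the signs in the axioms are harmless: 2x = -2x, so the monodromy does not see them.\<close>

lemma z4_cases:
  fixes c :: 4
  obtains "c = 0" | "c = 1" | "c = 2" | "c = 3"
proof (cases c rule: bit0_cases)
  case (of_int z)
  then have "z = 0 \<or> z = 1 \<or> z = 2 \<or> z = 3"
    by auto
  with of_int that show thesis
    by auto
qed

lemma z4_double_double: "(c::4) + c + (c + c) = 0"
  by (cases c rule: z4_cases) simp_all

lemma z4_half:
  assumes "(c::4) + c = 0"
  shows "\<exists>d. c = d + d"
proof (cases c rule: z4_cases)
  case 1
  then show ?thesis by (intro exI[of _ 0]) simp
next
  case 3
  then show ?thesis by (intro exI[of _ 1]) simp
qed (use assms in simp_all)

lemma z4_unit: "(c::4) + c \<noteq> 0 \<Longrightarrow> c * c = 1"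
  by (cases c rule: z4_cases) simp_all

type_synonym vec = "nat \<Rightarrow> 4"

definition Vec :: "nat \<Rightarrow> vec set" where
  "Vec n = {x. \<forall>i\<ge>n. x i = 0}"

definition trunc :: "nat \<Rightarrow> vec \<Rightarrow> vec" where
  "trunc n x = (\<lambda>i. if i < n then x i else 0)"

definition dbl :: "'a::plus \<Rightarrow> 'a" where
  "dbl x = x + x"

lemma Vec_zero [simp, intro]: "0 \<in> Vec n"
  by (simp add: Vec_def)

lemma Vec_add [simp, intro]: "x \<in> Vec n \<Longrightarrow> y \<in> Vec n \<Longrightarrow> x + y \<in> Vec n"
  by (simp add: Vec_def)

lemma Vec_uminus [simp, intro]: "x \<in> Vec n \<Longrightarrow> - x \<in> Vec n"
  by (simp add: Vec_def)

lemma Vec_diff [simp, intro]: "x \<in> Vec n \<Longrightarrow> y \<in> Vec n \<Longrightarrow> x - y \<in> Vec n"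
  by (simp add: Vec_def)

lemma Vec_dbl [simp, intro]: "x \<in> Vec n \<Longrightarrow> dbl x \<in> Vec n"
  unfolding dbl_def by (rule Vec_add)

lemma Vec_0_iff [simp]: "x \<in> Vec 0 \<longleftrightarrow> x = 0"
  by (auto simp: Vec_def)

lemma trunc_in_Vec [simp, intro]: "trunc n x \<in> Vec n"
  by (simp add: Vec_def trunc_def)

lemma trunc_eq [simp]: "x \<in> Vec n \<Longrightarrow> trunc n x = x"
  by (auto simp: Vec_def trunc_def)

lemma trunc_add: "trunc n (x + y) = trunc n x + trunc n y"
  by (auto simp: trunc_def)

lemma dbl_add: "dbl (x + y) = dbl x + dbl (y :: 'a::ab_semigroup_add)"
  by (simp add: dbl_def algebra_simps)

lemma dbl_diff: "dbl (x - y) = dbl x - dbl (y :: 'a::ab_group_add)"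
  by (simp add: dbl_def)

lemma dbl_uminus: "dbl (- x) = - dbl (x :: 'a::ab_group_add)"
  by (simp add: dbl_def)

lemma dbl_zero [simp]: "dbl (0 :: 'a::monoid_add) = 0"
  by (simp add: dbl_def)

lemma dbl_dbl [simp]: "dbl (dbl (x :: vec)) = 0"
  by (rule ext) (simp only: dbl_def plus_fun_apply zero_fun_apply z4_double_double)

lemma uminus_dbl [simp]: "- dbl (x :: vec) = dbl x"
  using dbl_dbl[of x] by (metis dbl_def minus_unique)

text \<open>In Z/4 the kernel of 2 is the image of 2. Applied to boundaries, this is what makes the
  connecting maps available on elements.\<close>

lemma dbl_eq_0:
  assumes "x \<in> Vec n" "dbl x = 0"
  obtains t where "t \<in> Vec n" "x = dbl t"
proof -
  have "\<exists>d. x i = d + d" for i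
    using fun_cong[OF assms(2), of i] by (intro z4_half) (simp add: dbl_def)
  then obtain d where d: "\<And>i. x i = d i + d i"
    by metis
  have "x = dbl (trunc n d)"
    using assms(1) d by (fastforce simp: dbl_def trunc_def Vec_def)
  then show thesis
    using that by blast
qed

lemma finite_Vec [simp]: "finite (Vec n)"
proof -
  have "Vec n \<subseteq> (\<lambda>g i. if i < n then g i else 0) ` ({..<n} \<rightarrow>\<^sub>E UNIV)"
  proof
    fix x :: vec assume "x \<in> Vec n"
    show "x \<in> (\<lambda>g i. if i < n then g i else 0) ` ({..<n} \<rightarrow>\<^sub>E UNIV)"
    proof (rule image_eqI[where x = "restrict x {..<n}"])
      show "x = (\<lambda>i. if i < n then restrict x {..<n} i else 0)"
        using \<open>x \<in> Vec n\<close> by (auto simp: Vec_def)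
    qed simp
  qed
  then show ?thesis
    by (rule finite_subset) (intro finite_imageI finite_PiE; simp)
qed

text \<open>
  Linear maps \<open>Vec n \<rightarrow> Vec m\<close> are extended to all vectors by precomposition with \<open>trunc n\<close>, so that
  they are additive everywhere and form a category under \<open>\<circ>\<close> with identities \<open>trunc n\<close>.
\<close>

definition Lin :: "nat \<Rightarrow> nat \<Rightarrow> (vec \<Rightarrow> vec) set" where
  "Lin n m = {f. (\<forall>x y. f (x + y) = f x + f y) \<and> (\<forall>x. f x \<in> Vec m) \<and> (\<forall>x. f (trunc n x) = f x)}"

lemma LinI:
  assumes "\<And>x y. f (x + y) = f x + f y" "\<And>x. f x \<in> Vec m" "\<And>x. f (trunc n x) = f x"
  shows "f \<in> Lin n m"
  using assms by (simp add: Lin_def)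

lemma Lin_add: "f \<in> Lin n m \<Longrightarrow> f (x + y) = f x + f y"
  unfolding Lin_def by blast

lemma Lin_Vec [simp]: "f \<in> Lin n m \<Longrightarrow> f x \<in> Vec m"
  unfolding Lin_def by blast

lemma Lin_trunc: "f \<in> Lin n m \<Longrightarrow> f (trunc n x) = f x"
  unfolding Lin_def by blast

lemma Lin_0: "f \<in> Lin n m \<Longrightarrow> f 0 = 0"
  using Lin_add[of f n m 0 0] by simp

lemma Lin_uminus: "f \<in> Lin n m \<Longrightarrow> f (- x) = - f x"
  using Lin_add[of f n m "- x" x] Lin_0[of f n m] by (simp add: eq_neg_iff_add_eq_0)

lemma Lin_diff: "f \<in> Lin n m \<Longrightarrow> f (x - y) = f x - f y"
  using Lin_add[of f n m x "- y"] Lin_uminus[of f n m y] by simp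

lemma Lin_dbl: "f \<in> Lin n m \<Longrightarrow> f (dbl x) = dbl (f x)"
  unfolding dbl_def by (rule Lin_add)

lemmas Lin_simps = Lin_add Lin_0 Lin_uminus Lin_diff Lin_dbl

lemma Lin_trunc_id: "trunc n \<in> Lin n n"
  by (rule LinI) (auto simp: trunc_def Vec_def)

lemma Lin_comp:
  assumes f: "f \<in> Lin n m" and g: "g \<in> Lin m k"
  shows "g \<circ> f \<in> Lin n k"
  by (rule LinI) (simp_all add: Lin_add[OF f] Lin_add[OF g] Lin_trunc[OF f] Lin_Vec[OF g])

lemma Lin_plus:
  assumes f: "f \<in> Lin n m" and g: "g \<in> Lin n m"
  shows "f + g \<in> Lin n m"
  by (rule LinI) (simp_all add: Lin_add[OF f] Lin_add[OF g] Lin_trunc[OF f] Lin_trunc[OF g]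
      Lin_Vec[OF f] Lin_Vec[OF g] add_ac)

lemma Lin_neg:
  assumes f: "f \<in> Lin n m"
  shows "- f \<in> Lin n m"
  by (rule LinI) (simp_all add: Lin_add[OF f] Lin_trunc[OF f] Lin_Vec[OF f])

lemma Lin_zero: "0 \<in> Lin n m"
  by (intro LinI) simp_all

lemma Lin_on_Vec:
  assumes "\<And>x y. x \<in> Vec n \<Longrightarrow> y \<in> Vec n \<Longrightarrow> f (x + y) = f x + f y"
    and "\<And>x. x \<in> Vec n \<Longrightarrow> f x \<in> Vec m"
  shows "(\<lambda>x. f (trunc n x)) \<in> Lin n m"
  by (intro LinI) (simp_all add: trunc_add assms)

text \<open>Finite hom sets make the set of all arrows countable, so that arrows can be coded by
  natural numbers.\<close>

lemma finite_Lin: "finite (Lin n m)"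
proof -
  have "Lin n m \<subseteq> (\<lambda>g x. g (trunc n x)) ` (Vec n \<rightarrow>\<^sub>E Vec m)"
  proof
    fix f assume f: "f \<in> Lin n m"
    then have "f = (\<lambda>x. restrict f (Vec n) (trunc n x))"
      by (simp add: fun_eq_iff Lin_trunc)
    moreover have "restrict f (Vec n) \<in> Vec n \<rightarrow>\<^sub>E Vec m"
      using f by simp
    ultimately show "f \<in> (\<lambda>g x. g (trunc n x)) ` (Vec n \<rightarrow>\<^sub>E Vec m)"
      by blast
  qed
  then show ?thesis
    by (rule finite_subset) (simp add: finite_PiE)
qed

section \<open>Biproducts of free modules in coordinates\<close>

definition inl :: "nat \<Rightarrow> nat \<Rightarrow> vec \<Rightarrow> vec" where
  "inl n m = trunc n"

definition outl :: "nat \<Rightarrow> nat \<Rightarrow> vec \<Rightarrow> vec" where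
  "outl n m = trunc n"

definition inr :: "nat \<Rightarrow> nat \<Rightarrow> vec \<Rightarrow> vec" where
  "inr n m y = (\<lambda>i. if n \<le> i \<and> i < n + m then y (i - n) else 0)"

definition outr :: "nat \<Rightarrow> nat \<Rightarrow> vec \<Rightarrow> vec" where
  "outr n m x = (\<lambda>i. if i < m then x (i + n) else 0)"

lemma Lin_inl: "inl n m \<in> Lin n (n + m)"
  by (rule LinI) (simp_all add: inl_def trunc_def Vec_def fun_eq_iff)

lemma Lin_outl: "outl n m \<in> Lin (n + m) n"
  by (rule LinI) (simp_all add: outl_def trunc_def Vec_def fun_eq_iff)

lemma Lin_inr: "inr n m \<in> Lin m (n + m)"
  by (rule LinI) (auto simp: inr_def trunc_def Vec_def fun_eq_iff)

lemma Lin_outr: "outr n m \<in> Lin (n + m) m"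
  by (rule LinI) (simp_all add: outr_def trunc_def Vec_def fun_eq_iff)

lemmas Lin_biprod = Lin_inl Lin_outl Lin_inr Lin_outr

lemmas biprod_linear [simp] =
  Lin_simps[OF Lin_inl] Lin_simps[OF Lin_outl] Lin_simps[OF Lin_inr] Lin_simps[OF Lin_outr]

lemma out_in [simp]:
  "x \<in> Vec n \<Longrightarrow> outl n m (inl n m x) = x"
  "y \<in> Vec m \<Longrightarrow> outr n m (inr n m y) = y"
  "outl n m (inr n m y) = 0"
  "outr n m (inl n m x) = 0"
  by (auto simp: inl_def outl_def inr_def outr_def trunc_def Vec_def)

lemma in_out: "s \<in> Vec (n + m) \<Longrightarrow> inl n m (outl n m s) + inr n m (outr n m s) = s"
  by (auto simp: inl_def outl_def inr_def outr_def trunc_def Vec_def fun_eq_iff)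

lemma biprod_eqI:
  assumes "s \<in> Vec (n + m)" "t \<in> Vec (n + m)" "outl n m s = outl n m t" "outr n m s = outr n m t"
  shows "s = t"
  using assms by (metis in_out)

section \<open>Triangles of free modules\<close>

text \<open>
  On the sequence \<open>T\<close> that repeats \<open>u, v, w\<close> periodically, multiplication by 2 gives a short exact
  sequence \<open>T/2 \<rightarrow> T \<rightarrow> T/2\<close>.  If \<open>T\<close> is exact, its connecting maps are isomorphisms
  \<open>\<partial>\<close> from the homology of \<open>T/2\<close> at \<open>Y\<close>, \<open>Z\<close>, \<open>X\<close> to that at \<open>Z\<close>, \<open>X\<close>, \<open>Y\<close>.  The last condition
  below says that \<open>\<partial>\<^sup>3 = 1\<close>.
\<close>

definition tri :: "nat \<Rightarrow> nat \<Rightarrow> nat \<Rightarrow> (vec \<Rightarrow> vec) \<Rightarrow> (vec \<Rightarrow> vec) \<Rightarrow> (vec \<Rightarrow> vec) \<Rightarrow> bool" where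
  "tri X Y Z u v w \<longleftrightarrow> u \<in> Lin X Y \<and> v \<in> Lin Y Z \<and> w \<in> Lin Z X \<and>
     (\<forall>y\<in>Vec Y. v y = 0 \<longleftrightarrow> (\<exists>x\<in>Vec X. y = u x)) \<and>
     (\<forall>z\<in>Vec Z. w z = 0 \<longleftrightarrow> (\<exists>y\<in>Vec Y. z = v y)) \<and>
     (\<forall>x\<in>Vec X. u x = 0 \<longleftrightarrow> (\<exists>z\<in>Vec Z. x = w z)) \<and>
     (\<forall>y\<in>Vec Y. \<forall>z\<in>Vec Z. v y = dbl z \<longrightarrow> (\<exists>x\<in>Vec X. w z = dbl x \<and> u x = dbl y))"

lemma triI:
  assumes "u \<in> Lin X Y" "v \<in> Lin Y Z" "w \<in> Lin Z X"
    and "\<And>x. x \<in> Vec X \<Longrightarrow> v (u x) = 0"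
    and "\<And>y. y \<in> Vec Y \<Longrightarrow> w (v y) = 0"
    and "\<And>z. z \<in> Vec Z \<Longrightarrow> u (w z) = 0"
    and "\<And>y. y \<in> Vec Y \<Longrightarrow> v y = 0 \<Longrightarrow> \<exists>x\<in>Vec X. y = u x"
    and "\<And>z. z \<in> Vec Z \<Longrightarrow> w z = 0 \<Longrightarrow> \<exists>y\<in>Vec Y. z = v y"
    and "\<And>x. x \<in> Vec X \<Longrightarrow> u x = 0 \<Longrightarrow> \<exists>z\<in>Vec Z. x = w z"
    and "\<And>y z. y \<in> Vec Y \<Longrightarrow> z \<in> Vec Z \<Longrightarrow> v y = dbl z \<Longrightarrow> \<exists>x\<in>Vec X. w z = dbl x \<and> u x = dbl y"
  shows "tri X Y Z u v w"
  unfolding tri_def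
proof (intro conjI ballI iffI impI)
  show "v y = 0" if "\<exists>x\<in>Vec X. y = u x" for y
    using that assms(4) by blast
  show "w z = 0" if "\<exists>y\<in>Vec Y. z = v y" for z
    using that assms(5) by blast
  show "u x = 0" if "\<exists>z\<in>Vec Z. x = w z" for x
    using that assms(6) by blast
qed (fact assms)+

lemma tri_Lin:
  assumes "tri X Y Z u v w"
  shows "u \<in> Lin X Y" "v \<in> Lin Y Z" "w \<in> Lin Z X"
  using assms unfolding tri_def by auto

lemma tri_zero:
  assumes "tri X Y Z u v w"
  shows "v (u x) = 0" "w (v y) = 0" "u (w z) = 0"
proof -
  have "v (u (trunc X x)) = 0" "w (v (trunc Y y)) = 0" "u (w (trunc Z z)) = 0"
    using assms unfolding tri_def by (metis Lin_Vec trunc_in_Vec)+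
  then show "v (u x) = 0" "w (v y) = 0" "u (w z) = 0"
    using tri_Lin[OF assms] by (simp_all add: Lin_trunc)
qed

lemma tri_exact:
  assumes "tri X Y Z u v w"
  shows "y \<in> Vec Y \<Longrightarrow> v y = 0 \<Longrightarrow> \<exists>x\<in>Vec X. y = u x"
    and "z \<in> Vec Z \<Longrightarrow> w z = 0 \<Longrightarrow> \<exists>y\<in>Vec Y. z = v y"
    and "x \<in> Vec X \<Longrightarrow> u x = 0 \<Longrightarrow> \<exists>z\<in>Vec Z. x = w z"
  using assms unfolding tri_def by blast+

lemma tri_half:
  assumes "tri X Y Z u v w" "y \<in> Vec Y" "z \<in> Vec Z" "v y = dbl z"
  shows "\<exists>x\<in>Vec X. w z = dbl x \<and> u x = dbl y"
  using assms unfolding tri_def by blast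

text \<open>The monodromy at Z is conjugate to that at Y by a connecting isomorphism, so one is
  trivial when the other is. The chase carries this out on elements.\<close>

lemma tri_rotate:
  assumes T: "tri X Y Z u v w"
  shows "tri Y Z X v w u"
proof (rule triI)
  note u = tri_Lin(1)[OF T] and v = tri_Lin(2)[OF T] and w = tri_Lin(3)[OF T]
  fix z x assume z: "z \<in> Vec Z" and x: "x \<in> Vec X" and zx: "w z = dbl x"
  have "dbl (u x) = 0"
    using tri_zero(3)[OF T, of z] by (simp add: zx Lin_dbl[OF u])
  then obtain y0 where y0: "y0 \<in> Vec Y" "u x = dbl y0"
    using dbl_eq_0 u by (metis Lin_Vec)
  have "dbl (v y0) = 0"
    using tri_zero(1)[OF T, of x] by (simp add: y0 Lin_dbl[OF v])
  then obtain z0 where z0: "z0 \<in> Vec Z" "v y0 = dbl z0"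
    using dbl_eq_0 v by (metis Lin_Vec)
  obtain x0 where x0: "x0 \<in> Vec X" "w z0 = dbl x0" "u x0 = dbl y0"
    using tri_half[OF T y0(1) z0] by blast
  \<comment> \<open>Both \<open>x\<close> and \<open>x0\<close> connect to \<open>y0\<close>, so
    they differ by a boundary; hence \<open>z0\<close> and \<open>z\<close> differ by a boundary
    modulo 2, which a correction of \<open>y0\<close> by an even vector absorbs.\<close>
  have "u (x0 - x) = 0"
    by (simp add: Lin_diff[OF u] x0 y0)
  then obtain z1 where z1: "z1 \<in> Vec Z" "x0 - x = w z1"
    using tri_exact(3)[OF T Vec_diff[OF x0(1) x]] by blast
  have "w (z0 - z - dbl z1) = 0"
    by (simp add: Lin_diff[OF w] Lin_dbl[OF w] x0 zx z1(2)[symmetric] dbl_diff)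
  then obtain y1 where y1: "y1 \<in> Vec Y" "z0 - z - dbl z1 = v y1"
    using tri_exact(2)[OF T Vec_diff[OF Vec_diff[OF z0(1) z] Vec_dbl[OF z1(1)]]] by blast
  then have "z0 = z + dbl z1 + v y1"
    by (simp add: algebra_simps)
  then have "v (y0 - dbl y1) = dbl z"
    by (simp add: Lin_diff[OF v] Lin_dbl[OF v] z0 dbl_add)
  moreover have "u x = dbl (y0 - dbl y1)"
    by (simp add: dbl_diff y0)
  ultimately show "\<exists>y\<in>Vec Y. u x = dbl y \<and> v y = dbl z"
    using y0(1) y1(1) by blast
qed (use T tri_Lin[OF T] tri_zero[OF T] tri_exact[OF T] in auto)

text \<open>Needed for the sign in the rotation axiom; the monodromy clause survives because -2 =
  2.\<close>

lemma tri_neg: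
  assumes T: "tri X Y Z u v w"
  shows "tri X Y Z u v (- w)"
proof (rule triI)
  fix x assume "x \<in> Vec X" "u x = 0"
  then obtain z where "z \<in> Vec Z" "x = w z"
    using tri_exact(3)[OF T] by blast
  then show "\<exists>z\<in>Vec Z. x = (- w) z"
    by (intro bexI[of _ "- z"]) (simp_all add: Lin_uminus[OF tri_Lin(3)[OF T]])
next
  fix y z assume "y \<in> Vec Y" "z \<in> Vec Z" "v y = dbl z"
  then obtain x where "x \<in> Vec X" "w z = dbl x" "u x = dbl y"
    using tri_half[OF T] by blast
  then show "\<exists>x\<in>Vec X. (- w) z = dbl x \<and> u x = dbl y"
    by (intro bexI[of _ x]) simp_all
qed (use T tri_Lin[OF T] tri_zero[OF T] tri_exact[OF T] in
    \<open>auto simp: Lin_neg Lin_uminus[OF tri_Lin(1)[OF T]]\<close>)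

lemma tri_iso:
  assumes T: "tri X Y Z u v w"
    and l: "u' \<in> Lin X' Y'" "v' \<in> Lin Y' Z'" "w' \<in> Lin Z' X'"
    and f: "f \<in> Lin X X'" "f' \<in> Lin X' X" "\<And>x. x \<in> Vec X' \<Longrightarrow> f (f' x) = x" "\<And>x. x \<in> Vec X \<Longrightarrow> f' (f x) = x"
    and g: "g \<in> Lin Y Y'" "g' \<in> Lin Y' Y" "\<And>x. x \<in> Vec Y' \<Longrightarrow> g (g' x) = x" "\<And>x. x \<in> Vec Y \<Longrightarrow> g' (g x) = x"
    and h: "h \<in> Lin Z Z'" "h' \<in> Lin Z' Z" "\<And>x. x \<in> Vec Z' \<Longrightarrow> h (h' x) = x" "\<And>x. x \<in> Vec Z \<Longrightarrow> h' (h x) = x"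
    and c: "\<And>x. g (u x) = u' (f x)" "\<And>x. h (v x) = v' (g x)" "\<And>x. f (w x) = w' (h x)"
  shows "tri X' Y' Z' u' v' w'"
proof -
  note L = tri_Lin[OF T]
  have V: "f' x \<in> Vec X" "g' y \<in> Vec Y" "h' z \<in> Vec Z" for x y z
    using f(2) g(2) h(2) by auto
  have c': "g' (u' x) = u (f' x)" if "x \<in> Vec X'" for x
    using c(1)[of "f' x"] g(4)[of "u (f' x)"] that L(1) f(3) by (simp del: c)
  have d': "h' (v' x) = v (g' x)" if "x \<in> Vec Y'" for x
    using c(2)[of "g' x"] h(4)[of "v (g' x)"] that L(2) g(3) by (simp del: c)
  have e': "f' (w' x) = w (h' x)" if "x \<in> Vec Z'" for x
    using c(3)[of "h' x"] f(4)[of "w (h' x)"] that L(3) h(3) by (simp del: c)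
  show ?thesis
  proof (rule triI)
    fix x assume x: "x \<in> Vec X'"
    show "v' (u' x) = 0"
      using c(1)[of "f' x"] c(2)[of "u (f' x)"] tri_zero(1)[OF T, of "f' x"] f(3)[OF x] Lin_0[OF h(1)] by simp
  next
    fix x assume x: "x \<in> Vec Y'"
    show "w' (v' x) = 0"
      using c(2)[of "g' x"] c(3)[of "v (g' x)"] tri_zero(2)[OF T, of "g' x"] g(3)[OF x] Lin_0[OF f(1)] by simp
  next
    fix x assume x: "x \<in> Vec Z'"
    show "u' (w' x) = 0"
      using c(3)[of "h' x"] c(1)[of "w (h' x)"] tri_zero(3)[OF T, of "h' x"] h(3)[OF x] Lin_0[OF g(1)] by simp
  next
    fix y assume y: "y \<in> Vec Y'" "v' y = 0"
    then have "v (g' y) = 0"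
      using d'[OF y(1)] Lin_0[OF h(2)] by simp
    then obtain x where "x \<in> Vec X" "g' y = u x"
      using tri_exact(1)[OF T] V by blast
    then show "\<exists>x\<in>Vec X'. y = u' x"
      using c(1)[of x] g(3)[OF y(1)] f(1) by (metis Lin_Vec)
  next
    fix y assume y: "y \<in> Vec Z'" "w' y = 0"
    then have "w (h' y) = 0"
      using e'[OF y(1)] Lin_0[OF f(2)] by simp
    then obtain x where "x \<in> Vec Y" "h' y = v x"
      using tri_exact(2)[OF T] V by blast
    then show "\<exists>x\<in>Vec Y'. y = v' x"
      using c(2)[of x] h(3)[OF y(1)] g(1) by (metis Lin_Vec)
  next
    fix y assume y: "y \<in> Vec X'" "u' y = 0"
    then have "u (f' y) = 0"
      using c'[OF y(1)] Lin_0[OF g(2)] by simp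
    then obtain x where "x \<in> Vec Z" "f' y = w x"
      using tri_exact(3)[OF T] V by blast
    then show "\<exists>x\<in>Vec Z'. y = w' x"
      using c(3)[of x] f(3)[OF y(1)] h(1) by (metis Lin_Vec)
  next
    fix y z assume y: "y \<in> Vec Y'" and z: "z \<in> Vec Z'" and yz: "v' y = dbl z"
    have "v (g' y) = dbl (h' z)"
      using d'[OF y] Lin_dbl[OF h(2), of z] yz by simp
    then obtain x where x: "x \<in> Vec X" "w (h' z) = dbl x" "u x = dbl (g' y)"
      using tri_half[OF T] V by blast
    have "w' z = dbl (f x)"
      using c(3)[of "h' z"] x(2) h(3)[OF z] Lin_dbl[OF f(1), of x] by simp
    moreover have "u' (f x) = dbl y"
      using c(1)[of x] x(3) g(3)[OF y] Lin_dbl[OF g(1), of "g' y"] by simp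
    ultimately show "\<exists>x\<in>Vec X'. w' z = dbl x \<and> u' x = dbl y"
      using f(1) by (metis Lin_Vec)
  qed (use l in auto)
qed

section \<open>Extending partial linear maps\<close>

definition addsub :: "'a::ab_group_add set \<Rightarrow> bool" where
  "addsub G \<longleftrightarrow> 0 \<in> G \<and> (\<forall>p\<in>G. \<forall>q\<in>G. p + q \<in> G) \<and> (\<forall>p\<in>G. - p \<in> G)"

lemma addsub_0: "addsub G \<Longrightarrow> 0 \<in> G"
  and addsub_add: "addsub G \<Longrightarrow> p \<in> G \<Longrightarrow> q \<in> G \<Longrightarrow> p + q \<in> G"
  and addsub_uminus: "addsub G \<Longrightarrow> p \<in> G \<Longrightarrow> - p \<in> G"
  unfolding addsub_def by blast+

lemma addsub_diff:
  assumes "addsub G" "p \<in> G" "q \<in> G"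
  shows "p - q \<in> G"
  using addsub_add[OF assms(1,2) addsub_uminus[OF assms(1,3)]] by simp

text \<open>Two cosets suffice, since the double of the new element is already present.\<close>

lemma addsub_adjoin:
  assumes G: "addsub G" and q: "dbl q \<in> G"
  shows "addsub (G \<union> {p. p - q \<in> G})"
  unfolding addsub_def
proof (intro conjI ballI)
  show "0 \<in> G \<union> {p. p - q \<in> G}"
    using addsub_0[OF G] by simp
next
  fix p p' assume p: "p \<in> G \<union> {p. p - q \<in> G}" and p': "p' \<in> G \<union> {p. p - q \<in> G}"
  have "p + p' = (p - q) + (p' - q) + dbl q" "p + p' - q = p + (p' - q)" "p + p' - q = (p - q) + p'"
    by (simp_all add: dbl_def)
  then show "p + p' \<in> G \<union> {p. p - q \<in> G}"
    using p p' q addsub_add[OF G] by (metis UnE UnI1 UnI2 mem_Collect_eq)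
next
  fix p assume p: "p \<in> G \<union> {p. p - q \<in> G}"
  have "- p - q = - (p - q) - dbl q"
    by (simp add: dbl_def)
  then show "- p \<in> G \<union> {p. p - q \<in> G}"
    using p q addsub_uminus[OF G] addsub_diff[OF G] by (metis UnE UnI1 UnI2 mem_Collect_eq)
qed

lemma dbl_Pair [simp]: "dbl (a, b) = (dbl a, dbl b)"
  by (simp add: dbl_def)

text \<open>
  Graphs of partial linear maps inside a relation \<open>R\<close>, where on the domain of \<open>S\<close> a subrelation
  \<open>S\<close> is prescribed.  The condition on \<open>(dbl z, d)\<close> is what it takes to extend such a map to \<open>z\<close>.
\<close>

definition admissible ::
  "nat \<Rightarrow> (vec \<times> vec) set \<Rightarrow> (vec \<times> vec) set \<Rightarrow> (vec \<times> vec) set \<Rightarrow> bool" where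
  "admissible n R S G \<longleftrightarrow> addsub G \<and> G \<subseteq> R \<and> (\<forall>b. (0, b) \<in> G \<longrightarrow> b = 0) \<and>
     (\<forall>z\<in>Vec n. \<forall>d. (dbl z, d) \<in> G \<longrightarrow> (\<exists>z'. (z, z') \<in> R \<and> dbl z' = d)) \<and>
     (\<forall>a b. (a, b) \<in> G \<longrightarrow> a \<in> Domain S \<longrightarrow> (a, b) \<in> S)"

text \<open>Only the new coset of \<open>(c, c')\<close> has to be checked: \<open>half\<close> and
  \<open>S\<close> are the two clauses there, and functionality holds because \<open>c\<close> is
  new in the domain.\<close>

lemma admissible_adjoin:
  assumes G: "admissible n R S G" and R: "addsub R"
    and q: "(c, c') \<in> R" "(dbl c, dbl c') \<in> G" "c \<notin> Domain G"
    and half: "\<And>z d. z \<in> Vec n \<Longrightarrow> (dbl z - c, d - c') \<in> G \<Longrightarrow> \<exists>z'. (z, z') \<in> R \<and> dbl z' = d"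
    and S: "\<And>a b. (a - c, b - c') \<in> G \<Longrightarrow> a \<in> Domain S \<Longrightarrow> (a, b) \<in> S"
  shows "admissible n R S (G \<union> {p. p - (c, c') \<in> G})"
proof -
  have GR: "addsub G" "G \<subseteq> R" "\<And>b. (0, b) \<in> G \<Longrightarrow> b = 0"
    "\<And>z d. z \<in> Vec n \<Longrightarrow> (dbl z, d) \<in> G \<Longrightarrow> \<exists>z'. (z, z') \<in> R \<and> dbl z' = d"
    "\<And>a b. (a, b) \<in> G \<Longrightarrow> a \<in> Domain S \<Longrightarrow> (a, b) \<in> S"
    using G unfolding admissible_def by blast+
  have 1: "(0, b) - (c, c') \<notin> G" for b
  proof
    assume "(0, b) - (c, c') \<in> G"
    from addsub_uminus[OF GR(1) this] have "(c, c' - b) \<in> G"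
      by simp
    with q(3) show False
      by blast
  qed
  have 2: "p \<in> R" if "p - (c, c') \<in> G" for p
    using addsub_add[OF R subsetD[OF GR(2) that] q(1)] by simp
  show ?thesis
    unfolding admissible_def
  proof (intro conjI allI ballI impI)
    show "addsub (G \<union> {p. p - (c, c') \<in> G})"
      by (rule addsub_adjoin) (use GR q in simp_all)
    show "G \<union> {p. p - (c, c') \<in> G} \<subseteq> R"
      using GR(2) 2 by blast
    show "b = 0" if "(0, b) \<in> G \<union> {p. p - (c, c') \<in> G}" for b
      using GR(3) 1 that by blast
    show "\<exists>z'. (z, z') \<in> R \<and> dbl z' = d"
      if "z \<in> Vec n" "(dbl z, d) \<in> G \<union> {p. p - (c, c') \<in> G}" for z d
      using GR(4) half that by auto
    show "(a, b) \<in> S" if "(a, b) \<in> G \<union> {p. p - (c, c') \<in> G}" "a \<in> Domain S" for a b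
      using that(1) GR(5)[OF _ that(2), of b] S[OF _ that(2), of b] by auto
  qed
qed

text \<open>By finiteness there is a maximal admissible graph above \<open>G\<^sub>0\<close>, and it
  must be total: otherwise one more coset could be adjoined. The order of adjoining matters: even
  vectors, then elements of \<open>Domain S\<close>, then the rest.\<close>

lemma extend_linear:
  assumes R: "addsub R" "R \<subseteq> Vec n \<times> Vec m" "\<And>z. z \<in> Vec n \<Longrightarrow> z \<in> Domain R"
    and S: "addsub S" "S \<subseteq> R"
    and RS: "\<And>p. p \<in> R \<Longrightarrow> dbl p \<in> S"
    and SG: "\<And>p. p \<in> S \<Longrightarrow> dbl p \<in> G\<^sub>0"
    and G0: "admissible n R S G\<^sub>0"
  shows "\<exists>h\<in>Lin n m. (\<forall>z\<in>Vec n. (z, h z) \<in> R) \<and> (\<forall>(a, b)\<in>G\<^sub>0. h a = b) \<and> (\<forall>z\<in>Domain S. (z, h z) \<in> S)"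
proof -
  let ?A = "{G. admissible n R S G \<and> G\<^sub>0 \<subseteq> G}"
  have "finite R"
    using R(2) by (rule finite_subset) simp
  have "?A \<subseteq> Pow R"
    unfolding admissible_def by blast
  then have "finite ?A"
    using \<open>finite R\<close> by (simp add: finite_subset)
  moreover have "G\<^sub>0 \<in> ?A"
    using G0 by simp
  ultimately obtain G where G: "admissible n R S G" "G\<^sub>0 \<subseteq> G"
    and max: "\<And>G'. admissible n R S G' \<Longrightarrow> G \<subseteq> G' \<Longrightarrow> G = G'"
    using finite_has_maximal2[of ?A G\<^sub>0] by auto
  have GR: "addsub G" "G \<subseteq> R" "\<And>b. (0, b) \<in> G \<Longrightarrow> b = 0"
    "\<And>z d. z \<in> Vec n \<Longrightarrow> (dbl z, d) \<in> G \<Longrightarrow> \<exists>z'. (z, z') \<in> R \<and> dbl z' = d"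
    "\<And>a b. (a, b) \<in> G \<Longrightarrow> a \<in> Domain S \<Longrightarrow> (a, b) \<in> S"
    using G(1) unfolding admissible_def by blast+
  have no_adjoin: False
    if "(c, c') \<in> R" "(dbl c, dbl c') \<in> G" "c \<notin> Domain G"
      "\<And>z d. z \<in> Vec n \<Longrightarrow> (dbl z - c, d - c') \<in> G \<Longrightarrow> \<exists>z'. (z, z') \<in> R \<and> dbl z' = d"
      "\<And>a b. (a - c, b - c') \<in> G \<Longrightarrow> a \<in> Domain S \<Longrightarrow> (a, b) \<in> S" for c c'
  proof -
    have "G \<union> {p. p - (c, c') \<in> G} \<subseteq> G"
      using max[OF admissible_adjoin[OF G(1) R(1) that]] by blast
    moreover have "(c, c') \<in> {p. p - (c, c') \<in> G}"
      using addsub_0[OF GR(1)] by (simp add: zero_prod_def)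
    ultimately have "(c, c') \<in> G"
      by blast
    with that(3) show False
      by blast
  qed
  have dbl_dom: "dbl z \<in> Domain G" if z: "z \<in> Vec n" for z
  proof (rule ccontr)
    assume nz: "dbl z \<notin> Domain G"
    obtain z' where z': "(z, z') \<in> R"
      using R(3)[OF z] by blast
    then have q: "(dbl z, dbl z') \<in> S"
      using RS[OF z'] by simp
    show False
    proof (rule no_adjoin[OF _ _ nz])
      show "(dbl z, dbl z') \<in> R"
        using q S(2) by blast
      show "(dbl (dbl z), dbl (dbl z')) \<in> G"
        using addsub_0[OF GR(1)] by (simp add: zero_prod_def)
      \<comment> \<open>The left entry is the double of \<open>t - z\<close>, so the divisibility
        clause of \<open>G\<close> halves \<open>d - dbl z'\<close>; adding \<open>z'\<close> halves
        \<open>d\<close>.\<close>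
      fix t d assume t: "t \<in> Vec n" "(dbl t - dbl z, d - dbl z') \<in> G"
      then obtain t' where "(t - z, t') \<in> R" "dbl t' = d - dbl z'"
        using GR(4)[OF Vec_diff[OF t(1) z], of "d - dbl z'"] by (auto simp: dbl_diff)
      then show "\<exists>z'. (t, z') \<in> R \<and> dbl z' = d"
        using addsub_add[OF R(1) _ z', of "(t - z, t')"] by (intro exI[of _ "t' + z'"]) (simp add: dbl_add)
    next
      fix a b assume a: "(a - dbl z, b - dbl z') \<in> G" "a \<in> Domain S"
      then obtain e where "(a, e) \<in> S"
        by blast
      then have "(a - dbl z, e - dbl z') \<in> S"
        using addsub_diff[OF S(1) _ q] by fastforce
      then have "(a - dbl z, b - dbl z') \<in> S"
        using GR(5)[OF a(1)] by blast
      then show "(a, b) \<in> S"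
        using addsub_add[OF S(1) _ q] by fastforce
    qed
  qed
  \<comment> \<open>By \<open>dbl_dom\<close> this is \<open>Domain G\<close> again. The redundant
    form \<open>a + dbl t\<close> matches what the clauses for a new coset produce, so that
    \<open>c \<notin> W\<close> refutes their hypotheses at once.\<close>
  define W where "W = {a + dbl t | a t. a \<in> Domain G \<and> t \<in> Vec n}"
  have GW: "a \<in> W" if "a \<in> Domain G" for a
    unfolding W_def using that by (intro CollectI exI[of _ a] exI[of _ 0]) simp
  have dom_diff: "a - b \<in> Domain G" if "a \<in> Domain G" "b \<in> Domain G" for a b
    using that addsub_diff[OF GR(1)] by (metis Domain_iff diff_Pair)
  have VW: "z \<in> W" if "z \<in> Vec n" for z
  proof (rule ccontr)
    assume "z \<notin> W"
    \<comment> \<open>A missing element of \<open>Domain S\<close> is preferred, with a value taken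
      from \<open>S\<close>. When none is missing, the coset of a new \<open>c\<close> cannot meet
      \<open>Domain S\<close>, so the clause about \<open>S\<close> costs nothing.\<close>
    then obtain c where c: "c \<in> Vec n" "c \<notin> W" "c \<in> Domain S \<or> Domain S \<subseteq> W"
      using \<open>z \<in> Vec n\<close> S(2) R(2) by blast
    obtain c' where c': "(c, c') \<in> R" "(dbl c, dbl c') \<in> G" "c \<in> Domain S \<Longrightarrow> (c, c') \<in> S"
    proof (cases "c \<in> Domain S")
      case True
      then obtain c' where "(c, c') \<in> S"
        by blast
      then show thesis
        using that[of c'] S(2) SG[of "(c, c')"] G(2) by auto
    next
      case False
      obtain d where d: "(dbl c, d) \<in> G"
        using dbl_dom[OF c(1)] by blast
      then obtain c' where "(c, c') \<in> R" "dbl c' = d"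
        using GR(4)[OF c(1)] by blast
      then show thesis
        using that d False by blast
    qed
    show False
    proof (rule no_adjoin[OF c'(1,2)])
      show "c \<notin> Domain G"
        using GW c(2) by blast
      fix t d assume t: "t \<in> Vec n" "(dbl t - c, d - c') \<in> G"
      have "0 - (dbl t - c) \<in> Domain G"
        using dom_diff[OF DomainI[OF addsub_0[OF GR(1), unfolded zero_prod_def]] DomainI[OF t(2)]] .
      then have "0 - (dbl t - c) + dbl t \<in> W"
        using t(1) unfolding W_def by blast
      with c(2) show "\<exists>z'. (t, z') \<in> R \<and> dbl z' = d"
        by simp
    next
      fix a b assume a: "(a - c, b - c') \<in> G" "a \<in> Domain S"
      show "(a, b) \<in> S"
      proof (cases "c \<in> Domain S")
        case True
        obtain e where "(a, e) \<in> S"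
          using a(2) by blast
        then have "(a - c, e - c') \<in> S"
          using addsub_diff[OF S(1) _ c'(3)[OF True]] by fastforce
        then have "(a - c, b - c') \<in> S"
          using GR(5)[OF a(1)] by blast
        then show ?thesis
          using addsub_add[OF S(1) _ c'(3)[OF True]] by fastforce
      next
        case False
        then obtain a1 t where at: "a = a1 + dbl t" "a1 \<in> Domain G" "t \<in> Vec n"
          using c(3) a(2) W_def by blast
        have "a1 - (a - c) \<in> Domain G"
          using dom_diff[OF at(2) DomainI[OF a(1)]] .
        then have "a1 - (a - c) + dbl t \<in> W"
          using at(3) unfolding W_def by blast
        with c(2) at(1) show ?thesis
          by (simp add: algebra_simps)
      qed
    qed
  qed
  have dom: "z \<in> Domain G" if zn: "z \<in> Vec n" for z
  proof -
    obtain a t where z: "z = a + dbl t" "a \<in> Domain G" "t \<in> Vec n"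
      using VW[OF zn] unfolding W_def by blast
    have "dbl t \<in> Domain G"
      using dbl_dom[OF z(3)] .
    from dom_diff[OF z(2) this] show ?thesis
      unfolding z(1) diff_conv_add_uminus uminus_dbl .
  qed
  have unique: "b = b'" if "(a, b) \<in> G" "(a, b') \<in> G" for a b b'
    using addsub_diff[OF GR(1) that] GR(3)[of "b - b'"] by simp
  define f where "f z = (THE b. (z, b) \<in> G)" for z
  have fG: "(z, f z) \<in> G" if z: "z \<in> Vec n" for z
  proof -
    obtain b where "(z, b) \<in> G"
      using dom[OF z] by blast
    then show ?thesis
      unfolding f_def by (rule theI[where P = "\<lambda>b. (z, b) \<in> G"]) (rule unique[OF _ \<open>(z, b) \<in> G\<close>])
  qed
  have feq: "f z = b" if "(z, b) \<in> G" for z b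
  proof -
    have "z \<in> Vec n"
      using that GR(2) R(2) by blast
    from unique[OF fG[OF this] that] show ?thesis .
  qed
  have 1: "(\<lambda>x. f (trunc n x)) \<in> Lin n m"
  proof (rule Lin_on_Vec)
    fix x y assume "x \<in> Vec n" "y \<in> Vec n"
    then show "f (x + y) = f x + f y"
      using addsub_add[OF GR(1) fG fG] by (intro feq) simp
  next
    fix x assume "x \<in> Vec n"
    then show "f x \<in> Vec m"
      using fG GR(2) R(2) by blast
  qed
  have 2: "(z, f (trunc n z)) \<in> R" if "z \<in> Vec n" for z
    using fG[OF that] GR(2) that by auto
  have 3: "f (trunc n a) = b" if "(a, b) \<in> G\<^sub>0" for a b
  proof -
    have "(a, b) \<in> G" "a \<in> Vec n"
      using that G(2) GR(2) R(2) by blast+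
    then show ?thesis
      using feq by simp
  qed
  have 4: "(z, f (trunc n z)) \<in> S" if "z \<in> Domain S" for z
  proof -
    have "z \<in> Vec n"
      using that S(2) R(2) by blast
    then show ?thesis
      using GR(5)[OF fG[OF \<open>z \<in> Vec n\<close>] that] by simp
  qed
  show ?thesis
  proof (rule bexI[OF _ 1], intro conjI ballI)
    fix p assume "p \<in> G\<^sub>0"
    then show "case p of (a, b) \<Rightarrow> f (trunc n a) = b"
      using 3 by (cases p) simp
  qed (use 2 4 in simp_all)
qed

section \<open>Fill-ins with exact mapping cone\<close>

text \<open>The last clause of the conclusion is the monodromy clause of the reduced cone Y -> Y' +
  Z -> Z' -> Y. Here \<open>G0\<close> is the part of \<open>h\<close> forced by
  \<open>h v = v' g\<close>, \<open>R\<close> expresses \<open>w' h = w\<close>, and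
  \<open>S\<close> expresses trivial monodromy.\<close>

lemma good_fill_in:
  assumes T: "tri X Y Z u v w" and T': "tri X Y' Z' u' v' w'"
    and g: "g \<in> Lin Y Y'" and gu: "\<And>x. g (u x) = u' x"
  shows "\<exists>h\<in>Lin Z Z'. (\<forall>y. h (v y) = v' (g y)) \<and> (\<forall>z. w' (h z) = w z) \<and>
    (\<forall>y\<in>Vec Y. \<forall>y'\<in>Vec Y'. \<forall>z\<in>Vec Z. g y = dbl y' \<longrightarrow> v y = dbl z \<longrightarrow>
      (\<exists>t\<in>Vec Z'. h z = v' y' + dbl t \<and> u (w' t) = dbl y))"
proof -
  note L = tri_Lin[OF T] and L' = tri_Lin[OF T']
  note u = Lin_simps[OF L(1)] and v = Lin_simps[OF L(2)] and w = Lin_simps[OF L(3)]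
  note v' = Lin_simps[OF L'(2)] and w' = Lin_simps[OF L'(3)]
  note gl = Lin_simps[OF g]
  note V = Lin_Vec[OF L(1)] Lin_Vec[OF L(2)] Lin_Vec[OF L(3)] Lin_Vec[OF L'(1)] Lin_Vec[OF L'(2)]
    Lin_Vec[OF L'(3)] Lin_Vec[OF g]
  note z = tri_zero[OF T] and z' = tri_zero[OF T']
  define R where "R = {(a, b). a \<in> Vec Z \<and> b \<in> Vec Z' \<and> w' b = w a}"
  \<comment> \<open>The mapping cone has trivial monodromy iff \<open>(a, h a) \<in> S\<close> for all \<open>a\<close> in the domain of \<open>S\<close>.\<close>
  define Q where "Q a b y y' t \<longleftrightarrow> a \<in> Vec Z \<and> y \<in> Vec Y \<and> y' \<in> Vec Y' \<and> t \<in> Vec Z' \<and>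
    dbl (w' t) = w a \<and> g y = dbl y' \<and> v y = dbl a \<and> u (w' t) = dbl y \<and> b = v' y' + dbl t" for a b y y' t
  define S where "S = {(a, b). \<exists>y y' t. Q a b y y' t}"
  define G0 where "G0 = (\<lambda>y. (v y, v' (g y))) ` Vec Y"
  have Q0: "Q 0 0 0 0 0"
    by (simp add: Q_def gl v w' w u v')
  have Qadd: "Q (a + a1) (b + b1) (y + y1) (y' + y1') (t + t1)"
    if "Q a b y y' t" "Q a1 b1 y1 y1' t1" for a b y y' t a1 b1 y1 y1' t1
    using that unfolding Q_def by (simp add: gl v w w' u v' dbl_add algebra_simps)
  have Qneg: "Q (- a) (- b) (- y) (- y') (- t)" if "Q a b y y' t" for a b y y' t
    using that unfolding Q_def by (simp add: gl v w w' u v' dbl_uminus del: uminus_dbl)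
  have R1: "addsub R"
    unfolding addsub_def by (auto simp: R_def w w' zero_prod_def)
  have R2: "R \<subseteq> Vec Z \<times> Vec Z'"
    unfolding R_def by auto
  have R3: "a \<in> Domain R" if "a \<in> Vec Z" for a
  proof -
    have "u' (w a) = 0"
      using gu[of "w a"] z(3)[of a] gl by simp
    then obtain b where "b \<in> Vec Z'" "w a = w' b"
      using tri_exact(3)[OF T' V(3)] by blast
    then show ?thesis
      using that unfolding R_def by auto
  qed
  have S1: "addsub S"
    unfolding addsub_def
  proof (intro conjI ballI)
    show "0 \<in> S"
      using Q0 unfolding S_def zero_prod_def by blast
    show "p + q \<in> S" if "p \<in> S" "q \<in> S" for p q
      using that Qadd unfolding S_def by (cases p; cases q) (simp, blast)
    show "- p \<in> S" if "p \<in> S" for p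
      using that Qneg unfolding S_def by (cases p) (simp, blast)
  qed
  have S2: "S \<subseteq> R"
    unfolding S_def R_def Q_def by (auto simp: w' z' V)
  have RS: "dbl p \<in> S" if "p \<in> R" for p
  proof -
    obtain a b where p: "p = (a, b)"
      by (cases p)
    \<comment> \<open>For an even first entry the cycle can be taken with \<open>y = y' = 0\<close>,
      and \<open>t = b\<close> is its lift.\<close>
    have "Q (dbl a) (dbl b) 0 0 b"
      using that z(3)[of a] by (simp add: p R_def Q_def gl v w' w u v')
    then show ?thesis
      unfolding p S_def by auto
  qed
  have SG: "dbl p \<in> G0" if pS: "p \<in> S" for p
  proof -
    obtain a b y y' t where p: "p = (a, b)" and q: "Q a b y y' t"
      using pS unfolding S_def by blast
    have "dbl b = v' (g y)" "dbl a = v y" "y \<in> Vec Y"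
      using q by (simp_all add: Q_def v' dbl_add)
    then show ?thesis
      unfolding p G0_def by (intro image_eqI[where x = y]) simp_all
  qed
  have G0S: "G0 \<subseteq> S"
  proof
    fix p assume "p \<in> G0"
    then obtain y where y: "y \<in> Vec Y" "p = (v y, v' (g y))"
      unfolding G0_def by blast
    \<comment> \<open>A point in the image of \<open>v\<close> is hit by an even cycle, so
      \<open>t = 0\<close> serves.\<close>
    have "Q (v y) (v' (g y)) (dbl y) (g y) 0"
      using y(1) by (simp add: Q_def gl v v' w' u V z z')
    then show "p \<in> S"
      unfolding y(2) S_def by blast
  qed
  have "admissible Z R S G0"
    unfolding admissible_def
  proof (intro conjI ballI allI impI)
    show "addsub G0"
      unfolding addsub_def
    proof (intro conjI ballI)
      show "0 \<in> G0"
        unfolding G0_def zero_prod_def by (rule image_eqI[where x = 0]) (simp_all add: v gl v')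
      show "p + q \<in> G0" if pq: "p \<in> G0" "q \<in> G0" for p q
      proof -
        obtain y1 y2 where "y1 \<in> Vec Y" "p = (v y1, v' (g y1))" "y2 \<in> Vec Y" "q = (v y2, v' (g y2))"
          using pq unfolding G0_def by blast
        then show ?thesis
          unfolding G0_def by (intro image_eqI[where x = "y1 + y2"]) (simp_all add: v gl v')
      qed
      show "- p \<in> G0" if pq: "p \<in> G0" for p
      proof -
        obtain y1 where "y1 \<in> Vec Y" "p = (v y1, v' (g y1))"
          using pq unfolding G0_def by blast
        then show ?thesis
          unfolding G0_def by (intro image_eqI[where x = "- y1"]) (simp_all add: v gl v')
      qed
    qed
    show "G0 \<subseteq> R"
      using G0S S2 by (rule subset_trans)
    show "b = 0" if b: "(0, b) \<in> G0" for b
    proof -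
      obtain y where y: "y \<in> Vec Y" "v y = 0" "b = v' (g y)"
        using b unfolding G0_def by auto
      then obtain x where "y = u x"
        using tri_exact(1)[OF T] by blast
      then show ?thesis
        using y(3) gu z'(1) by simp
    qed
    show "\<exists>b. (a, b) \<in> R \<and> dbl b = d" if a: "a \<in> Vec Z" and d: "(dbl a, d) \<in> G0" for a d
    proof -
      obtain y where y: "y \<in> Vec Y" "v y = dbl a" "d = v' (g y)"
        using d unfolding G0_def by auto
      \<comment> \<open>Both monodromies enter: that of \<open>T\<close> yields \<open>x\<close>,
        and that of \<open>T'\<close>, read after two rotations, halves \<open>v' (g y)\<close> by
        some \<open>b\<close> with the required \<open>w' b = w a\<close>.\<close>
      obtain x where x: "x \<in> Vec X" "w a = dbl x" "u x = dbl y"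
        using tri_half[OF T y(1) a y(2)] by blast
      have "u' x = dbl (g y)"
        using gu[of x] by (simp add: x gl)
      then obtain b where "b \<in> Vec Z'" "v' (g y) = dbl b" "w' b = dbl x"
        using tri_half[OF tri_rotate[OF tri_rotate[OF T']] x(1) V(7)] by blast
      then show ?thesis
        using a x(2) y(3) unfolding R_def by auto
    qed
    show "(a, b) \<in> S" if "(a, b) \<in> G0" for a b
      using that G0S by blast
  qed
  from extend_linear[OF R1 R2 R3 S1 S2 RS SG this]
  obtain h where h: "h \<in> Lin Z Z'" "\<forall>a\<in>Vec Z. (a, h a) \<in> R" "\<forall>(a, b)\<in>G0. h a = b"
    "\<forall>a\<in>Domain S. (a, h a) \<in> S"
    by (auto simp del: Domain_iff)
  have 1: "h (v y) = v' (g y)" for y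
  proof -
    have "(v (trunc Y y), v' (g (trunc Y y))) \<in> G0"
      unfolding G0_def by blast
    then show ?thesis
      using h(3) by (fastforce simp: Lin_trunc[OF L(2)] Lin_trunc[OF g])
  qed
  have 2: "w' (h a) = w a" for a
  proof -
    have "(trunc Z a, h (trunc Z a)) \<in> R"
      using h(2) by blast
    then show ?thesis
      by (simp add: R_def Lin_trunc[OF h(1)] Lin_trunc[OF L(3)])
  qed
  have 3: "\<exists>t\<in>Vec Z'. h a = v' y' + dbl t \<and> u (w' t) = dbl y"
    if y: "y \<in> Vec Y" "y' \<in> Vec Y'" "a \<in> Vec Z" "g y = dbl y'" "v y = dbl a" for y y' a
  proof -
    obtain x where x: "x \<in> Vec X" "w a = dbl x" "u x = dbl y"
      using tri_half[OF T y(1,3,5)] by blast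
    have "u' x = 0"
      using gu[of x] by (simp add: x gl y)
    then obtain t where t: "t \<in> Vec Z'" "x = w' t"
      using tri_exact(3)[OF T' x(1)] by blast
    have "Q a (v' y' + dbl t) y y' t"
      using y x t by (simp add: Q_def V w' z')
    then have "a \<in> Domain S"
      unfolding S_def by blast
    then have "(a, h a) \<in> S"
      using h(4) by blast
    \<comment> \<open>Membership in \<open>S\<close> brings witnesses of its own; what remains is
      independence of the cycle representing \<open>a\<close>.\<close>
    then obtain y1 y1' t1 where q: "Q a (h a) y1 y1' t1"
      unfolding S_def by blast
    have y1: "y1 \<in> Vec Y" "y1' \<in> Vec Y'" "t1 \<in> Vec Z'" "g y1 = dbl y1'" "v y1 = dbl a"
      "u (w' t1) = dbl y1" "h a = v' y1' + dbl t1"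
      using q unfolding Q_def by blast+
    \<comment> \<open>The two cycles differ by \<open>u x1\<close>, and the monodromy of
      \<open>T'\<close> turns \<open>x1\<close> into the correction \<open>s\<close> of
      \<open>t1\<close>.\<close>
    have "v (y - y1) = 0"
      by (simp add: v y y1)
    then obtain x1 where x1: "x1 \<in> Vec X" "y - y1 = u x1"
      using tri_exact(1)[OF T Vec_diff[OF y(1) y1(1)]] by blast
    have "u' x1 = dbl (y' - y1')"
      using gu[of x1] by (simp add: x1(2)[symmetric] gl y y1 dbl_diff)
    then obtain s where s: "s \<in> Vec Z'" "v' (y' - y1') = dbl s" "w' s = dbl x1"
      using tri_half[OF tri_rotate[OF tri_rotate[OF T']] x1(1) Vec_diff[OF y(2) y1(2)]] by blast
    have "v' y' = v' y1' + dbl s"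
      using s(2) by (simp add: v' algebra_simps)
    moreover have "dbl s + dbl s = 0"
      using dbl_dbl[of s] unfolding dbl_def[of "dbl s"] .
    ultimately have "h a = v' y' + dbl (t1 + s)"
      by (simp add: y1(7) dbl_add add_ac del: mult_2 mult_2_right)
    moreover have "u (w' (t1 + s)) = dbl y"
      by (simp add: w' u y1(6) s(3) x1(2)[symmetric] dbl_diff)
    ultimately show ?thesis
      using Vec_add[OF y1(3) s(1)] by blast
  qed
  show ?thesis
    using h(1) 1 2 3 by (intro bexI[OF _ h(1)] conjI allI ballI impI)
qed

section \<open>Reduced mapping cones and the octahedral axiom\<close>

abbreviation pair :: "nat \<Rightarrow> nat \<Rightarrow> (vec \<Rightarrow> vec) \<Rightarrow> (vec \<Rightarrow> vec) \<Rightarrow> vec \<Rightarrow> vec" where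
  "pair n m f g \<equiv> (inl n m \<circ> f) + (inr n m \<circ> g)"

text \<open>The sign makes the composite after \<open>pair\<close> vanish on a commuting
  square.\<close>

abbreviation copair :: "nat \<Rightarrow> nat \<Rightarrow> (vec \<Rightarrow> vec) \<Rightarrow> (vec \<Rightarrow> vec) \<Rightarrow> vec \<Rightarrow> vec" where
  "copair n m f g \<equiv> (f \<circ> outl n m) + - (g \<circ> outr n m)"

lemma Lin_pair:
  assumes "f \<in> Lin k n" "g \<in> Lin k m"
  shows "pair n m f g \<in> Lin k (n + m)"
  by (intro Lin_plus Lin_comp[OF assms(1) Lin_inl] Lin_comp[OF assms(2) Lin_inr])

lemma Lin_copair:
  assumes "f \<in> Lin n k" "g \<in> Lin m k"
  shows "copair n m f g \<in> Lin (n + m) k"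
  by (intro Lin_plus Lin_neg Lin_comp[OF Lin_outl assms(1)] Lin_comp[OF Lin_outr assms(2)])

text \<open>The triangle obtained is the mapping cone of (id, \<open>g\<close>, \<open>h\<close>)
  with its contractible summand X split off.\<close>

lemma cone_fill_in:
  assumes T: "tri X Y Z u v w" and T': "tri X Y' Z' u' v' w'"
    and g: "g \<in> Lin Y Y'" and gu: "\<And>x. g (u x) = u' x"
  shows "\<exists>h\<in>Lin Z Z'. (\<forall>y. h (v y) = v' (g y)) \<and> (\<forall>z. w' (h z) = w z) \<and>
    tri Y (Y' + Z) Z' (pair Y' Z g v) (copair Y' Z v' h) (u \<circ> w')"
proof -
  obtain h where h: "h \<in> Lin Z Z'" and hv: "\<And>y. h (v y) = v' (g y)" and wh: "\<And>z. w' (h z) = w z"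
    and half: "\<And>y y' z. y \<in> Vec Y \<Longrightarrow> y' \<in> Vec Y' \<Longrightarrow> z \<in> Vec Z \<Longrightarrow> g y = dbl y' \<Longrightarrow> v y = dbl z \<Longrightarrow>
      \<exists>t\<in>Vec Z'. h z = v' y' + dbl t \<and> u (w' t) = dbl y"
    using good_fill_in[OF T T' g gu] by blast
  note L = tri_Lin[OF T] and L' = tri_Lin[OF T']
  note u = Lin_simps[OF L(1)] and v = Lin_simps[OF L(2)] and w = Lin_simps[OF L(3)]
  note v' = Lin_simps[OF L'(2)] and w' = Lin_simps[OF L'(3)]
  note gl = Lin_simps[OF g] and hl = Lin_simps[OF h]
  note V = Lin_Vec[OF L(1)] Lin_Vec[OF L(2)] Lin_Vec[OF L(3)] Lin_Vec[OF L'(1)] Lin_Vec[OF L'(2)]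
    Lin_Vec[OF L'(3)] Lin_Vec[OF g] Lin_Vec[OF h]
  note z = tri_zero[OF T] and z' = tri_zero[OF T']
  note O = Lin_Vec[OF Lin_outl] Lin_Vec[OF Lin_outr]
  \<comment> \<open>In this rotation the monodromy clause starts from Y, where \<open>half\<close>
    provides it; rotating once gives the stated triangle.\<close>
  have "tri Z' Y (Y' + Z) (u \<circ> w') (pair Y' Z g v) (copair Y' Z v' h)"
  proof (rule triI)
    show "u \<circ> w' \<in> Lin Z' Y" "pair Y' Z g v \<in> Lin Y (Y' + Z)"
      "copair Y' Z v' h \<in> Lin (Y' + Z) Z'"
      using Lin_comp[OF L'(3) L(1)] Lin_pair[OF g L(2)] Lin_copair[OF L'(2) h] by simp_all
  next
    fix x
    show "(pair Y' Z g v) ((u \<circ> w') x) = 0"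
      by (simp add: gu z z')
    show "(copair Y' Z v' h) ((pair Y' Z g v) x) = 0"
      by (simp add: V hv)
    show "(u \<circ> w') ((copair Y' Z v' h) x) = 0"
      by (simp add: u w' wh z z')
  next
    fix y assume y: "y \<in> Vec Y" "(pair Y' Z g v) y = 0"
    have "outl Y' Z ((pair Y' Z g v) y) = 0" "outr Y' Z ((pair Y' Z g v) y) = 0"
      unfolding y(2) by simp_all
    then have gy: "g y = 0" "v y = 0"
      by (simp_all add: V)
    obtain x where x: "x \<in> Vec X" "y = u x"
      using tri_exact(1)[OF T y(1) gy(2)] by blast
    have "u' x = 0"
      using gy(1) gu[of x] x(2) by simp
    then obtain t where "t \<in> Vec Z'" "x = w' t"
      using tri_exact(3)[OF T' x(1)] by blast
    then show "\<exists>t\<in>Vec Z'. y = (u \<circ> w') t"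
      using x(2) by auto
  next
    fix s assume s: "s \<in> Vec (Y' + Z)" "(copair Y' Z v' h) s = 0"
    have eq: "h (outr Y' Z s) = v' (outl Y' Z s)"
      using s(2) by simp
    then have "w (outr Y' Z s) = 0"
      using wh[of "outr Y' Z s"] z' by simp
    then obtain y where y: "y \<in> Vec Y" "outr Y' Z s = v y"
      using tri_exact(2)[OF T O(2)] by blast
    have "v' (outl Y' Z s - g y) = 0"
      using hv[of y] eq by (simp add: v' y(2))
    then obtain x where x: "x \<in> Vec X" "outl Y' Z s - g y = u' x"
      using tri_exact(1)[OF T' Vec_diff[OF O(1) V(7)]] by blast
    have "s = (pair Y' Z g v) (y + u x)"
    proof (rule biprod_eqI[OF s(1)])
      show "(pair Y' Z g v) (y + u x) \<in> Vec (Y' + Z)"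
        by (simp add: Lin_Vec[OF Lin_inl] Lin_Vec[OF Lin_inr])
      show "outl Y' Z s = outl Y' Z ((pair Y' Z g v) (y + u x))"
        by (simp add: V O v gl gu x(2)[symmetric])
      show "outr Y' Z s = outr Y' Z ((pair Y' Z g v) (y + u x))"
        by (simp add: V v gl z y)
    qed
    then show "\<exists>y\<in>Vec Y. s = (pair Y' Z g v) y"
      using Vec_add[OF y(1) V(1)] by blast
  next
    fix t assume t: "t \<in> Vec Z'" "(u \<circ> w') t = 0"
    then obtain z1 where z1: "z1 \<in> Vec Z" "w' t = w z1"
      using tri_exact(3)[OF T V(6), of t] by auto
    have "w' (t - h z1) = 0"
      by (simp add: w' wh z1(2))
    then obtain y' where y': "y' \<in> Vec Y'" "t - h z1 = v' y'"
      using tri_exact(2)[OF T' Vec_diff[OF t(1) V(8)]] by blast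
    have "t = (copair Y' Z v' h) (inl Y' Z y' + inr Y' Z (- z1))"
      using y' z1(1) by (simp add: hl algebra_simps)
    moreover have "inl Y' Z y' + inr Y' Z (- z1) \<in> Vec (Y' + Z)"
      by (intro Vec_add Lin_Vec[OF Lin_inl] Lin_Vec[OF Lin_inr])
    ultimately show "\<exists>s\<in>Vec (Y' + Z). t = (copair Y' Z v' h) s"
      by blast
  next
    fix y s assume y: "y \<in> Vec Y" and s: "s \<in> Vec (Y' + Z)"
      and eq: "(pair Y' Z g v) y = dbl s"
    have "outl Y' Z ((pair Y' Z g v) y) = dbl (outl Y' Z s)"
      "outr Y' Z ((pair Y' Z g v) y) = dbl (outr Y' Z s)"
      unfolding eq by simp_all
    then have "g y = dbl (outl Y' Z s)" "v y = dbl (outr Y' Z s)"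
      by (simp_all add: V)
    from half[OF y O this] obtain t where
      "t \<in> Vec Z'" "h (outr Y' Z s) = v' (outl Y' Z s) + dbl t" "u (w' t) = dbl y"
      by blast
    then show "\<exists>t\<in>Vec Z'. (copair Y' Z v' h) s = dbl t \<and> (u \<circ> w') t = dbl y"
      by (intro bexI[of _ t]) simp_all
  qed
  from tri_rotate[OF this] show ?thesis
    using h hv wh by blast
qed

text \<open>The square from \<open>a\<close> to \<open>b a\<close> gives \<alpha> and a triangle Q
  -> R + K -> N. Projecting R + K to R compares it with the triangle on \<open>b\<close> and gives
  \<beta>. In the second cone R + K -> R + N -> M the two copies of R cancel, leaving K -> N -> M up
  to sign.\<close>

lemma tri_octahedron:
  assumes A: "tri P Q K a a' a''" and B: "tri Q R M b b' b''" and C: "tri P R N c c' c''"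
    and c: "\<And>x. b (a x) = c x"
  shows "\<exists>\<alpha> \<beta>. tri K N M \<alpha> \<beta> (a' \<circ> b'') \<and> (\<forall>y. \<alpha> (a' y) = c' (b y)) \<and> (\<forall>z. c'' (\<alpha> z) = a'' z) \<and>
    (\<forall>y. \<beta> (c' y) = b' y) \<and> (\<forall>z. b'' (\<beta> z) = a (c'' z))"
proof -
  note LA = tri_Lin[OF A] and LB = tri_Lin[OF B] and LC = tri_Lin[OF C]
  let ?i = "inl R K" and ?j = "inr R K" and ?p = "outl R K" and ?q = "outr R K"
  obtain \<alpha> where \<alpha>: "\<alpha> \<in> Lin K N" "\<And>y. \<alpha> (a' y) = c' (b y)" "\<And>z. c'' (\<alpha> z) = a'' z"
    and T1: "tri Q (R + K) N (pair R K b a') (copair R K c' \<alpha>) (a \<circ> c'')"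
    using cone_fill_in[OF A C LB(1) c] by blast
  have "?p ((pair R K b a') x) = b x" for x
    by (simp add: Lin_Vec[OF LB(1)])
  from cone_fill_in[OF T1 B Lin_outl this]
  obtain \<beta> where \<beta>: "\<beta> \<in> Lin N M" "\<And>y. \<beta> ((copair R K c' \<alpha>) y) = b' (?p y)"
      "\<And>z. b'' (\<beta> z) = (a \<circ> c'') z"
    and T2: "tri (R + K) (R + N) M (pair R N ?p (copair R K c' \<alpha>))
      (copair R N b' \<beta>) ((pair R K b a') \<circ> b'')"
    by blast
  note V = Lin_Vec[OF LA(1)] Lin_Vec[OF LA(2)] Lin_Vec[OF LA(3)] Lin_Vec[OF LB(1)] Lin_Vec[OF LB(2)]
    Lin_Vec[OF LB(3)] Lin_Vec[OF LC(1)] Lin_Vec[OF LC(2)] Lin_Vec[OF LC(3)] Lin_Vec[OF \<alpha>(1)] Lin_Vec[OF \<beta>(1)]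
  note O = Lin_Vec[OF Lin_outl] Lin_Vec[OF Lin_outr] Lin_Vec[OF Lin_inl] Lin_Vec[OF Lin_inr]
  note \<alpha>l = Lin_simps[OF \<alpha>(1)] and \<beta>l = Lin_simps[OF \<beta>(1)] and c'l = Lin_simps[OF LC(2)]
    and b'l = Lin_simps[OF LB(2)] and a'l = Lin_simps[OF LA(2)]
  have \<beta>c: "\<beta> (c' y) = b' y" for y
    using \<beta>(2)[of "?i (trunc R y)"]
    by (simp add: \<alpha>l Lin_trunc[OF LB(2)] Lin_trunc[OF LC(2)])
  have \<beta>\<alpha>: "\<beta> (\<alpha> z) = 0" for z
    using \<beta>(2)[of "?j (trunc K z)"]
    by (simp add: c'l b'l \<beta>l Lin_trunc[OF \<alpha>(1)])
  have out2: "outl R N ((pair R N ?p (copair R K c' \<alpha>)) s) = ?p s"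
    "outr R N ((pair R N ?p (copair R K c' \<alpha>)) s) = c' (?p s) - \<alpha> (?q s)" for s
    by (simp_all add: O V)
  have out3: "?p (((pair R K b a') \<circ> b'') k) = 0" "?q (((pair R K b a') \<circ> b'') k) = a' (b'' k)" for k
    by (simp_all add: V tri_zero[OF B])
  have "tri K N M \<alpha> \<beta> (a' \<circ> b'')"
  proof (rule triI)
    fix k
    show "\<beta> (\<alpha> k) = 0"
      by (rule \<beta>\<alpha>)
    show "(a' \<circ> b'') (\<beta> k) = 0"
      by (simp add: \<beta>(3) tri_zero[OF A])
    show "\<alpha> ((a' \<circ> b'') k) = 0"
      by (simp add: \<alpha>(2) tri_zero[OF B] c'l)
  next
    fix y assume y: "y \<in> Vec N" "\<beta> y = 0"
    \<comment> \<open>Cancelling R on elements: vectors with zero R component have preimages with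
      zero R component, here and in the cases below.\<close>
    have "(copair R N b' \<beta>) (inr R N y) = 0"
      using y by (simp add: b'l)
    then obtain s where s: "s \<in> Vec (R + K)"
        "inr R N y = (pair R N ?p (copair R K c' \<alpha>)) s"
      using tri_exact(1)[OF T2 O(4)] by blast
    have "outl R N (inr R N y) = ?p s" "outr R N (inr R N y) = c' (?p s) - \<alpha> (?q s)"
      unfolding s(2) out2 by (rule refl)+
    then have "y = \<alpha> (- ?q s)"
      using y(1) by (simp add: c'l \<alpha>l)
    then show "\<exists>x\<in>Vec K. y = \<alpha> x"
      using Vec_uminus[OF O(2)] by blast
  next
    fix k assume k: "k \<in> Vec M" "(a' \<circ> b'') k = 0"
    have "((pair R K b a') \<circ> b'') k = 0"
      using k(2) by (simp add: tri_zero[OF B])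
    then obtain s where s: "s \<in> Vec (R + N)" "k = (copair R N b' \<beta>) s"
      using tri_exact(2)[OF T2 k(1)] by blast
    have "k = \<beta> (c' (outl R N s) - outr R N s)"
      using s(2) by (simp add: \<beta>l \<beta>c)
    then show "\<exists>y\<in>Vec N. k = \<beta> y"
      using Vec_diff[OF V(8) O(2)] by blast
  next
    fix z assume z: "z \<in> Vec K" "\<alpha> z = 0"
    have "(pair R N ?p (copair R K c' \<alpha>)) (?j z) = 0"
      using z by (simp add: c'l)
    then obtain k where k: "k \<in> Vec M" "?j z = ((pair R K b a') \<circ> b'') k"
      using tri_exact(3)[OF T2 O(4)] by blast
    have "?q (?j z) = a' (b'' k)"
      unfolding k(2) out3 by (rule refl)
    then have "z = a' (b'' k)"
      using z(1) by simp
    then show "\<exists>k\<in>Vec M. z = (a' \<circ> b'') k"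
      using k(1) by auto
  next
    fix y k assume y: "y \<in> Vec N" and k: "k \<in> Vec M" and yk: "\<beta> y = dbl k"
    have "(copair R N b' \<beta>) (inr R N (- y)) = dbl k"
      using y by (simp add: b'l \<beta>l yk)
    then obtain s where s: "s \<in> Vec (R + K)" "((pair R K b a') \<circ> b'') k = dbl s"
        "(pair R N ?p (copair R K c' \<alpha>)) s = dbl (inr R N (- y))"
      using tri_half[OF T2 O(4) k] by blast
    have "a' (b'' k) = dbl (?q s)"
      using arg_cong[OF s(2), of ?q] unfolding out3 by simp
    moreover have "?p s = outl R N (dbl (inr R N (- y)))" "c' (?p s) - \<alpha> (?q s) = outr R N (dbl (inr R N (- y)))"
      unfolding s(3)[symmetric] out2 by (rule refl)+
    then have "- \<alpha> (?q s) = dbl y"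
      using y by (simp add: c'l dbl_uminus)
    then have "\<alpha> (?q s) = dbl y"
      by (metis minus_minus uminus_dbl)
    ultimately show "\<exists>x\<in>Vec K. (a' \<circ> b'') k = dbl x \<and> \<alpha> x = dbl y"
      using O(2) by auto
  qed (use \<alpha>(1) \<beta>(1) Lin_comp[OF LB(3) LA(2)] in simp_all)
  then show ?thesis
    using \<alpha>(2,3) \<beta>c \<beta>(3) by auto
qed

text \<open>
  The fill-in is assembled from two octahedra, over the factorizations \<open>g u\<close> and \<open>u' f\<close> of the
  diagonal of the square.
\<close>

lemma tri_fill_in:
  assumes T: "tri X Y Z u v w" and T': "tri X' Y' Z' u' v' w'"
    and f: "tri X X' F f f\<^sub>1 f\<^sub>2" and g: "tri Y Y' G g g\<^sub>1 g\<^sub>2" and c: "tri X Y' C c c\<^sub>1 c\<^sub>2"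
    and gu: "\<And>x. g (u x) = c x" and uf: "\<And>x. u' (f x) = c x"
  shows "\<exists>h\<in>Lin Z Z'. (\<forall>y. h (v y) = v' (g y)) \<and> (\<forall>z. w' (h z) = f (w z))"
proof -
  obtain \<alpha> where \<alpha>: "\<alpha> \<in> Lin Z C" "\<And>y. \<alpha> (v y) = c\<^sub>1 (g y)" "\<And>z. c\<^sub>2 (\<alpha> z) = w z"
    using tri_octahedron[OF T g c gu] tri_Lin(1) by blast
  obtain \<beta> where \<beta>: "\<beta> \<in> Lin C Z'" "\<And>y. \<beta> (c\<^sub>1 y) = v' y" "\<And>z. w' (\<beta> z) = f (c\<^sub>2 z)"
    using tri_octahedron[OF f T' c uf] tri_Lin(2) by blast
  show ?thesis
    using Lin_comp[OF \<alpha>(1) \<beta>(1)] by (rule bexI[rotated]) (simp add: \<alpha> \<beta>)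
qed

section \<open>Existence of triangles\<close>

definition smul :: "4 \<Rightarrow> vec \<Rightarrow> vec" where
  "smul c x = (\<lambda>i. c * x i)"

definition vcons :: "4 \<Rightarrow> vec \<Rightarrow> vec" where
  "vcons c x = (\<lambda>i. case i of 0 \<Rightarrow> c | Suc j \<Rightarrow> x j)"

definition vtl :: "vec \<Rightarrow> vec" where
  "vtl x = (\<lambda>i. x (Suc i))"

lemma vcons_simps [simp]: "vcons c x 0 = c" "vtl (vcons c x) = x" "vcons (x 0) (vtl x) = x"
  by (auto simp: vcons_def vtl_def fun_eq_iff split: nat.splits)

lemma vec_eqI: "x 0 = y 0 \<Longrightarrow> vtl x = vtl y \<Longrightarrow> x = y"
  by (metis vcons_simps(3))

lemma vtl_simps [simp]:
  "vtl (x + y) = vtl x + vtl y" "vtl (x - y) = vtl x - vtl y" "vtl (- x) = - vtl x" "vtl 0 = 0"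
  "vtl (dbl x) = dbl (vtl x)" "vtl (trunc (Suc n) x) = trunc n (vtl x)" "vtl (smul c x) = smul c (vtl x)"
  by (auto simp: vtl_def fun_eq_iff dbl_def trunc_def smul_def)

lemma head_simps [simp]: "dbl x 0 = dbl (x 0 :: 4)" "trunc (Suc n) x 0 = x 0" "smul c x 0 = c * x 0"
  by (simp_all add: dbl_def trunc_def smul_def)

lemma vcons_add: "vcons (a + b) (x + y) = vcons a x + vcons b y"
  by (rule vec_eqI) simp_all

lemma vcons_0 [simp]: "vcons 0 0 = 0"
  by (rule vec_eqI) simp_all

lemma vcons_Vec [simp]: "vcons c x \<in> Vec (Suc n) \<longleftrightarrow> x \<in> Vec n"
proof
  show "x \<in> Vec n" if "vcons c x \<in> Vec (Suc n)"
    unfolding Vec_def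
  proof (intro CollectI allI impI)
    fix i assume "n \<le> i"
    then have "vcons c x (Suc i) = 0"
      using that unfolding Vec_def by blast
    then show "x i = 0"
      by (simp add: vcons_def)
  qed
qed (auto simp: Vec_def vcons_def split: nat.splits)

lemma vtl_Vec [simp]: "x \<in> Vec (Suc n) \<Longrightarrow> vtl x \<in> Vec n"
  by (simp add: Vec_def vtl_def)

lemma smul_Vec [simp]: "x \<in> Vec n \<Longrightarrow> smul c x \<in> Vec n"
  by (simp add: Vec_def smul_def)

lemma smul_simps [simp]:
  "smul c (x + y) = smul c x + smul c y" "smul (c + d) x = smul c x + smul d x"
  "smul c (smul d x) = smul (c * d) x" "smul 1 x = x" "smul 0 x = 0" "smul c 0 = 0"
  by (simp_all add: smul_def fun_eq_iff algebra_simps)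

text \<open>Additivity suffices because every scalar of Z/4 is a multiple of 1.\<close>

lemma Lin_smul:
  assumes "f \<in> Lin n m"
  shows "f (smul c x) = smul c (f x)"
proof -
  have 2: "smul 2 y = dbl y" "smul 3 y = dbl y + y" for y
    by (simp_all add: smul_def dbl_def fun_eq_iff)
  show ?thesis
    by (cases c rule: z4_cases) (simp_all add: 2 Lin_simps[OF assms])
qed

lemma dbl_eq_0_z4: "dbl (c::4) = 0 \<Longrightarrow> \<exists>d. c = dbl d"
  using z4_half unfolding dbl_def .

lemma dbl_dbl_z4 [simp]: "dbl (dbl (c::4)) = 0"
  unfolding dbl_def by (rule z4_double_double)

text \<open>Adds the contractible triangle Z/4 = Z/4 -> 0, which accounts for a unit pivot.\<close>

lemma tri_plus_contractible:
  assumes T: "tri X Y Z u v w"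
  shows "tri (Suc X) (Suc Y) Z (\<lambda>x. vcons (x 0) (u (vtl x))) (\<lambda>y. v (vtl y)) (\<lambda>z. vcons 0 (w z))"
proof -
  note L = tri_Lin[OF T]
  note u = Lin_simps[OF L(1)] and v = Lin_simps[OF L(2)] and w = Lin_simps[OF L(3)]
  note V = Lin_Vec[OF L(1)] Lin_Vec[OF L(2)] Lin_Vec[OF L(3)]
  note tr = Lin_trunc[OF L(1)] Lin_trunc[OF L(2)] Lin_trunc[OF L(3)]
  show ?thesis
  proof (rule triI)
    show "(\<lambda>x. vcons (x 0) (u (vtl x))) \<in> Lin (Suc X) (Suc Y)"
      by (rule LinI) (simp_all add: u tr V vcons_add)
    show "(\<lambda>y. v (vtl y)) \<in> Lin (Suc Y) Z"
      by (rule LinI) (simp_all add: v tr V)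
    show "(\<lambda>z. vcons 0 (w z)) \<in> Lin Z (Suc X)"
      by (rule LinI) (simp_all add: w tr V flip: vcons_add)
  next
    fix y assume y: "y \<in> Vec (Suc Y)" "v (vtl y) = 0"
    then obtain x where "x \<in> Vec X" "vtl y = u x"
      using tri_exact(1)[OF T vtl_Vec] by blast
    then show "\<exists>x\<in>Vec (Suc X). y = vcons (x 0) (u (vtl x))"
      by (intro bexI[of _ "vcons (y 0) x"]) (simp_all flip: \<open>vtl y = u x\<close>)
  next
    fix z assume z: "z \<in> Vec Z" "vcons 0 (w z) = 0"
    have "w z = 0"
      using arg_cong[OF z(2), of vtl] by simp
    then obtain y where "y \<in> Vec Y" "z = v y"
      using tri_exact(2)[OF T z(1)] by blast
    then show "\<exists>y\<in>Vec (Suc Y). z = v (vtl y)"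
      by (intro bexI[of _ "vcons 0 y"]) simp_all
  next
    fix x assume x: "x \<in> Vec (Suc X)" "vcons (x 0) (u (vtl x)) = 0"
    have 0: "u (vtl x) = 0" "x 0 = 0"
      using arg_cong[OF x(2), of vtl] fun_cong[OF x(2), of 0] by simp_all
    then obtain z where z: "z \<in> Vec Z" "vtl x = w z"
      using tri_exact(3)[OF T vtl_Vec[OF x(1)]] by blast
    have "x = vcons 0 (w z)"
      by (rule vec_eqI) (simp_all add: 0 z)
    then show "\<exists>z\<in>Vec Z. x = vcons 0 (w z)"
      using z(1) by blast
  next
    fix y z assume y: "y \<in> Vec (Suc Y)" and z: "z \<in> Vec Z" and yz: "v (vtl y) = dbl z"
    obtain x where x: "x \<in> Vec X" "w z = dbl x" "u x = dbl (vtl y)"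
      using tri_half[OF T vtl_Vec[OF y] z yz] by blast
    \<comment> \<open>The head must have double 0 and be equal to \<open>dbl (y 0)\<close>, which
      leaves no choice.\<close>
    have "vcons 0 (w z) = dbl (vcons (dbl (y 0)) x)"
      by (rule vec_eqI) (simp_all add: x)
    moreover have "vcons (dbl (y 0)) (u x) = dbl y"
      by (rule vec_eqI) (simp_all add: x)
    ultimately show "\<exists>x\<in>Vec (Suc X). vcons 0 (w z) = dbl x \<and> vcons (x 0) (u (vtl x)) = dbl y"
      using x(1) by (intro bexI[of _ "vcons (dbl (y 0)) x"]) simp_all
  qed (simp_all add: tri_zero[OF T])
qed

text \<open>Adds a copy of T, which accounts for a pivot 2; each of its connecting maps is the
  identity of Z/2.\<close>

lemma tri_plus_double:
  assumes T: "tri X Y Z u v w"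
  shows "tri (Suc X) (Suc Y) (Suc Z) (\<lambda>x. vcons (dbl (x 0)) (u (vtl x)))
    (\<lambda>y. vcons (dbl (y 0)) (v (vtl y))) (\<lambda>z. vcons (dbl (z 0)) (w (vtl z)))"
proof -
  have Lin: "(\<lambda>x. vcons (dbl (x 0)) (f (vtl x))) \<in> Lin (Suc n) (Suc m)" if f: "f \<in> Lin n m" for f n m
    by (rule LinI) (simp_all add: Lin_add[OF f] Lin_trunc[OF f] Lin_Vec[OF f] dbl_add vcons_add)
  have exact: "\<exists>x\<in>Vec (Suc n). y = vcons (dbl (x 0)) (f (vtl x))"
    if y: "y \<in> Vec (Suc m)" "vcons (dbl (y 0)) (g (vtl y)) = 0"
      and fg: "\<And>y. y \<in> Vec m \<Longrightarrow> g y = 0 \<Longrightarrow> \<exists>x\<in>Vec n. y = f x" for y f g n m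
  proof -
    have 0: "g (vtl y) = 0" "dbl (y 0) = 0"
      using arg_cong[OF y(2), of vtl] fun_cong[OF y(2), of 0] by simp_all
    obtain x where x: "x \<in> Vec n" "vtl y = f x"
      using fg[OF vtl_Vec[OF y(1)] 0(1)] by blast
    obtain d where d: "y 0 = dbl d"
      using dbl_eq_0_z4[OF 0(2)] by blast
    show ?thesis
      using x(1) vec_eqI[of y "vcons (dbl d) (f x)"] by (intro bexI[of _ "vcons d x"]) (simp_all add: x(2) d)
  qed
  have zero: "vcons (dbl (vcons (dbl (x 0)) (f (vtl x)) 0)) (g (vtl (vcons (dbl (x 0)) (f (vtl x))))) = 0"
    if "\<And>x. g (f x) = 0" for f g x
    by (rule vec_eqI) (simp_all add: that)
  show ?thesis
  proof (rule triI)
    fix y z assume y: "y \<in> Vec (Suc Y)" and z: "z \<in> Vec (Suc Z)"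
      and yz: "vcons (dbl (y 0)) (v (vtl y)) = dbl z"
    have 0: "v (vtl y) = dbl (vtl z)" "dbl (y 0) = dbl (z 0)"
      using arg_cong[OF yz, of vtl] fun_cong[OF yz, of 0] by simp_all
    obtain x where x: "x \<in> Vec X" "w (vtl z) = dbl x" "u x = dbl (vtl y)"
      using tri_half[OF T vtl_Vec[OF y] vtl_Vec[OF z] 0(1)] by blast
    have "vcons (dbl (z 0)) (w (vtl z)) = dbl (vcons (y 0) x)"
      by (rule vec_eqI) (simp_all add: x 0)
    moreover have "vcons (dbl (y 0)) (u x) = dbl y"
      by (rule vec_eqI) (simp_all add: x)
    ultimately show "\<exists>x\<in>Vec (Suc X). vcons (dbl (z 0)) (w (vtl z)) = dbl x \<and> vcons (dbl (x 0)) (u (vtl x)) = dbl y"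
      using x(1) by (intro bexI[of _ "vcons (y 0) x"]) simp_all
  qed (rule Lin[OF tri_Lin(1)[OF T]] Lin[OF tri_Lin(2)[OF T]] Lin[OF tri_Lin(3)[OF T]]
      zero[where f = u and g = v, OF tri_zero(1)[OF T]] zero[where f = v and g = w, OF tri_zero(2)[OF T]] zero[where f = w and g = u, OF tri_zero(3)[OF T]]
      exact[where f = u and g = v, OF _ _ tri_exact(1)[OF T]] exact[where f = v and g = w, OF _ _ tri_exact(2)[OF T]] exact[where f = w and g = u, OF _ _ tri_exact(3)[OF T]];
      assumption)+
qed

text \<open>The split triangle ends the reduction. Its cycles modulo 2 at Y are even, so the
  monodromy has nothing to move there.\<close>

lemma tri_of_zero: "tri X Y (Y + X) 0 (inl Y X) (outr Y X)"
proof (rule triI)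
  fix y assume "y \<in> Vec Y" "inl Y X y = 0"
  then have "y = 0"
    using out_in(1)[of y Y X] by simp
  then show "\<exists>x\<in>Vec X. y = 0 x"
    by auto
next
  fix z assume z: "z \<in> Vec (Y + X)" "outr Y X z = 0"
  then show "\<exists>y\<in>Vec Y. z = inl Y X y"
    using in_out[OF z(1)] Lin_Vec[OF Lin_outl] by (intro bexI[of _ "outl Y X z"]) simp_all
next
  fix x assume "x \<in> Vec X"
  then show "\<exists>z\<in>Vec (Y + X). x = outr Y X z"
    using Lin_Vec[OF Lin_inr] by (intro bexI[of _ "inr Y X x"]) simp_all
next
  fix y z assume y: "y \<in> Vec Y" and z: "z \<in> Vec (Y + X)" and yz: "inl Y X y = dbl z"
  have "outl Y X (inl Y X y) = dbl (outl Y X z)" "outr Y X (inl Y X y) = dbl (outr Y X z)"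
    unfolding yz by simp_all
  then have *: "y = dbl (outl Y X z)" "dbl (outr Y X z) = 0"
    using y by simp_all
  obtain x where "x \<in> Vec X" "outr Y X z = dbl x"
    using dbl_eq_0[OF Lin_Vec[OF Lin_outr] *(2)] by blast
  with *(1) show "\<exists>x\<in>Vec X. outr Y X z = dbl x \<and> 0 x = dbl y"
    by (intro bexI[of _ x]) simp_all
qed (simp_all add: Lin_zero Lin_biprod)

section \<open>Pivoting over Z/4\<close>

definition inverse_Lin :: "nat \<Rightarrow> (vec \<Rightarrow> vec) \<Rightarrow> (vec \<Rightarrow> vec) \<Rightarrow> bool" where
  "inverse_Lin n p p' \<longleftrightarrow> p \<in> Lin n n \<and> p' \<in> Lin n n \<and> (\<forall>x\<in>Vec n. p (p' x) = x) \<and> (\<forall>x\<in>Vec n. p' (p x) = x)"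

lemma inverse_LinD:
  assumes "inverse_Lin n p p'"
  shows "p \<in> Lin n n" "p' \<in> Lin n n" "\<And>x. x \<in> Vec n \<Longrightarrow> p (p' x) = x" "\<And>x. x \<in> Vec n \<Longrightarrow> p' (p x) = x"
  using assms unfolding inverse_Lin_def by blast+

text \<open>A vector with nonzero double has a unit coordinate, so it can replace a standard basis
  vector and become the first member of a basis.\<close>

lemma unimodular_basis:
  assumes y: "y \<in> Vec N" "dbl y \<noteq> 0"
  obtains M \<theta> \<theta>' where "N = Suc M" "inverse_Lin N \<theta> \<theta>'" "\<theta> (vcons 1 0) = y"
proof -
  obtain i where i: "y i + y i \<noteq> 0"
    using y(2) unfolding dbl_def by (metis ext plus_fun_apply zero_fun_apply)
  have "y i = 0" if "N \<le> i"
    using y(1) that unfolding Vec_def by blast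
  with i have iN: "i < N"
    by (cases "i < N") simp_all
  then obtain M where M: "N = Suc M"
    by (cases N) auto
  define c where "c = y i"
  have cc: "c * c = 1"
    unfolding c_def using z4_unit[OF i] .
  define \<tau> :: "vec \<Rightarrow> vec" where "\<tau> x = (\<lambda>j. if j = 0 then x i else if j = i then x 0 else x j)" for x
  have \<tau>: "\<tau> (\<tau> x) = x" "\<tau> (x + z) = \<tau> x + \<tau> z" "x \<in> Vec N \<Longrightarrow> \<tau> x \<in> Vec N" for x z
    using iN by (auto simp: \<tau>_def fun_eq_iff Vec_def)
  define r where "r = vtl (\<tau> y)"
  have "\<tau> y 0 = c"
    by (simp add: \<tau>_def c_def)
  then have r: "r \<in> Vec M" "vcons c r = \<tau> y"
    using \<tau>(3)[OF y(1)] vcons_simps(3)[of "\<tau> y"] by (simp_all add: r_def M)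
  \<comment> \<open>An elementary matrix with first column \<open>\<tau> y\<close>, followed by the
    swap \<tau> that puts the unit back in place \<open>i\<close>. A unit of Z/4 is its own inverse,
    so \<open>c\<close> also appears in the inverse map.\<close>
  define \<theta> where "\<theta> x = \<tau> (vcons (c * x 0) (vtl x + smul (x 0) r))" for x
  define \<theta>' where "\<theta>' x = vcons (c * \<tau> x 0) (vtl (\<tau> x) + smul (- c * \<tau> x 0) r)" for x
  have cancel: "smul a r + smul (- a) r = 0" for a
    by (simp flip: smul_simps(2))
  have cc': "c * (c * a) = a" for a
    using cc by (simp flip: mult.assoc)
  have inv: "\<theta> (\<theta>' x) = x" "\<theta>' (\<theta> x) = x" for x
  proof -
    have "vcons (c * \<theta>' x 0) (vtl (\<theta>' x) + smul (\<theta>' x 0) r) = \<tau> x"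
      using cancel[of "- c * \<tau> x 0"] by (intro vec_eqI[of _ "\<tau> x"]) (simp_all add: \<theta>'_def cc' add.assoc)
    then show "\<theta> (\<theta>' x) = x"
      by (simp add: \<theta>_def \<tau>)
    have "\<tau> (\<theta> x) = vcons (c * x 0) (vtl x + smul (x 0) r)"
      by (simp add: \<theta>_def \<tau>)
    then show "\<theta>' (\<theta> x) = x"
      using cancel[of "x 0"] by (intro vec_eqI[of _ x]) (simp_all add: \<theta>'_def cc' add.assoc)
  qed
  have add: "\<theta> (x + z) = \<theta> x + \<theta> z" for x z
  proof -
    have "vcons (c * (x + z) 0) (vtl (x + z) + smul ((x + z) 0) r) =
      vcons (c * x 0) (vtl x + smul (x 0) r) + vcons (c * z 0) (vtl z + smul (z 0) r)"
      by (rule vec_eqI) (simp_all add: algebra_simps)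
    then show ?thesis
      unfolding \<theta>_def by (simp only: \<tau>)
  qed
  have add': "\<theta>' (x + z) = \<theta>' x + \<theta>' z" for x z
    using inv(2)[of "\<theta>' x + \<theta>' z"] by (simp add: add inv(1))
  have Vec: "\<theta> x \<in> Vec N" "\<theta>' x \<in> Vec N" if "x \<in> Vec N" for x
    using that r(1) \<tau>(3) by (simp_all add: \<theta>_def \<theta>'_def M)
  have "\<theta> (vcons 1 0) = y"
    using r(2) by (simp add: \<theta>_def \<tau>)
  moreover have "vcons 1 0 \<in> Vec N"
    by (simp add: M)
  moreover have "inverse_Lin N (\<lambda>x. \<theta> (trunc N x)) (\<lambda>x. \<theta>' (trunc N x))"
    unfolding inverse_Lin_def using Lin_on_Vec[OF add Vec(1)] Lin_on_Vec[OF add' Vec(2)]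
    by (simp add: inv Vec)
  ultimately show thesis
    using that[OF M] by simp
qed

text \<open>One step of Gaussian elimination: bases starting with \<open>x\<close> and
  \<open>k x\<close> make the first column standard, and a column operation clears the first
  row.\<close>

lemma pivot:
  assumes k: "k \<in> Lin X Y" and x: "x \<in> Vec X" "dbl (k x) \<noteq> 0"
  obtains X' Y' l p p' q q' where "X = Suc X'" "Y = Suc Y'" "l \<in> Lin X' Y'"
    "inverse_Lin X p p'" "inverse_Lin Y q q'" "\<forall>x. k (p x) = q (vcons (x 0) (l (vtl x)))"
proof -
  have "dbl x \<noteq> 0"
    using x(2) Lin_dbl[OF k, of x] Lin_0[OF k] by auto
  then obtain X' \<theta> \<theta>' where X: "X = Suc X'" and \<theta>\<theta>': "inverse_Lin X \<theta> \<theta>'" and \<theta>1: "\<theta> (vcons 1 0) = x"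
    using unimodular_basis[OF x(1)] by metis
  obtain Y' q q' where Y: "Y = Suc Y'" and qq': "inverse_Lin Y q q'" and q1: "q (vcons 1 0) = k x"
    using unimodular_basis[OF Lin_Vec[OF k] x(2)] by metis
  note \<theta> = inverse_LinD[OF \<theta>\<theta>'] and q = inverse_LinD[OF qq']
  define f where "f = q' \<circ> k \<circ> \<theta>"
  have f: "f \<in> Lin X Y"
    unfolding f_def by (intro Lin_comp[OF \<theta>(1)] Lin_comp[OF k] q)
  have qf: "q (f x) = k (\<theta> x)" for x
    unfolding f_def by (simp add: q Lin_Vec[OF k])
  have f1: "f (vcons 1 0) = vcons 1 0"
    unfolding f_def using q(4)[of "vcons 1 0"] by (simp add: \<theta>1 q1[symmetric] Y)
  define \<phi> where "\<phi> t = f (vcons 0 t)" for t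
  have v0: "vcons 0 (s + t) = vcons 0 s + vcons 0 t" for s t
    by (simp flip: vcons_add)
  have \<phi>: "\<phi> (s + t) = \<phi> s + \<phi> t" "\<phi> (trunc X' t) = \<phi> t" "\<phi> t \<in> Vec (Suc Y')" for s t
  proof -
    have "vcons 0 (trunc X' t) = trunc X (vcons 0 t)"
      unfolding X by (rule vec_eqI) simp_all
    then show "\<phi> (trunc X' t) = \<phi> t"
      unfolding \<phi>_def by (simp add: Lin_trunc[OF f])
    show "\<phi> (s + t) = \<phi> s + \<phi> t"
      unfolding \<phi>_def v0 by (rule Lin_add[OF f])
    show "\<phi> t \<in> Vec (Suc Y')"
      unfolding \<phi>_def using Lin_Vec[OF f] Y by simp
  qed
  have f_eq: "f (vcons s t) = vcons (s + \<phi> t 0) (vtl (\<phi> t))" for s t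
  proof -
    have "vcons s t = smul s (vcons 1 0) + vcons 0 t"
      by (rule vec_eqI) simp_all
    then have eq: "f (vcons s t) = smul s (vcons 1 0) + \<phi> t"
      by (simp add: Lin_add[OF f] Lin_smul[OF f] f1 \<phi>_def)
    show ?thesis
      unfolding eq by (rule vec_eqI) simp_all
  qed
  \<comment> \<open>Subtracts the entries \<open>\<phi> (vtl x) 0\<close> of the first row.\<close>
  define \<sigma> where "\<sigma> x = vcons (x 0 - \<phi> (vtl x) 0) (trunc X' (vtl x))" for x
  define \<sigma>' where "\<sigma>' x = vcons (x 0 + \<phi> (vtl x) 0) (trunc X' (vtl x))" for x
  have \<sigma>: "\<sigma> \<in> Lin X X" "\<sigma>' \<in> Lin X X"
    unfolding X \<sigma>_def \<sigma>'_def by (rule LinI; (rule vec_eqI)?; simp add: \<phi> trunc_add)+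
  have \<sigma>_inv: "\<sigma> (\<sigma>' x) = x" "\<sigma>' (\<sigma> x) = x" if "x \<in> Vec X" for x
    using that by (simp_all add: \<sigma>_def \<sigma>'_def X)
  show thesis
  proof (rule that[OF X Y])
    show "(\<lambda>t. vtl (\<phi> t)) \<in> Lin X' Y'"
      by (rule LinI) (simp_all add: \<phi>)
    show "inverse_Lin X (\<theta> \<circ> \<sigma>) (\<sigma>' \<circ> \<theta>')"
      unfolding inverse_Lin_def using Lin_comp[OF \<sigma>(1) \<theta>(1)] Lin_comp[OF \<theta>(2) \<sigma>(2)]
      by (simp add: \<sigma>_inv \<theta> Lin_Vec[OF \<sigma>(1)] Lin_Vec[OF \<theta>(2)])
    show "\<forall>x. k ((\<theta> \<circ> \<sigma>) x) = q (vcons (x 0) (vtl (\<phi> (vtl x))))"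
    proof
      fix x
      show "k ((\<theta> \<circ> \<sigma>) x) = q (vcons (x 0) (vtl (\<phi> (vtl x))))"
        using qf[of "\<sigma> x"] by (simp add: \<sigma>_def f_eq \<phi>)
    qed
  qed (rule qq')
qed

lemma tri_transport:
  assumes T: "tri X Y Z u v w" and u': "u' \<in> Lin X Y"
    and pp: "inverse_Lin X p p'" and qq: "inverse_Lin Y q q'"
    and c: "\<And>x. u' (p x) = q (u x)"
  shows "tri X Y Z u' (v \<circ> q') (p \<circ> w)"
proof -
  note L = tri_Lin[OF T] and p = inverse_LinD[OF pp] and q = inverse_LinD[OF qq]
  show ?thesis
  proof (rule tri_iso[OF T u' _ _ p q])
    show "v \<circ> q' \<in> Lin Y Z" "p \<circ> w \<in> Lin Z X" "trunc Z \<in> Lin Z Z" "trunc Z \<in> Lin Z Z"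
      using Lin_comp[OF q(2) L(2)] Lin_comp[OF L(3) p(1)] Lin_trunc_id by blast+
    show "trunc Z (v y) = (v \<circ> q') (q y)" for y
      using q(4)[of "trunc Y y"] by (simp add: Lin_Vec[OF L(2)] Lin_trunc[OF q(1)] Lin_trunc[OF L(2)])
    show "p (w z) = (p \<circ> w) (trunc Z z)" for z
      by (simp add: Lin_trunc[OF L(3)])
  qed (simp_all add: c)
qed

text \<open>Halves exist pointwise but not canonically, and the extension result selects them
  linearly. It is used with nothing prescribed and with \<open>S\<close> as small as its hypotheses
  allow, the doubles of \<open>R\<close>.\<close>

lemma half_of_even:
  assumes u: "u \<in> Lin X Y" and even: "\<And>x. dbl (u x) = 0"
  shows "\<exists>k\<in>Lin X Y. \<forall>x. u x = dbl (k x)"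
proof -
  define R where "R = {(x, t). x \<in> Vec X \<and> t \<in> Vec Y \<and> dbl t = u x}"
  define S where "S = dbl ` R"
  have R: "addsub R"
    unfolding addsub_def R_def by (auto simp: zero_prod_def Lin_simps[OF u] dbl_add dbl_uminus simp del: uminus_dbl)
  have S1: "addsub S"
    unfolding addsub_def S_def
  proof (intro conjI ballI)
    show "0 \<in> dbl ` R"
      using addsub_0[OF R] by (intro image_eqI[of _ _ 0]) simp_all
    show "p + q \<in> dbl ` R" if "p \<in> dbl ` R" "q \<in> dbl ` R" for p q
      using that addsub_add[OF R] by (metis (no_types, lifting) dbl_add image_iff)
    show "- p \<in> dbl ` R" if "p \<in> dbl ` R" for p
      using that addsub_uminus[OF R] by (metis (no_types, lifting) dbl_uminus image_iff)
  qed
  have S: "S \<subseteq> R"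
    unfolding S_def R_def using even by (auto simp: Lin_dbl[OF u] Lin_Vec[OF u])
  have dom: "x \<in> Domain R" if x: "x \<in> Vec X" for x
  proof -
    obtain t where "t \<in> Vec Y" "u x = dbl t"
      using dbl_eq_0[OF Lin_Vec[OF u] even] by blast
    then show ?thesis
      using x unfolding R_def by auto
  qed
  have SG: "dbl p \<in> {0}" if "p \<in> S" for p
    using that unfolding S_def by (cases p) (auto simp: zero_prod_def)
  have adm: "admissible X R S {0}"
    unfolding admissible_def
  proof (intro conjI ballI allI impI)
    show "\<exists>z'. (z, z') \<in> R \<and> dbl z' = d" if z: "z \<in> Vec X" "(dbl z, d) \<in> {0}" for z d
    proof -
      \<comment> \<open>A vector killed by 2 is even, so \<open>u\<close> sends it to 0 and the half
        can be 0.\<close>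
      obtain t where "z = dbl t"
        using dbl_eq_0[OF z(1)] z(2) by (auto simp: zero_prod_def)
      then have "u z = 0"
        using even by (simp add: Lin_dbl[OF u])
      then show ?thesis
        using z unfolding R_def by (intro exI[of _ 0]) (simp add: zero_prod_def)
    qed
    show "(a, b) \<in> S" if "(a, b) \<in> {0}" for a b
      using that addsub_0[OF S1] by simp
  qed (use addsub_0[OF R] in \<open>auto simp: addsub_def zero_prod_def\<close>)
  have RV: "R \<subseteq> Vec X \<times> Vec Y"
    unfolding R_def by auto
  have RS: "dbl p \<in> S" if "p \<in> R" for p
    using that unfolding S_def by blast
  obtain k where k: "k \<in> Lin X Y" "\<And>x. x \<in> Vec X \<Longrightarrow> (x, k x) \<in> R"
    using extend_linear[OF R RV dom S1 S RS SG adm] by blast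
  have "u x = dbl (k x)" for x
    using k(2)[of "trunc X x"] by (simp add: R_def Lin_trunc[OF u] Lin_trunc[OF k(1)])
  then show ?thesis
    using k(1) by blast
qed

text \<open>Diagonalization: a unit entry of \<open>u\<close> splits off a contractible triangle;
  when all entries are even, a unit entry of \<open>u/2\<close> splits off a copy of T; otherwise
  \<open>u\<close> is zero.\<close>

lemma tri_exists: "u \<in> Lin X Y \<Longrightarrow> \<exists>Z v w. tri X Y Z u v w"
proof (induction X arbitrary: Y u rule: less_induct)
  case (less X)
  note u = less.prems
  show ?case
  proof (cases "\<exists>x\<in>Vec X. dbl (u x) \<noteq> 0")
    case True
    then obtain x where x: "x \<in> Vec X" "dbl (u x) \<noteq> 0"
      by blast
    obtain X' Y' l p p' q q' where X: "X = Suc X'" "Y = Suc Y'" and l: "l \<in> Lin X' Y'"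
      and pq: "inverse_Lin X p p'" "inverse_Lin Y q q'" and c: "\<And>x. u (p x) = q (vcons (x 0) (l (vtl x)))"
      using pivot[OF u x] by metis
    obtain Z v w where "tri X' Y' Z l v w"
      using less.IH[OF _ l] X by auto
    from tri_transport[OF tri_plus_contractible[OF this, folded X] u pq c] show ?thesis
      by blast
  next
    case False
    have even: "dbl (u x) = 0" for x
      using False Lin_trunc[OF u, of x] trunc_in_Vec by metis
    obtain k where k: "k \<in> Lin X Y" "\<And>x. u x = dbl (k x)"
      using half_of_even[OF u even] by blast
    show ?thesis
    proof (cases "\<exists>x\<in>Vec X. dbl (k x) \<noteq> 0")
      case True
      then obtain x where x: "x \<in> Vec X" "dbl (k x) \<noteq> 0"
        by blast
      obtain X' Y' l p p' q q' where X: "X = Suc X'" "Y = Suc Y'" and l: "l \<in> Lin X' Y'"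
        and pq: "inverse_Lin X p p'" "inverse_Lin Y q q'" and c: "\<And>x. k (p x) = q (vcons (x 0) (l (vtl x)))"
        using pivot[OF k(1) x] by metis
      have "(\<lambda>x. dbl (l x)) \<in> Lin X' Y'"
        by (rule LinI) (simp_all add: Lin_simps[OF l] Lin_trunc[OF l] Lin_Vec[OF l] dbl_add)
      then obtain Z v w where T: "tri X' Y' Z (\<lambda>x. dbl (l x)) v w"
        using less.IH X by (metis lessI)
      have "dbl (vcons a t) = vcons (dbl a) (dbl t)" for a t
        by (rule vec_eqI) simp_all
      then have "u (p x) = q (vcons (dbl (x 0)) (dbl (l (vtl x))))" for x
        by (simp add: k(2) c flip: Lin_dbl[OF inverse_LinD(1)[OF pq(2)]])
      from tri_transport[OF tri_plus_double[OF T, folded X] u pq this] show ?thesis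
        by blast
    next
      case False
      \<comment> \<open>Now both \<open>u\<close> and its half \<open>k\<close> are even, so
        \<open>u\<close> is divisible by 4.\<close>
      have "u x = 0" for x
        using False k(2) Lin_trunc[OF k(1), of x] trunc_in_Vec by metis
      then have "u = 0"
        by (simp add: fun_eq_iff)
      then show ?thesis
        using tri_of_zero by blast
    qed
  qed
qed

section \<open>The triangulated category of finitely generated free modules\<close>

text \<open>The ranks are recorded because the function does not determine them: the zero function
  lies in every \<open>Lin n m\<close>.\<close>

definition Mor :: "(nat \<times> nat \<times> (vec \<Rightarrow> vec)) set" where
  "Mor = {(n, m, f). f \<in> Lin n m}"

lemma countable_Mor: "countable Mor"
proof -
  have eq: "Mor = (\<Union>n. \<Union>m. (\<lambda>f. (n, m, f)) ` Lin n m)"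
    unfolding Mor_def by auto
  show ?thesis
    unfolding eq by (intro countable_UN countable_image countable_finite finite_Lin countableI_type)
qed

definition arr :: "nat \<Rightarrow> nat \<Rightarrow> (vec \<Rightarrow> vec) \<Rightarrow> nat" where
  "arr n m f = to_nat_on Mor (n, m, f)"

definition src :: "nat \<Rightarrow> nat" where
  "src a = fst (from_nat_into Mor a)"

definition tgt :: "nat \<Rightarrow> nat" where
  "tgt a = fst (snd (from_nat_into Mor a))"

definition lin :: "nat \<Rightarrow> vec \<Rightarrow> vec" where
  "lin a = snd (snd (from_nat_into Mor a))"

lemma arr_simps:
  assumes "f \<in> Lin n m"
  shows "src (arr n m f) = n" "tgt (arr n m f) = m" "lin (arr n m f) = f"
  using assms from_nat_into_to_nat_on[OF countable_Mor, of "(n, m, f)"]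
  by (simp_all add: src_def tgt_def lin_def arr_def Mor_def)

definition FreeZ4 :: countable_tricat where
  "FreeZ4 = \<lparr>Ob = UNIV, Arr = to_nat_on Mor ` Mor, Dom = src, Cod = tgt,
     Id = (\<lambda>n. arr n n (trunc n)),
     Comp = (\<lambda>g f. arr (src f) (tgt g) (lin g \<circ> lin f)),
     Add = (\<lambda>f g. arr (src f) (tgt f) (lin f + lin g)),
     Zero = (\<lambda>n m. arr n m 0),
     ShO = (\<lambda>n. n), Sh = (\<lambda>f. f),
     Tri = {(u, v, w). u \<in> to_nat_on Mor ` Mor \<and> v \<in> to_nat_on Mor ` Mor \<and> w \<in> to_nat_on Mor ` Mor \<and>
       tgt u = src v \<and> tgt v = src w \<and> tgt w = src u \<and>
       tri (src u) (src v) (src w) (lin u) (lin v) (lin w)}\<rparr>"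

lemma FreeZ4_simps [simp]:
  "Ob FreeZ4 = UNIV" "Dom FreeZ4 = src" "Cod FreeZ4 = tgt" "ShO FreeZ4 n = n" "Sh FreeZ4 a = a"
  by (simp_all add: FreeZ4_def)

abbreviation HomF :: "nat \<Rightarrow> nat \<Rightarrow> nat set" where
  "HomF \<equiv> Hom FreeZ4"

section \<open>Coded arrows and their linear maps\<close>

lemma HomD:
  assumes "a \<in> HomF n m"
  shows "src a = n" "tgt a = m" "lin a \<in> Lin n m" "arr n m (lin a) = a"
proof -
  obtain k l f where f: "f \<in> Lin k l" "a = arr k l f"
    using assms unfolding Hom_def FreeZ4_def Mor_def arr_def by auto
  moreover have "src a = n" "tgt a = m"
    using assms unfolding Hom_def by simp_all
  ultimately show "src a = n" "tgt a = m" "lin a \<in> Lin n m" "arr n m (lin a) = a"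
    using arr_simps[OF f(1)] by auto
qed

lemma arr_Hom: "f \<in> Lin n m \<Longrightarrow> arr n m f \<in> HomF n m"
  using arr_simps unfolding Hom_def by (simp add: FreeZ4_def arr_def Mor_def)

lemma Arr_Hom: "a \<in> Arr FreeZ4 \<Longrightarrow> a \<in> HomF (src a) (tgt a)"
  by (simp add: Hom_def)

lemma Hom_eqI: "a \<in> HomF n m \<Longrightarrow> b \<in> HomF n m \<Longrightarrow> (\<And>x. lin a x = lin b x) \<Longrightarrow> a = b"
  by (metis HomD(4) ext)

lemma Id_Hom: "Id FreeZ4 n \<in> HomF n n"
  and lin_Id: "lin (Id FreeZ4 n) = trunc n"
  using arr_Hom[OF Lin_trunc_id] arr_simps[OF Lin_trunc_id] by (simp_all add: FreeZ4_def)

lemma Zero_Hom: "Zero FreeZ4 n m \<in> HomF n m"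
  and lin_Zero: "lin (Zero FreeZ4 n m) = 0"
  using arr_Hom[OF Lin_zero] arr_simps[OF Lin_zero] by (simp_all add: FreeZ4_def)

lemma Comp_Hom:
  assumes "f \<in> HomF X Y" "g \<in> HomF Y Z"
  shows "g \<cdot>\<^bsub>FreeZ4\<^esub> f \<in> HomF X Z" "lin (g \<cdot>\<^bsub>FreeZ4\<^esub> f) x = lin g (lin f x)"
  using arr_Hom[OF Lin_comp] arr_simps(3)[OF Lin_comp] HomD[OF assms(1)] HomD[OF assms(2)]
  by (simp_all add: FreeZ4_def)

lemma Add_Hom:
  assumes "f \<in> HomF X Y" "g \<in> HomF X Y"
  shows "f \<boxplus>\<^bsub>FreeZ4\<^esub> g \<in> HomF X Y" "lin (f \<boxplus>\<^bsub>FreeZ4\<^esub> g) x = lin f x + lin g x"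
  using arr_Hom[OF Lin_plus] arr_simps(3)[OF Lin_plus] HomD[OF assms(1)] HomD[OF assms(2)]
  by (simp_all add: FreeZ4_def)

lemma arr_neg_Hom:
  assumes "f \<in> HomF X Y"
  shows "arr X Y (- lin f) \<in> HomF X Y" "lin (arr X Y (- lin f)) x = - lin f x"
  using arr_Hom[OF Lin_neg] arr_simps(3)[OF Lin_neg] HomD[OF assms] by simp_all

lemma hom_group_comm_group: "comm_group (hom_group FreeZ4 X Y)"
proof (rule comm_groupI; simp add: hom_group_def)
  show "f \<boxplus>\<^bsub>FreeZ4\<^esub> g \<in> HomF X Y" if "f \<in> HomF X Y" "g \<in> HomF X Y" for f g
    using Add_Hom(1)[OF that] .
  show "Zero FreeZ4 X Y \<in> HomF X Y"
    by (rule Zero_Hom)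
  show "f \<boxplus>\<^bsub>FreeZ4\<^esub> g \<boxplus>\<^bsub>FreeZ4\<^esub> h = f \<boxplus>\<^bsub>FreeZ4\<^esub> (g \<boxplus>\<^bsub>FreeZ4\<^esub> h)"
    if "f \<in> HomF X Y" "g \<in> HomF X Y" "h \<in> HomF X Y" for f g h
    by (rule Hom_eqI[of _ X Y]) (simp_all add: Add_Hom[of _ X Y] that add.assoc)
  show "f \<boxplus>\<^bsub>FreeZ4\<^esub> g = g \<boxplus>\<^bsub>FreeZ4\<^esub> f" if "f \<in> HomF X Y" "g \<in> HomF X Y" for f g
    by (rule Hom_eqI[of _ X Y]) (simp_all add: Add_Hom[of _ X Y] that add.commute)
  show "Zero FreeZ4 X Y \<boxplus>\<^bsub>FreeZ4\<^esub> f = f" if "f \<in> HomF X Y" for f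
    by (rule Hom_eqI[of _ X Y]) (simp_all add: Add_Hom[of _ X Y] that Zero_Hom lin_Zero)
  show "\<exists>g\<in>HomF X Y. g \<boxplus>\<^bsub>FreeZ4\<^esub> f = Zero FreeZ4 X Y" if f: "f \<in> HomF X Y" for f
  proof (rule bexI[OF _ arr_neg_Hom(1)[OF f]])
    show "arr X Y (- lin f) \<boxplus>\<^bsub>FreeZ4\<^esub> f = Zero FreeZ4 X Y"
      by (rule Hom_eqI[of _ X Y]) (simp_all add: Add_Hom[of _ X Y] f arr_neg_Hom[OF f] Zero_Hom lin_Zero)
  qed
qed

lemma neg_Hom:
  assumes f: "f \<in> HomF X Y"
  shows "neg FreeZ4 f \<in> HomF X Y" "lin (neg FreeZ4 f) x = - lin f x"
proof -
  interpret comm_group "hom_group FreeZ4 X Y"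
    by (rule hom_group_comm_group)
  have "arr X Y (- lin f) \<boxplus>\<^bsub>FreeZ4\<^esub> f = Zero FreeZ4 X Y"
    by (rule Hom_eqI[of _ X Y]) (simp_all add: Add_Hom[of _ X Y] f arr_neg_Hom[OF f] Zero_Hom lin_Zero)
  then have "inv\<^bsub>hom_group FreeZ4 X Y\<^esub> f = arr X Y (- lin f)"
    by (intro inv_equality) (simp_all add: hom_group_def f arr_neg_Hom)
  then have "neg FreeZ4 f = arr X Y (- lin f)"
    unfolding neg_def using HomD[OF f] by simp
  then show "neg FreeZ4 f \<in> HomF X Y" "lin (neg FreeZ4 f) x = - lin f x"
    using arr_neg_Hom[OF f] by simp_all
qed

lemma Comp_eq_Comp_iff:
  assumes "f \<in> HomF X Y" "g \<in> HomF Y Z" "f' \<in> HomF X Y'" "g' \<in> HomF Y' Z"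
  shows "g \<cdot>\<^bsub>FreeZ4\<^esub> f = g' \<cdot>\<^bsub>FreeZ4\<^esub> f' \<longleftrightarrow> (\<forall>x. lin g (lin f x) = lin g' (lin f' x))"
  using Comp_Hom[OF assms(1,2)] Comp_Hom[OF assms(3,4)] Hom_eqI by metis

lemma Comp_eq_iff:
  assumes "f \<in> HomF X Y" "g \<in> HomF Y Z" "h \<in> HomF X Z"
  shows "g \<cdot>\<^bsub>FreeZ4\<^esub> f = h \<longleftrightarrow> (\<forall>x. lin g (lin f x) = lin h x)"
  using Comp_Hom[OF assms(1,2)] assms(3) Hom_eqI by metis

lemma TriI:
  assumes "u \<in> HomF X Y" "v \<in> HomF Y Z" "w \<in> HomF Z X" "tri X Y Z (lin u) (lin v) (lin w)"
  shows "(u, v, w) \<in> Tri FreeZ4"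
  using assms HomD(1,2)[OF assms(1)] HomD(1,2)[OF assms(2)] HomD(1,2)[OF assms(3)]
  unfolding Hom_def FreeZ4_def by simp

lemma TriE:
  assumes "(u, v, w) \<in> Tri FreeZ4"
  obtains X Y Z where "u \<in> HomF X Y" "v \<in> HomF Y Z" "w \<in> HomF Z X" "tri X Y Z (lin u) (lin v) (lin w)"
proof (rule that[of "src u" "src v" "src w"])
  show "u \<in> HomF (src u) (src v)" "v \<in> HomF (src v) (src w)" "w \<in> HomF (src w) (src u)"
    using assms unfolding Hom_def FreeZ4_def by simp_all
  show "tri (src u) (src v) (src w) (lin u) (lin v) (lin w)"
    using assms unfolding FreeZ4_def by simp
qed

lemma Tri_exists:
  assumes u: "u \<in> HomF X Y"
  obtains Z v w where "v \<in> HomF Y Z" "w \<in> HomF Z X" "tri X Y Z (lin u) (lin v) (lin w)"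
proof -
  obtain Z v w where T: "tri X Y Z (lin u) v w"
    using tri_exists[OF HomD(3)[OF u]] by blast
  note L = tri_Lin[OF T]
  show thesis
    using that[OF arr_Hom[OF L(2)] arr_Hom[OF L(3)]] T by (simp add: arr_simps L)
qed

lemma is_isoE:
  assumes "is_iso FreeZ4 X Y f"
  obtains g where "f \<in> HomF X Y" "g \<in> HomF Y X" "\<And>x. x \<in> Vec Y \<Longrightarrow> lin f (lin g x) = x"
    "\<And>x. x \<in> Vec X \<Longrightarrow> lin g (lin f x) = x"
proof -
  obtain g where fg: "f \<in> HomF X Y" "g \<in> HomF Y X" "g \<cdot>\<^bsub>FreeZ4\<^esub> f = Id FreeZ4 X" "f \<cdot>\<^bsub>FreeZ4\<^esub> g = Id FreeZ4 Y"
    using assms unfolding is_iso_def by blast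
  show thesis
    using that[OF fg(1,2)] fg(3,4)
    by (simp add: Comp_eq_iff[OF fg(1,2) Id_Hom] Comp_eq_iff[OF fg(2,1) Id_Hom] lin_Id)
qed

section \<open>Verification of the axioms\<close>

lemma additive_FreeZ4: "additive_category FreeZ4"
proof (intro additive_category.intro category.intro additive_category_axioms.intro)
  show "Dom FreeZ4 f \<in> Ob FreeZ4" "Cod FreeZ4 f \<in> Ob FreeZ4" for f
    by simp_all
  show "Id FreeZ4 X \<in> HomF X X" for X
    by (rule Id_Hom)
  show "g \<cdot>\<^bsub>FreeZ4\<^esub> f \<in> HomF X Z" if "f \<in> HomF X Y" "g \<in> HomF Y Z" for f g X Y Z
    using Comp_Hom(1)[OF that] .
  show "f \<cdot>\<^bsub>FreeZ4\<^esub> Id FreeZ4 X = f" if f: "f \<in> HomF X Y" for f X Y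
    using Lin_trunc[OF HomD(3)[OF f]] by (simp add: Comp_eq_iff[OF Id_Hom f f] lin_Id)
  show "Id FreeZ4 Y \<cdot>\<^bsub>FreeZ4\<^esub> f = f" if f: "f \<in> HomF X Y" for f X Y
    using Lin_Vec[OF HomD(3)[OF f]] by (simp add: Comp_eq_iff[OF f Id_Hom f] lin_Id)
  show "h \<cdot>\<^bsub>FreeZ4\<^esub> g \<cdot>\<^bsub>FreeZ4\<^esub> f = h \<cdot>\<^bsub>FreeZ4\<^esub> (g \<cdot>\<^bsub>FreeZ4\<^esub> f)"
    if f: "f \<in> HomF W X" and g: "g \<in> HomF X Y" and h: "h \<in> HomF Y Z" for f g h W X Y Z
    using Comp_Hom[OF f g] Comp_Hom[OF g h]
    by (simp add: Comp_eq_Comp_iff[OF f Comp_Hom(1)[OF g h] Comp_Hom(1)[OF f g] h])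
  show "comm_group (hom_group FreeZ4 X Y)" for X Y
    by (rule hom_group_comm_group)
  show "(g \<boxplus>\<^bsub>FreeZ4\<^esub> g') \<cdot>\<^bsub>FreeZ4\<^esub> f = (g \<cdot>\<^bsub>FreeZ4\<^esub> f) \<boxplus>\<^bsub>FreeZ4\<^esub> (g' \<cdot>\<^bsub>FreeZ4\<^esub> f)"
    if f: "f \<in> HomF X Y" and g: "g \<in> HomF Y Z" and g': "g' \<in> HomF Y Z" for f g g' X Y Z
    using Comp_Hom[OF f g] Comp_Hom[OF f g'] Add_Hom[OF g g']
    by (simp add: Comp_eq_iff[OF f Add_Hom(1)[OF g g'] Add_Hom(1)[OF Comp_Hom(1)[OF f g] Comp_Hom(1)[OF f g']]]
        Add_Hom[of _ X Z])
  show "g \<cdot>\<^bsub>FreeZ4\<^esub> (f \<boxplus>\<^bsub>FreeZ4\<^esub> f') = (g \<cdot>\<^bsub>FreeZ4\<^esub> f) \<boxplus>\<^bsub>FreeZ4\<^esub> (g \<cdot>\<^bsub>FreeZ4\<^esub> f')"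
    if f: "f \<in> HomF X Y" and f': "f' \<in> HomF X Y" and g: "g \<in> HomF Y Z" for f f' g X Y Z
    using Comp_Hom[OF f g] Comp_Hom[OF f' g] Add_Hom[OF f f']
    by (simp add: Comp_eq_iff[OF Add_Hom(1)[OF f f'] g Add_Hom(1)[OF Comp_Hom(1)[OF f g] Comp_Hom(1)[OF f' g]]]
        Add_Hom[of _ X Z] Lin_add[OF HomD(3)[OF g]])
  have to_0: "lin f x = 0" if "f \<in> HomF X 0" for f X x
    using Lin_Vec[OF HomD(3)[OF that]] by simp
  have from_0: "lin f x = 0" if "f \<in> HomF 0 X" for f X x
    using Lin_trunc[OF HomD(3)[OF that], of x] Lin_0[OF HomD(3)[OF that]] trunc_in_Vec[of 0 x] by simp
  have "zero_object FreeZ4 0"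
    unfolding zero_object_def
  proof (intro conjI ballI)
    show "\<exists>!f. f \<in> HomF X 0" for X
      using Zero_Hom Hom_eqI to_0 by (metis (no_types, lifting))
    show "\<exists>!f. f \<in> HomF 0 X" for X
      using Zero_Hom Hom_eqI from_0 by (metis (no_types, lifting))
  qed simp
  then show "\<exists>Z. zero_object FreeZ4 Z" ..
  show "\<exists>B. biproduct FreeZ4 X Y B" for X Y
  proof (intro exI)
    let ?S = "X + Y"
    note i = arr_Hom[OF Lin_inl[of X Y]] and j = arr_Hom[OF Lin_inr[of X Y]]
      and p = arr_Hom[OF Lin_outl[of X Y]] and q = arr_Hom[OF Lin_outr[of X Y]]
    note l = arr_simps[OF Lin_inl] arr_simps[OF Lin_inr] arr_simps[OF Lin_outl] arr_simps[OF Lin_outr]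
    have tr: "inl X Y (trunc X x) = inl X Y x" "inr X Y (trunc Y y) = inr X Y y"
      "outl X Y (trunc ?S s) = outl X Y s" "outr X Y (trunc ?S s) = outr X Y s" for x y s
      using Lin_trunc[OF Lin_inl] Lin_trunc[OF Lin_inr] Lin_trunc[OF Lin_outl] Lin_trunc[OF Lin_outr] by auto
    have "outl X Y (inl X Y x) = trunc X x" "outr X Y (inr X Y y) = trunc Y y" for x y
      using out_in(1)[of "trunc X x" X Y] out_in(2)[of "trunc Y y" Y X] by (simp_all add: tr)
    moreover have "inl X Y (outl X Y s) + inr X Y (outr X Y s) = trunc ?S s" for s
      using in_out[of "trunc ?S s" X Y] by (simp add: tr)
    ultimately show "biproduct FreeZ4 X Y
      (?S, arr X ?S (inl X Y), arr Y ?S (inr X Y), arr ?S X (outl X Y), arr ?S Y (outr X Y))"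
      using i j p q Comp_Hom[OF p i] Comp_Hom[OF q j]
      by (simp add: Comp_eq_iff[OF i p Id_Hom] Comp_eq_iff[OF j q Id_Hom] Comp_eq_iff[OF j p Zero_Hom]
          Comp_eq_iff[OF i q Zero_Hom] l lin_Id lin_Zero)
        (rule Hom_eqI[OF Add_Hom(1)[OF Comp_Hom(1)[OF p i] Comp_Hom(1)[OF q j]] Id_Hom],
          simp add: Add_Hom[OF Comp_Hom(1)[OF p i] Comp_Hom(1)[OF q j]] l lin_Id)
  qed
qed

lemma Sh_FreeZ4: "Sh FreeZ4 = (\<lambda>f. f)" "ShO FreeZ4 = (\<lambda>n. n)"
  by (simp_all add: FreeZ4_def)

lemma candidate_FreeZ4:
  assumes "candidate FreeZ4 (u, v, w)"
  shows "u \<in> HomF (src u) (src v)" "v \<in> HomF (src v) (src w)" "w \<in> HomF (src w) (src u)"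
  using assms by (auto simp: HomD)

lemma triangulated_FreeZ4: "triangulated_category FreeZ4"
proof (intro triangulated_category.intro triangulated_category_axioms.intro additive_FreeZ4)
  have id: "natural_iso FreeZ4 (\<lambda>n. n) (\<lambda>f. f) (\<lambda>n. n) (\<lambda>f. f) (Id FreeZ4)"
    using additive_category.axioms(1)[OF additive_FreeZ4] Id_Hom
    unfolding natural_iso_def is_iso_def by (metis category.comp_id category.id_comp)
  have endo: "endofunctor FreeZ4 (\<lambda>n. n) (\<lambda>f. f)"
    unfolding endofunctor_def by simp
  then show "self_equivalence FreeZ4 (ShO FreeZ4) (Sh FreeZ4)"
    unfolding self_equivalence_def Sh_FreeZ4
    using id by (intro conjI exI[of _ "\<lambda>n. n"] exI[of _ "\<lambda>f. f"] exI[of _ "Id FreeZ4"]) (simp_all add: comp_def id_def)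
next
  fix T assume "T \<in> Tri FreeZ4"
  then show "candidate FreeZ4 T"
    by (cases T) (auto elim!: TriE)
next
  fix T T' \<phi> assume T: "T \<in> Tri FreeZ4" and iso: "candidate_iso FreeZ4 T T' \<phi>"
  obtain u v w u' v' w' f g h where eq: "T = (u, v, w)" "T' = (u', v', w')" "\<phi> = (f, g, h)"
    by (metis surj_pair)
  obtain X Y Z where uvw: "u \<in> HomF X Y" "v \<in> HomF Y Z" "w \<in> HomF Z X" and t: "tri X Y Z (lin u) (lin v) (lin w)"
    using T unfolding eq by (rule TriE)
  have "candidate FreeZ4 (u', v', w')"
    using iso unfolding eq by simp
  note uvw' = candidate_FreeZ4[OF this]
  let ?X' = "src u'" and ?Y' = "src v'" and ?Z' = "src w'"
  have isos: "is_iso FreeZ4 X ?X' f" "is_iso FreeZ4 Y ?Y' g" "is_iso FreeZ4 Z ?Z' h"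
    and comm: "g \<cdot>\<^bsub>FreeZ4\<^esub> u = u' \<cdot>\<^bsub>FreeZ4\<^esub> f" "h \<cdot>\<^bsub>FreeZ4\<^esub> v = v' \<cdot>\<^bsub>FreeZ4\<^esub> g" "f \<cdot>\<^bsub>FreeZ4\<^esub> w = w' \<cdot>\<^bsub>FreeZ4\<^esub> h"
    using iso HomD[OF uvw(1)] HomD[OF uvw(2)] HomD[OF uvw(3)] unfolding eq by simp_all
  obtain f' where f: "f \<in> HomF X ?X'" "f' \<in> HomF ?X' X" "\<And>x. x \<in> Vec ?X' \<Longrightarrow> lin f (lin f' x) = x"
    "\<And>x. x \<in> Vec X \<Longrightarrow> lin f' (lin f x) = x"
    using is_isoE[OF isos(1)] by metis
  obtain g' where g: "g \<in> HomF Y ?Y'" "g' \<in> HomF ?Y' Y" "\<And>x. x \<in> Vec ?Y' \<Longrightarrow> lin g (lin g' x) = x"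
    "\<And>x. x \<in> Vec Y \<Longrightarrow> lin g' (lin g x) = x"
    using is_isoE[OF isos(2)] by metis
  obtain h' where h: "h \<in> HomF Z ?Z'" "h' \<in> HomF ?Z' Z" "\<And>x. x \<in> Vec ?Z' \<Longrightarrow> lin h (lin h' x) = x"
    "\<And>x. x \<in> Vec Z \<Longrightarrow> lin h' (lin h x) = x"
    using is_isoE[OF isos(3)] by metis
  have "tri ?X' ?Y' ?Z' (lin u') (lin v') (lin w')"
  proof (rule tri_iso[OF t])
    show "lin g (lin u x) = lin u' (lin f x)" "lin h (lin v x) = lin v' (lin g x)" "lin f (lin w x) = lin w' (lin h x)" for x
      using comm by (simp_all add: Comp_eq_Comp_iff[OF uvw(1) g(1) f(1) uvw'(1)]
          Comp_eq_Comp_iff[OF uvw(2) h(1) g(1) uvw'(2)] Comp_eq_Comp_iff[OF uvw(3) f(1) h(1) uvw'(3)])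
  qed (fact HomD(3)[OF uvw'(1)] HomD(3)[OF uvw'(2)] HomD(3)[OF uvw'(3)] f g h HomD(3)[OF f(1)]
      HomD(3)[OF f(2)] HomD(3)[OF g(1)] HomD(3)[OF g(2)] HomD(3)[OF h(1)] HomD(3)[OF h(2)])+
  then show "T' \<in> Tri FreeZ4"
    unfolding eq using uvw' TriI by blast
next
  fix X Z assume Z: "zero_object FreeZ4 Z"
  \<comment> \<open>The axiom concerns an arbitrary zero object; all that is used of it is that its
    module is trivial.\<close>
  have "Id FreeZ4 Z = Zero FreeZ4 Z Z"
    using Z Id_Hom Zero_Hom unfolding zero_object_def by (metis (no_types, lifting))
  then have "trunc Z = 0"
    using lin_Id lin_Zero by metis
  then have Z0: "z = 0" if "z \<in> Vec Z" for z
    using trunc_eq[OF that] by simp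
  have "tri X X Z (trunc X) 0 0"
  proof (rule triI)
    fix y z assume "y \<in> Vec X" "0 y = dbl z"
    then show "\<exists>x\<in>Vec X. 0 z = dbl x \<and> trunc X x = dbl y"
      by (intro bexI[of _ "dbl y"]) simp_all
  next
    show "\<exists>y\<in>Vec X. z = 0 y" if "z \<in> Vec Z" for z
      using Z0[OF that] by auto
  next
    show "\<exists>x\<in>Vec X. y = trunc X x" if "y \<in> Vec X" for y
      using trunc_eq[OF that] that by metis
  next
    show "\<exists>z\<in>Vec Z. x = 0 z" if "x \<in> Vec X" "trunc X x = 0" for x
      using that by auto
  qed (simp_all add: Lin_zero Lin_trunc_id)
  then show "(Id FreeZ4 X, Zero FreeZ4 X Z, Zero FreeZ4 Z (ShO FreeZ4 X)) \<in> Tri FreeZ4"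
    by (intro TriI[of _ X X _ Z]) (simp_all add: Id_Hom Zero_Hom lin_Id lin_Zero)
next
  fix u assume "u \<in> Arr FreeZ4"
  then obtain Z v w where "v \<in> HomF (tgt u) Z" "w \<in> HomF Z (src u)" "tri (src u) (tgt u) Z (lin u) (lin v) (lin w)"
    using Tri_exists[OF Arr_Hom] by blast
  then show "\<exists>v w. (u, v, w) \<in> Tri FreeZ4"
    using TriI[OF Arr_Hom[OF \<open>u \<in> Arr FreeZ4\<close>]] by blast
next
  fix u v w assume "candidate FreeZ4 (u, v, w)"
  note uvw = candidate_FreeZ4[OF this]
  let ?X = "src u" and ?Y = "src v" and ?Z = "src w"
  have n: "neg FreeZ4 u \<in> HomF ?X ?Y" "lin (neg FreeZ4 u) = - lin u"
    using neg_Hom[OF uvw(1)] by auto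
  have "(u, v, w) \<in> Tri FreeZ4 \<longleftrightarrow> tri ?X ?Y ?Z (lin u) (lin v) (lin w)"
    using uvw TriI[OF uvw] HomD(1,2)[OF uvw(1)] HomD(1,2)[OF uvw(2)] HomD(1,2)[OF uvw(3)] by (metis TriE HomD(1))
  also have "\<dots> \<longleftrightarrow> tri ?Y ?Z ?X (lin v) (lin w) (- lin u)"
  proof
    show "tri ?Y ?Z ?X (lin v) (lin w) (- lin u)" if "tri ?X ?Y ?Z (lin u) (lin v) (lin w)"
      using tri_neg[OF tri_rotate[OF that]] .
    \<comment> \<open>After the sign is undone, two further rotations complete the period of
      three.\<close>
    show "tri ?X ?Y ?Z (lin u) (lin v) (lin w)" if "tri ?Y ?Z ?X (lin v) (lin w) (- lin u)"
      using tri_rotate[OF tri_rotate[OF tri_neg[OF that]]] by simp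
  qed
  also have "\<dots> \<longleftrightarrow> (v, w, neg FreeZ4 u) \<in> Tri FreeZ4"
    using TriI[OF uvw(2,3) n(1)] HomD(1)[OF n(1)] n(2) by (metis TriE HomD(1))
  finally show "(u, v, w) \<in> Tri FreeZ4 \<longleftrightarrow> (v, w, neg FreeZ4 (Sh FreeZ4 u)) \<in> Tri FreeZ4"
    by simp
next
  fix u v w u' v' w' f g
  assume T: "(u, v, w) \<in> Tri FreeZ4" and T': "(u', v', w') \<in> Tri FreeZ4"
    and f: "f \<in> HomF (Dom FreeZ4 u) (Dom FreeZ4 u')" and g: "g \<in> HomF (Cod FreeZ4 u) (Cod FreeZ4 u')"
    and c: "g \<cdot>\<^bsub>FreeZ4\<^esub> u = u' \<cdot>\<^bsub>FreeZ4\<^esub> f"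
  obtain X Y Z where uvw: "u \<in> HomF X Y" "v \<in> HomF Y Z" "w \<in> HomF Z X" and t: "tri X Y Z (lin u) (lin v) (lin w)"
    using T by (rule TriE)
  obtain X' Y' Z' where uvw': "u' \<in> HomF X' Y'" "v' \<in> HomF Y' Z'" "w' \<in> HomF Z' X'"
    and t': "tri X' Y' Z' (lin u') (lin v') (lin w')"
    using T' by (rule TriE)
  have fg: "f \<in> HomF X X'" "g \<in> HomF Y Y'"
    using f g HomD[OF uvw(1)] HomD[OF uvw'(1)] by simp_all
  note gu = Comp_Hom[OF uvw(1) fg(2)]
  have uf: "lin u' (lin f x) = lin (g \<cdot>\<^bsub>FreeZ4\<^esub> u) x" for x
    using Comp_Hom(2)[OF fg(1) uvw'(1)] c by simp
  obtain F f1 f2 where tf: "tri X X' F (lin f) (lin f1) (lin f2)"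
    by (rule Tri_exists[OF fg(1)])
  obtain G g1 g2 where tg: "tri Y Y' G (lin g) (lin g1) (lin g2)"
    by (rule Tri_exists[OF fg(2)])
  obtain A c1 c2 where tc: "tri X Y' A (lin (g \<cdot>\<^bsub>FreeZ4\<^esub> u)) (lin c1) (lin c2)"
    by (rule Tri_exists[OF gu(1)])
  obtain h where h: "h \<in> Lin Z Z'" "\<And>y. h (lin v y) = lin v' (lin g y)" "\<And>z. lin w' (h z) = lin f (lin w z)"
    using tri_fill_in[OF t t' tf tg tc gu(2)[symmetric] uf] by blast
  note hh = arr_Hom[OF h(1)]
  have "candidate_map FreeZ4 (u, v, w) (u', v', w') (f, g, arr Z Z' h)"
    using uvw uvw' fg hh c HomD[OF uvw(1)] HomD[OF uvw(2)] HomD[OF uvw(3)] HomD[OF uvw'(1)] HomD[OF uvw'(2)] HomD[OF uvw'(3)]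
    by (auto simp: Comp_eq_Comp_iff[OF uvw(2) hh fg(2) uvw'(2)] Comp_eq_Comp_iff[OF uvw(3) fg(1) hh uvw'(3)]
        arr_simps[OF h(1)] h)
  then show "\<exists>h. candidate_map FreeZ4 (u, v, w) (u', v', w') (f, g, h)" ..
next
  fix a a' a'' b b' b'' c' c''
  assume A: "(a, a', a'') \<in> Tri FreeZ4" and B: "(b, b', b'') \<in> Tri FreeZ4"
    and C: "(b \<cdot>\<^bsub>FreeZ4\<^esub> a, c', c'') \<in> Tri FreeZ4" and ba: "Dom FreeZ4 b = Cod FreeZ4 a"
  obtain P Q K where a: "a \<in> HomF P Q" "a' \<in> HomF Q K" "a'' \<in> HomF K P" and tA: "tri P Q K (lin a) (lin a') (lin a'')"
    using A by (rule TriE)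
  obtain Q' R M where b': "b \<in> HomF Q' R" "b' \<in> HomF R M" "b'' \<in> HomF M Q'" and tB': "tri Q' R M (lin b) (lin b') (lin b'')"
    using B by (rule TriE)
  have "Q' = Q"
    using ba HomD[OF a(1)] HomD[OF b'(1)] by simp
  note b = b'[unfolded this] and tB = tB'[unfolded this]
  note c = Comp_Hom[OF a(1) b(1)]
  obtain P' R' N where cc: "b \<cdot>\<^bsub>FreeZ4\<^esub> a \<in> HomF P' R'" "c' \<in> HomF R' N" "c'' \<in> HomF N P'"
    and tC': "tri P' R' N (lin (b \<cdot>\<^bsub>FreeZ4\<^esub> a)) (lin c') (lin c'')"
    using C by (rule TriE)
  have "P' = P" "R' = R"
    using HomD(1,2)[OF c(1)] HomD(1,2)[OF cc(1)] by simp_all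
  note c' = cc(2,3)[unfolded this] and tC = tC'[unfolded this]
  obtain \<alpha> \<beta> where t: "tri K N M \<alpha> \<beta> (lin a' \<circ> lin b'')" and r: "\<And>y. \<alpha> (lin a' y) = lin c' (lin b y)"
    "\<And>z. lin c'' (\<alpha> z) = lin a'' z" "\<And>y. \<beta> (lin c' y) = lin b' y" "\<And>z. lin b'' (\<beta> z) = lin a (lin c'' z)"
    using tri_octahedron[OF tA tB tC c(2)[symmetric]] by blast
  note \<alpha> = tri_Lin(1)[OF t] and \<beta> = tri_Lin(2)[OF t]
  note \<alpha>H = arr_Hom[OF \<alpha>] and \<beta>H = arr_Hom[OF \<beta>] and \<gamma>H = Comp_Hom[OF b(3) a(2)]
  have "lin (a' \<cdot>\<^bsub>FreeZ4\<^esub> b'') = lin a' \<circ> lin b''"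
    using \<gamma>H(2) by auto
  then have "(arr K N \<alpha>, arr N M \<beta>, a' \<cdot>\<^bsub>FreeZ4\<^esub> b'') \<in> Tri FreeZ4"
    using TriI[OF \<alpha>H \<beta>H \<gamma>H(1)] t by (simp add: arr_simps \<alpha> \<beta>)
  then have "octahedron FreeZ4 (a, a', a'') (b, b', b'') (b \<cdot>\<^bsub>FreeZ4\<^esub> a, c', c'') (arr K N \<alpha>, arr N M \<beta>, a' \<cdot>\<^bsub>FreeZ4\<^esub> b'')"
    using A B C ba \<alpha>H \<beta>H \<gamma>H(1) HomD(2)[OF a(2)] HomD(2)[OF b(2)] HomD(2)[OF c'(1)]
    by (simp add: Comp_eq_Comp_iff[OF a(2) \<alpha>H b(1) c'(1)] Comp_eq_iff[OF \<alpha>H c'(2) a(3)] Comp_eq_iff[OF c'(1) \<beta>H b(2)]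
        Comp_eq_Comp_iff[OF \<beta>H b(3) c'(2) a(1)] arr_simps \<alpha> \<beta> r)
  then show "\<exists>\<omega>. octahedron FreeZ4 (a, a', a'') (b, b', b'') (b \<cdot>\<^bsub>FreeZ4\<^esub> a, c', c'') \<omega>" ..
qed simp_all

section \<open>Maps of the triangle given by multiplication by 2\<close>

definition two :: nat where
  "two = arr 1 1 (dbl \<circ> trunc 1)"

definition nul :: nat where
  "nul = Zero FreeZ4 1 1"

abbreviation e :: vec where
  "e \<equiv> vcons 1 0"

lemma e_Vec: "e \<in> Vec 1"
  by simp

lemma dbl_e: "dbl e \<noteq> 0"
proof
  assume "dbl e = 0"
  then have "dbl e 0 = 0"
    by simp
  then show False
    by (simp add: dbl_def)
qed

lemma Lin_two: "dbl \<circ> trunc 1 \<in> Lin 1 1"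
  by (rule LinI) (simp_all add: trunc_add dbl_add)

lemma two_Hom: "two \<in> HomF 1 1"
  and lin_two: "lin two x = dbl (trunc 1 x)"
  and lin_two_Vec: "x \<in> Vec 1 \<Longrightarrow> lin two x = dbl x"
  unfolding two_def using arr_Hom[OF Lin_two] arr_simps(3)[OF Lin_two] by simp_all

lemma nul_Hom: "nul \<in> HomF 1 1"
  and lin_nul: "lin nul = 0"
  unfolding nul_def by (rule Zero_Hom lin_Zero)+

lemmas src_tgt = HomD(1,2)[OF two_Hom] HomD(1,2)[OF nul_Hom]

lemma dbl_add_self: "dbl x + dbl x = (0 :: vec)"
  using dbl_dbl[of x] unfolding dbl_def[of "dbl x"] .

lemma Tri_two: "(two, two, two) \<in> Tri FreeZ4"
proof (rule TriI[OF two_Hom two_Hom two_Hom], rule triI)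
  show "lin two \<in> Lin 1 1" "lin two \<in> Lin 1 1" "lin two \<in> Lin 1 1"
    using HomD(3)[OF two_Hom] by auto
  fix x :: vec assume x: "x \<in> Vec 1"
  show "lin two (lin two x) = 0" "lin two (lin two x) = 0" "lin two (lin two x) = 0"
    using x by (simp_all add: lin_two)
  assume "lin two x = 0"
  then obtain t where "t \<in> Vec 1" "x = dbl t"
    using dbl_eq_0[OF x] x by (auto simp: lin_two)
  then have ex: "\<exists>t\<in>Vec 1. x = lin two t"
    by (intro bexI[of _ t]) (simp_all add: lin_two)
  show "\<exists>t\<in>Vec 1. x = lin two t" "\<exists>t\<in>Vec 1. x = lin two t" "\<exists>t\<in>Vec 1. x = lin two t"
    by (fact ex)+
next
  fix y z assume "y \<in> Vec 1" "z \<in> Vec 1" "lin two y = dbl z"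
  then show "\<exists>x\<in>Vec 1. lin two z = dbl x \<and> lin two x = dbl y"
    \<comment> \<open>The hypothesis says \<open>dbl y = dbl z\<close>, so \<open>y\<close>
      represents all three classes and the monodromy is trivial.\<close>
    by (intro bexI[of _ y]) (simp_all add: lin_two)
qed

lemma TriE_Hom:
  assumes "(u, v, w) \<in> Tri FreeZ4" "u \<in> HomF X Y"
  obtains Z where "v \<in> HomF Y Z" "w \<in> HomF Z X" "tri X Y Z (lin u) (lin v) (lin w)"
  using assms(1)
proof (rule TriE)
  fix X' Y' Z
  assume *: "u \<in> HomF X' Y'" "v \<in> HomF Y' Z" "w \<in> HomF Z X'" "tri X' Y' Z (lin u) (lin v) (lin w)"
  then have "X' = X" "Y' = Y"
    using assms(2) HomD(1,2) by metis+
  with * that show thesis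
    by blast
qed

lemma triangle_map_two_two: "triangle_map FreeZ4 (two, two, two) (two, two, two) (two, two, two)"
  using Tri_two two_Hom by (auto simp: triangle_map_def src_tgt)

lemma triangle_map_zero_two: "triangle_map FreeZ4 (two, two, two) (two, two, two) (nul, nul, two)"
  using Tri_two two_Hom nul_Hom
  by (auto simp: triangle_map_def src_tgt lin_two lin_nul Comp_eq_Comp_iff[OF two_Hom two_Hom nul_Hom two_Hom]
      Comp_eq_Comp_iff[OF two_Hom nul_Hom two_Hom two_Hom] Comp_eq_Comp_iff[OF two_Hom nul_Hom nul_Hom two_Hom])

section \<open>Middling goodness of the two maps\<close>

lemma middling_good_two_two: "middling_good FreeZ4 (two, two, two) (two, two, two) (two, two, two)"
proof -
  \<comment> \<open>The anticommuting square: both sides are 0 because 4 = 0.\<close>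
  have "two \<cdot>\<^bsub>FreeZ4\<^esub> two = neg FreeZ4 (two \<cdot>\<^bsub>FreeZ4\<^esub> two)"
    using Comp_Hom[OF two_Hom two_Hom] neg_Hom[OF Comp_Hom(1)[OF two_Hom two_Hom]]
    by (intro Hom_eqI[of _ 1 1]) (simp_all add: lin_two)
  then show ?thesis
    using Tri_two two_Hom unfolding middling_good.simps by (intro exI[of _ two]) (simp add: src_tgt)
qed

text \<open>As g = 0, the map g'' is onto, so some \<open>y\<close> lies over 1. Its image
  \<open>z\<close> in Z'' then has h''(\<open>z\<close>) = 2, to which the monodromy of the triangle
  on h = 2 applies.\<close>

lemma not_middling_good_zero_two: "\<not> middling_good FreeZ4 (two, two, two) (two, two, two) (nul, nul, two)"
proof
  assume "middling_good FreeZ4 (two, two, two) (two, two, two) (nul, nul, two)"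
  then obtain f1 f2 g1 g2 h1 h2 r s t where
    f: "(nul, f1, f2) \<in> Tri FreeZ4" and g: "(nul, g1, g2) \<in> Tri FreeZ4" and h: "(two, h1, h2) \<in> Tri FreeZ4"
    and rst: "r \<in> HomF (tgt f1) (tgt g1)" "s \<in> HomF (tgt g1) (tgt h1)" "t \<in> HomF (tgt h1) (tgt f1)"
      "(r, s, t) \<in> Tri FreeZ4"
    and ft: "f1 \<cdot>\<^bsub>FreeZ4\<^esub> two = t \<cdot>\<^bsub>FreeZ4\<^esub> h1" and hs: "h2 \<cdot>\<^bsub>FreeZ4\<^esub> s = two \<cdot>\<^bsub>FreeZ4\<^esub> g2"
    by auto
  obtain X where X: "f1 \<in> HomF 1 X" "f2 \<in> HomF X 1" "tri 1 1 X (lin nul) (lin f1) (lin f2)"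
    using TriE_Hom[OF f nul_Hom] by metis
  obtain Y where Y: "g1 \<in> HomF 1 Y" "g2 \<in> HomF Y 1" "tri 1 1 Y (lin nul) (lin g1) (lin g2)"
    using TriE_Hom[OF g nul_Hom] by metis
  obtain Z where Z: "h1 \<in> HomF 1 Z" "h2 \<in> HomF Z 1" "tri 1 1 Z (lin two) (lin h1) (lin h2)"
    using TriE_Hom[OF h two_Hom] by metis
  have r: "r \<in> HomF X Y" and s: "s \<in> HomF Y Z" and t: "t \<in> HomF Z X"
    using rst HomD(2)[OF X(1)] HomD(2)[OF Y(1)] HomD(2)[OF Z(1)] by simp_all
  have T: "tri X Y Z (lin r) (lin s) (lin t)"
    using TriE_Hom[OF rst(4) r] HomD(2)[OF s] by (metis HomD(2))
  obtain y where y: "y \<in> Vec Y" "e = lin g2 y"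
    using tri_exact(3)[OF Y(3) e_Vec] by (auto simp: lin_nul)
  define z where "z = lin s y"
  have z: "z \<in> Vec Z"
    unfolding z_def using Lin_Vec[OF HomD(3)[OF s]] .
  have "lin h2 z = dbl e"
    using hs unfolding z_def Comp_eq_Comp_iff[OF s Z(2) Y(2) two_Hom] by (simp add: lin_two flip: y(2))
  \<comment> \<open>This \<open>x\<close> is odd with h'(\<open>x\<close>) = 2\<open>z\<close>.
    Since \<open>z\<close> comes from Y'', \<open>t\<close> kills 2\<open>z\<close>, and
    commutativity gives f'(2\<open>x\<close>) = 0, where 2\<open>x\<close> = 2.\<close>
  then obtain x where x: "x \<in> Vec 1" "lin two e = dbl x" "lin h1 x = dbl z"
    using tri_half[OF tri_rotate[OF Z(3)] z e_Vec] by blast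
  have "lin t (lin h1 x) = 0"
    using tri_zero(2)[OF T, of y] by (simp add: x(3) Lin_dbl[OF HomD(3)[OF t]] flip: z_def)
  then have "lin f1 (dbl x) = 0"
    using ft x(1) unfolding Comp_eq_Comp_iff[OF two_Hom X(1) Z(1) t] by (metis lin_two_Vec)
  then have "\<exists>x'\<in>Vec 1. dbl x = lin nul x'"
    using tri_exact(1)[OF X(3) Vec_dbl[OF x(1)]] by blast
  then show False
    using x(2) dbl_e by (simp add: lin_nul lin_two)
qed

text \<open>The octahedral relations give \<alpha>(1) = \<open>c1\<close>(1) + 2\<open>b\<close>
  with 2\<open>c2\<close>(\<open>b\<close>) = 2, and also 2\<beta>(\<open>b\<close>) =
  2\<open>c2\<close>(\<open>b\<close>). So \<beta>\<alpha>(1) is \<beta>\<open>c1\<close>(1) +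
  2\<beta>(\<open>b\<close>) = 2 + 2 = 0, not 2.\<close>

lemma not_verdier_good_two_two: "\<not> verdier_good FreeZ4 (two, two, two) (two, two, two) (two, two, two)"
proof
  assume "verdier_good FreeZ4 (two, two, two) (two, two, two) (two, two, two)"
  then obtain c1 c2 \<alpha> \<beta> where c: "(two \<cdot>\<^bsub>FreeZ4\<^esub> two, c1, c2) \<in> Tri FreeZ4"
    and \<alpha>: "\<alpha> \<in> HomF 1 (tgt c1)" "\<alpha> \<cdot>\<^bsub>FreeZ4\<^esub> two = c1 \<cdot>\<^bsub>FreeZ4\<^esub> two" "c2 \<cdot>\<^bsub>FreeZ4\<^esub> \<alpha> = two"
    and \<beta>: "\<beta> \<in> HomF (tgt c1) 1" "\<beta> \<cdot>\<^bsub>FreeZ4\<^esub> c1 = two" "two \<cdot>\<^bsub>FreeZ4\<^esub> \<beta> = two \<cdot>\<^bsub>FreeZ4\<^esub> c2"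
    and h: "two = \<beta> \<cdot>\<^bsub>FreeZ4\<^esub> \<alpha>"
    by (auto simp: src_tgt)
  obtain A where c12: "c1 \<in> HomF 1 A" "c2 \<in> HomF A 1" and t: "tri 1 1 A (lin (two \<cdot>\<^bsub>FreeZ4\<^esub> two)) (lin c1) (lin c2)"
    using TriE_Hom[OF c Comp_Hom(1)[OF two_Hom two_Hom]] by metis
  have A: "\<alpha> \<in> HomF 1 A" "\<beta> \<in> HomF A 1"
    using \<alpha>(1) \<beta>(1) HomD(2)[OF c12(1)] by simp_all
  note l\<alpha> = HomD(3)[OF A(1)] and l\<beta> = HomD(3)[OF A(2)] and lc1 = HomD(3)[OF c12(1)] and lc2 = HomD(3)[OF c12(2)]
  define a where "a = lin \<alpha> e"
  have "lin \<alpha> (lin two e) = lin c1 (lin two e)"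
    using \<alpha>(2) unfolding Comp_eq_Comp_iff[OF two_Hom A(1) two_Hom c12(1)] by blast
  then have "dbl (a - lin c1 e) = 0"
    by (simp add: lin_two a_def Lin_dbl[OF l\<alpha>] Lin_dbl[OF lc1] dbl_diff)
  then obtain b where b: "b \<in> Vec A" "a - lin c1 e = dbl b"
    using dbl_eq_0 Vec_diff Lin_Vec[OF l\<alpha>] Lin_Vec[OF lc1] unfolding a_def by metis
  then have a: "a = lin c1 e + dbl b"
    by (simp add: algebra_simps)
  have "lin c2 a = dbl e"
    using \<alpha>(3) unfolding Comp_eq_iff[OF A(1) c12(2) two_Hom] a_def by (simp add: lin_two)
  then have cb: "dbl (lin c2 b) = dbl e"
    unfolding a by (simp add: Lin_add[OF lc2] Lin_dbl[OF lc2] tri_zero[OF t])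
  have "lin \<beta> (lin c1 e) = dbl e"
    using \<beta>(2) unfolding Comp_eq_iff[OF c12(1) A(2) two_Hom] by (simp add: lin_two)
  moreover have "lin two (lin \<beta> b) = lin two (lin c2 b)"
    using \<beta>(3) unfolding Comp_eq_Comp_iff[OF A(2) two_Hom c12(2) two_Hom] by blast
  then have "dbl (lin \<beta> b) = dbl e"
    using Lin_Vec[OF l\<beta>] Lin_Vec[OF lc2] by (simp add: lin_two cb)
  ultimately have "lin \<beta> a = dbl e + dbl e"
    unfolding a Lin_add[OF l\<beta>] Lin_dbl[OF l\<beta>] by (rule arg_cong2)
  moreover have "lin \<beta> a = dbl e"
    using h[symmetric] unfolding Comp_eq_iff[OF A two_Hom] a_def by (simp add: lin_two)
  ultimately show False
    using dbl_e dbl_add_self[of e] by metis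
qed

section \<open>The mapping cone of (2, 2, 2)\<close>

lemma upper_matrix_Hom:
  assumes p: "p \<in> HomF S A" and q: "q \<in> HomF S B" and i: "i \<in> HomF A' S'" and j: "j \<in> HomF B' S'"
    and a: "a \<in> HomF A A'" and b: "b \<in> HomF B A'" and d: "d \<in> HomF B B'"
  shows "upper_matrix FreeZ4 i j p q a b d \<in> HomF S S'"
    and "lin (upper_matrix FreeZ4 i j p q a b d) x =
      lin i (lin a (lin p x)) + lin i (lin b (lin q x)) + lin j (lin d (lin q x))"
proof -
  note ia = Comp_Hom[OF a i] and ib = Comp_Hom[OF b i] and jd = Comp_Hom[OF d j]
  note iap = Comp_Hom[OF p ia(1)] and ibq = Comp_Hom[OF q ib(1)] and jdq = Comp_Hom[OF q jd(1)]
  note s = Add_Hom[OF iap(1) ibq(1)]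
  show "upper_matrix FreeZ4 i j p q a b d \<in> HomF S S'"
    "lin (upper_matrix FreeZ4 i j p q a b d) x =
      lin i (lin a (lin p x)) + lin i (lin b (lin q x)) + lin j (lin d (lin q x))"
    unfolding upper_matrix_def using Add_Hom[OF s(1) jdq(1)] s(2) iap(2) ibq(2) jdq(2) ia(2) ib(2) jd(2)
    by simp_all
qed

lemma biproduct_11E:
  assumes "biproduct FreeZ4 1 1 B"
  obtains S i j p q where "B = (S, i, j, p, q)"
    "i \<in> HomF 1 S" "j \<in> HomF 1 S" "p \<in> HomF S 1" "q \<in> HomF S 1"
    "\<forall>x\<in>Vec 1. lin p (lin i x) = x" "\<forall>x\<in>Vec 1. lin q (lin j x) = x"
    "\<forall>x. lin p (lin j x) = 0" "\<forall>x. lin q (lin i x) = 0"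
proof -
  obtain S i j p q where B: "B = (S, i, j, p, q)"
    by (metis prod_cases5)
  have H: "i \<in> HomF 1 S" "j \<in> HomF 1 S" "p \<in> HomF S 1" "q \<in> HomF S 1"
    and c: "p \<cdot>\<^bsub>FreeZ4\<^esub> i = Id FreeZ4 1" "q \<cdot>\<^bsub>FreeZ4\<^esub> j = Id FreeZ4 1" "p \<cdot>\<^bsub>FreeZ4\<^esub> j = nul" "q \<cdot>\<^bsub>FreeZ4\<^esub> i = nul"
    using assms unfolding B nul_def by simp_all
  show thesis
    using that[OF B H] c[unfolded Comp_eq_iff[OF H(1,3) Id_Hom] Comp_eq_iff[OF H(2,4) Id_Hom]
        Comp_eq_iff[OF H(2,3) nul_Hom] Comp_eq_iff[OF H(1,4) nul_Hom]]
    by (simp add: lin_Id lin_nul)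
qed

text \<open>Modulo 2 each connecting map of the cone is [1 1; 0 1]. The monodromy is its cube, which
  is the same matrix because 3 is odd.\<close>

lemma not_good_two_two: "\<not> good FreeZ4 (two, two, two) (two, two, two) (two, two, two)"
proof
  assume "good FreeZ4 (two, two, two) (two, two, two) (two, two, two)"
  then obtain B1 B2 B3 where B: "biproduct FreeZ4 1 1 B1" "biproduct FreeZ4 1 1 B2" "biproduct FreeZ4 1 1 B3"
    and cone: "mapping_cone FreeZ4 (two, two, two) (two, two, two) (two, two, two) B1 B2 B3 \<in> Tri FreeZ4"
    unfolding good.simps by (auto simp del: biproduct.simps mapping_cone.simps simp: src_tgt)
  obtain S1 i1 j1 p1 q1 where B1: "B1 = (S1, i1, j1, p1, q1)"
    and H1: "i1 \<in> HomF 1 S1" "j1 \<in> HomF 1 S1" "p1 \<in> HomF S1 1" "q1 \<in> HomF S1 1"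
    and c1: "\<forall>x\<in>Vec 1. lin p1 (lin i1 x) = x" "\<forall>x\<in>Vec 1. lin q1 (lin j1 x) = x"
      "\<forall>x. lin p1 (lin j1 x) = 0" "\<forall>x. lin q1 (lin i1 x) = 0"
    using B(1) by (rule biproduct_11E)
  obtain S2 i2 j2 p2 q2 where B2: "B2 = (S2, i2, j2, p2, q2)"
    and H2: "i2 \<in> HomF 1 S2" "j2 \<in> HomF 1 S2" "p2 \<in> HomF S2 1" "q2 \<in> HomF S2 1"
    and c2: "\<forall>x\<in>Vec 1. lin p2 (lin i2 x) = x" "\<forall>x\<in>Vec 1. lin q2 (lin j2 x) = x"
      "\<forall>x. lin p2 (lin j2 x) = 0" "\<forall>x. lin q2 (lin i2 x) = 0"
    using B(2) by (rule biproduct_11E)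
  obtain S3 i3 j3 p3 q3 where B3: "B3 = (S3, i3, j3, p3, q3)"
    and H3: "i3 \<in> HomF 1 S3" "j3 \<in> HomF 1 S3" "p3 \<in> HomF S3 1" "q3 \<in> HomF S3 1"
    and c3: "\<forall>x\<in>Vec 1. lin p3 (lin i3 x) = x" "\<forall>x\<in>Vec 1. lin q3 (lin j3 x) = x"
      "\<forall>x. lin p3 (lin j3 x) = 0" "\<forall>x. lin q3 (lin i3 x) = 0"
    using B(3) by (rule biproduct_11E)
  have neg: "lin (neg FreeZ4 two) x = lin two x" for x
    using neg_Hom(2)[OF two_Hom] by (simp add: lin_two)
  define U V W where "U = upper_matrix FreeZ4 i2 j2 p1 q1 two two (neg FreeZ4 two)"
    and "V = upper_matrix FreeZ4 i3 j3 p2 q2 two two (neg FreeZ4 two)"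
    and "W = upper_matrix FreeZ4 i1 j1 p3 q3 two two (neg FreeZ4 two)"
  note u = upper_matrix_Hom[OF _ _ _ _ two_Hom two_Hom neg_Hom(1)[OF two_Hom]]
  have U: "U \<in> HomF S1 S2" "lin U x = lin i2 (lin two (lin p1 x)) + lin i2 (lin two (lin q1 x)) + lin j2 (lin two (lin q1 x))" for x
    unfolding U_def using u[OF H1(3,4) H2(1,2)] by (simp_all add: neg)
  have V: "V \<in> HomF S2 S3" "lin V x = lin i3 (lin two (lin p2 x)) + lin i3 (lin two (lin q2 x)) + lin j3 (lin two (lin q2 x))" for x
    unfolding V_def using u[OF H2(3,4) H3(1,2)] by (simp_all add: neg)
  have W: "W \<in> HomF S3 S1" "lin W x = lin i1 (lin two (lin p3 x)) + lin i1 (lin two (lin q3 x)) + lin j1 (lin two (lin q3 x))" for x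
    unfolding W_def using u[OF H3(3,4) H1(1,2)] by (simp_all add: neg)
  have "(U, V, W) \<in> Tri FreeZ4"
    using cone unfolding B1 B2 B3 U_def V_def W_def by simp
  then have T: "tri S1 S2 S3 (lin U) (lin V) (lin W)"
    using TriE_Hom[OF _ U(1)] HomD(2)[OF V(1)] by (metis HomD(2))
  note l = Lin_simps[OF HomD(3)[OF H1(1)]] Lin_simps[OF HomD(3)[OF H1(2)]] Lin_simps[OF HomD(3)[OF H1(3)]] Lin_simps[OF HomD(3)[OF H1(4)]]
    Lin_simps[OF HomD(3)[OF H2(1)]] Lin_simps[OF HomD(3)[OF H2(2)]] Lin_simps[OF HomD(3)[OF H2(3)]] Lin_simps[OF HomD(3)[OF H2(4)]]
    Lin_simps[OF HomD(3)[OF H3(1)]] Lin_simps[OF HomD(3)[OF H3(2)]] Lin_simps[OF HomD(3)[OF H3(3)]] Lin_simps[OF HomD(3)[OF H3(4)]]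
    Lin_simps[OF HomD(3)[OF two_Hom]]
  \<comment> \<open>The second basis vector, which the monodromy moves, and its image under the
    first connecting map.\<close>
  let ?y = "lin j2 e" and ?z = "lin i3 e + lin j3 e"
  have y: "?y \<in> Vec S2" and z: "?z \<in> Vec S3"
    using Lin_Vec[OF HomD(3)[OF H2(2)]] Lin_Vec[OF HomD(3)[OF H3(1)]] Lin_Vec[OF HomD(3)[OF H3(2)]] by simp_all
  have "lin V ?y = dbl ?z"
    by (simp add: V c2 c3 lin_two l dbl_add)
  then obtain x where x: "x \<in> Vec S1" "lin W ?z = dbl x" "lin U x = dbl ?y"
    using tri_half[OF T y z] by blast
  have "lin W ?z = dbl (lin i1 e) + dbl (lin i1 e) + dbl (lin j1 e)"
    by (simp add: W c3 lin_two l)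
  then have "dbl x = lin j1 (dbl e)"
    unfolding x(2) dbl_add_self by (simp add: l)
  \<comment> \<open>The double of \<open>x\<close> fixes \<open>x\<close> modulo 2, hence
    \<open>lin U x\<close>; the extra term from \<open>i2\<close> is the off-diagonal entry of the
    monodromy.\<close>
  then have "dbl (lin p1 x) = 0" "dbl (lin q1 x) = dbl e"
    using l c1 by (metis Vec_dbl e_Vec)+
  then have "lin U x = lin i2 (dbl e) + lin j2 (dbl e)"
    using Lin_Vec[OF HomD(3)[OF H1(3)]] Lin_Vec[OF HomD(3)[OF H1(4)]] by (simp add: U lin_two l)
  then have "lin i2 (dbl e) = 0"
    using x(3) by (simp add: l)
  then have "dbl e = 0"
    using bspec[OF c2(1) Vec_dbl[OF e_Vec]] l by metis
  with dbl_e show False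
    by blast
qed

lemma chain_homotopic_two:
  "chain_homotopic FreeZ4 (two, two, two) (two, two, two) (two, two, two) (nul, nul, two)"
proof -
  have inv: "inv_into (HomF 1 1) (Sh FreeZ4) f = f" if "f \<in> HomF 1 1" for f
    using inv_into_f_f[of "Sh FreeZ4" "HomF 1 1" f] that by (simp add: Sh_FreeZ4 inj_on_def)
  note id = Id_Hom[of 1]
  have sub: "sub FreeZ4 f g \<in> HomF 1 1" "lin (sub FreeZ4 f g) x = lin f x - lin g x"
    if "f \<in> HomF 1 1" "g \<in> HomF 1 1" for f g x
    using Add_Hom[OF that(1) neg_Hom(1)[OF that(2)]] neg_Hom(2)[OF that(2)] unfolding sub_def by simp_all
  have comp: "g \<cdot>\<^bsub>FreeZ4\<^esub> f \<in> HomF 1 1" if "f \<in> HomF 1 1" "g \<in> HomF 1 1" for f g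
    using Comp_Hom(1)[OF that] .
  \<comment> \<open>The homotopy is F = id, G = H = 0: it contributes 2 = 0 - 2 to the first two
    components and nothing to the third.\<close>
  have "sub FreeZ4 nul two = (Id FreeZ4 1 \<cdot>\<^bsub>FreeZ4\<^esub> two) \<boxplus>\<^bsub>FreeZ4\<^esub> (two \<cdot>\<^bsub>FreeZ4\<^esub> nul)"
    "sub FreeZ4 nul two = (nul \<cdot>\<^bsub>FreeZ4\<^esub> two) \<boxplus>\<^bsub>FreeZ4\<^esub> (two \<cdot>\<^bsub>FreeZ4\<^esub> Id FreeZ4 1)"
    "sub FreeZ4 two two = (nul \<cdot>\<^bsub>FreeZ4\<^esub> two) \<boxplus>\<^bsub>FreeZ4\<^esub> (two \<cdot>\<^bsub>FreeZ4\<^esub> nul)"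
    by (rule Hom_eqI[of _ 1 1]; simp add: sub comp two_Hom nul_Hom id Add_Hom[of _ 1 1] Comp_Hom[of _ 1 1 _ 1]
        lin_two lin_Id lin_nul del: One_nat_def)+
  then show ?thesis
    unfolding chain_homotopic.simps
    by (intro exI[of _ "Id FreeZ4 1"] exI[of _ nul]) (simp add: src_tgt id nul_Hom two_Hom inv comp del: One_nat_def)
qed

theorem corollary8p4:
  shows
    "(\<exists>C :: countable_tricat. triangulated_category C \<and>
        (\<exists>T T' \<phi>. triangle_map C T T' \<phi> \<and> \<not> middling_good C T T' \<phi>)) \<and>
     (\<exists>C :: countable_tricat. triangulated_category C \<and>
        (\<exists>T T' \<phi>. triangle_map C T T' \<phi> \<and>
           middling_good C T T' \<phi> \<and> \<not> good C T T' \<phi> \<and> \<not> verdier_good C T T' \<phi>)) \<and>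
     (\<exists>C :: countable_tricat. triangulated_category C \<and>
        (\<exists>T T' \<phi> \<psi>. triangle_map C T T' \<phi> \<and> triangle_map C T T' \<psi> \<and>
           chain_homotopic C T T' \<phi> \<psi> \<and>
           middling_good C T T' \<phi> \<and> \<not> middling_good C T T' \<psi>))"
  using triangulated_FreeZ4 triangle_map_zero_two triangle_map_two_two chain_homotopic_two
    not_middling_good_zero_two middling_good_two_two not_good_two_two not_verdier_good_two_two
  by blast

end
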